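(* Let $\lambda\in(0,1)$. For every $t\in\mathbb{R}$, $$ P(\Phi_t)=\begin{cases}\log\psi(t) & \text{if }\lambda^t\le\frac12,\\[1mm] \log\left[4\lambda^t(1-\lambda)^t\right] & \text{if }\lambda^t\ge\frac12,\end{cases} \qquad\text{where }\psi(t):=\frac{(1-\lambda)^t}{1-\lambda^t}, $$ so the function $t\mapsto P(\Phi_t)$ has a second order phase transition at $t_0=\frac{-\log2}{\log\lambda}$. Moreover, there is an equilibrium state $\mu_t$ for $\Phi_t$ if $\lambda^t<\frac12$. If such an equilibrium state exists, it is unique and is absolutely continuous with respect to $m_t$. There is no equilibrium state for $\Phi_t$ when $\lambda^t\ge\frac12$; in particular (taking $t=0$), there is no measure of maximal entropy.
   Context: For $\lambda\in(0,1)$ and $n\ge1$ let $W_n:=(\lambda^n,\lambda^{n-1}]$, and define $F=F_\lambda:(0,1]\to(0,1]$ by $F_\lambda(x)=\frac{x-\lambda}{1-\lambda}$ if $x\in W_1$ and $F_\lambda(x)=\frac{x-\lambda^n}{\lambda(1-\lambda)}$ if $x\in W_n$, $n\ge2$. Let $\Phi_t:=-t\log|F_\lambda'|$, where at the discontinuity points the one-sided derivative of the branch containing the point is used, so $|F_\lambda'|=\frac1{1-\lambda}$ on $W_1$ and $|F_\lambda'|=\frac1{\lambda(1-\lambda)}$ on $W_n$, $n\ge2$. The pressure is $P(\Phi_t):=\sup\{h(\mu)+\int\Phi_t\,d\mu:\mu\in\mathcal{M},\ -\int\Phi_t\,d\mu<\infty\}$, where $\mathcal{M}$ is the set of $F_\lambda$-invariant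 Borel probability measures on $(0,1]$ and $h(\mu)$ is the measure-theoretic entropy. A measure $\mu\in\mathcal{M}$ with $h(\mu)+\int\Phi_t\,d\mu=P(\Phi_t)$ is an equilibrium state for $\Phi_t$; an equilibrium state for $\Phi_0=0$ is a measure of maximal entropy. The function $t\mapsto P(\Phi_t)$ has a $k$-th order phase transition at $t_0$ if it is $C^{k-1}$ but not $C^k$ at $t_0$. For $p\in\mathbb{R}$, a Borel probability measure $m$ on $(0,1]$ is $(t,p)$-conformal if $m(F(A))=\int_A e^{p-\Phi_t}\,dm$ whenever $A$ is a measurable set on which $F$ is one-to-one. Let $P_{\mathrm{Conf}}(\Phi_t)$ be the infimum of the $p\in\mathbb{R}$ for which a $(t,p)$-conformal measure exists, and let $m_t$ denote the $(t,p)$-conformal measure for $p=P_{\mathrm{Conf}}(\Phi_t)$. *)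

theory Defs
  imports "HOL-Probability.Probability"
begin

section \<open>The maps\<close>

text \<open>The interval \<open>(0,1]\<close> is the disjoint union of the \<open>W lam n\<close> with \<open>n \<ge> 1\<close>.\<close>

definition W :: "real \<Rightarrow> nat \<Rightarrow> real set" where
  "W lam n = {lam ^ n <.. lam ^ (n - 1)}"

definition branch :: "real \<Rightarrow> real \<Rightarrow> nat" where
  "branch lam x = (THE n. n \<ge> 1 \<and> x \<in> W lam n)"

text \<open>Only the values on \<open>(0,1]\<close> are meaningful.\<close>

definition F :: "real \<Rightarrow> real \<Rightarrow> real" where
  "F lam x = (let n = branch lam x in
     if n = 1 then (x - lam) / (1 - lam) else (x - lam ^ n) / (lam * (1 - lam)))"

text \<open>Differentiating within the interval of the branch gives the usual derivative at interior points
  and the one-sided derivative of the branch containing the point at the endpoints \<open>lam ^ (n - 1)\<close>.\<close>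

definition F_deriv :: "real \<Rightarrow> real \<Rightarrow> real" where
  "F_deriv lam x = vector_derivative (F lam) (at x within W lam (branch lam x))"

definition \<Phi> :: "real \<Rightarrow> real \<Rightarrow> real \<Rightarrow> real" where
  "\<Phi> lam t x = - t * ln \<bar>F_deriv lam x\<bar>"


section \<open>Measure-theoretic entropy\<close>

abbreviation finite_measurable_partition :: "'a measure \<Rightarrow> 'a set set \<Rightarrow> bool" where
  "finite_measurable_partition \<mu> \<xi> \<equiv> finite \<xi> \<and> \<xi> \<subseteq> sets \<mu> \<and> partition_on (space \<mu>) \<xi>"

text \<open>Recall that \<open>ln 0 = 0\<close>, so null atoms contribute nothing.\<close>

definition partition_entropy :: "'a measure \<Rightarrow> 'a set set \<Rightarrow> real" where
  "partition_entropy \<mu> \<xi> = - (\<Sum>A\<in>\<xi>. measure \<mu> A * ln (measure \<mu> A))"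

definition pullback :: "'a measure \<Rightarrow> ('a \<Rightarrow> 'a) \<Rightarrow> nat \<Rightarrow> 'a set set \<Rightarrow> 'a set set" where
  "pullback \<mu> T i \<xi> = (\<lambda>A. (T ^^ i) -` A \<inter> space \<mu>) ` \<xi> - {{}}"

definition iterated_join :: "'a measure \<Rightarrow> ('a \<Rightarrow> 'a) \<Rightarrow> nat \<Rightarrow> 'a set set \<Rightarrow> 'a set set" where
  "iterated_join \<mu> T n \<xi> = common_refinement ((\<lambda>i. pullback \<mu> T i \<xi>) ` {..<n})"

definition entropy_wrt :: "'a measure \<Rightarrow> ('a \<Rightarrow> 'a) \<Rightarrow> 'a set set \<Rightarrow> real" where
  "entropy_wrt \<mu> T \<xi> = lim (\<lambda>n. partition_entropy \<mu> (iterated_join \<mu> T n \<xi>) / real n)"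

definition ks_entropy :: "'a measure \<Rightarrow> ('a \<Rightarrow> 'a) \<Rightarrow> ereal" where
  "ks_entropy \<mu> T = (SUP \<xi> \<in> {\<xi>. finite_measurable_partition \<mu> \<xi>}. ereal (entropy_wrt \<mu> T \<xi>))"


section \<open>Pressure and equilibrium states\<close>

abbreviation unit_borel :: "real measure" where
  "unit_borel \<equiv> restrict_space borel {0<..1}"

definition invariant_measures :: "real \<Rightarrow> real measure set" where
  "invariant_measures lam = {\<mu>. prob_space \<mu> \<and> sets \<mu> = sets unit_borel \<and>
     (\<forall>A\<in>sets \<mu>. F lam -` A \<inter> space \<mu> \<in> sets \<mu> \<and> emeasure \<mu> (F lam -` A \<inter> space \<mu>) = emeasure \<mu> A)}"

text \<open>\<open>\<Phi> lam t\<close> has constant sign and takes at most two values on \<open>(0,1]\<close>; the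
  condition that the integral of \<open>- \<Phi> lam t\<close> be finite is integrability.\<close>

definition pressure :: "real \<Rightarrow> real \<Rightarrow> ereal" where
  "pressure lam t = (SUP \<mu> \<in> {\<mu> \<in> invariant_measures lam. integrable \<mu> (\<Phi> lam t)}.
     ks_entropy \<mu> (F lam) + ereal (\<integral>x. \<Phi> lam t x \<partial>\<mu>))"

definition equilibrium_state :: "real \<Rightarrow> real \<Rightarrow> real measure \<Rightarrow> bool" where
  "equilibrium_state lam t \<mu> \<longleftrightarrow> \<mu> \<in> invariant_measures lam \<and>
     ks_entropy \<mu> (F lam) + ereal (\<integral>x. \<Phi> lam t x \<partial>\<mu>) = pressure lam t"

definition measure_of_maximal_entropy :: "real \<Rightarrow> real measure \<Rightarrow> bool" where
  "measure_of_maximal_entropy lam \<mu> \<longleftrightarrow> equilibrium_state lam 0 \<mu>"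

definition \<psi> :: "real \<Rightarrow> real \<Rightarrow> real" where
  "\<psi> lam t = (1 - lam) powr t / (1 - lam powr t)"


section \<open>Conformal measures\<close>

definition conformal_measure :: "real \<Rightarrow> real \<Rightarrow> real \<Rightarrow> real measure \<Rightarrow> bool" where
  "conformal_measure lam t p m \<longleftrightarrow> prob_space m \<and> sets m = sets unit_borel \<and>
     (\<forall>A\<in>sets m. inj_on (F lam) A \<longrightarrow>
        F lam ` A \<in> sets m \<and> emeasure m (F lam ` A) = (\<integral>\<^sup>+x\<in>A. ennreal (exp (p - \<Phi> lam t x)) \<partial>m))"

definition P_Conf :: "real \<Rightarrow> real \<Rightarrow> ereal" where
  "P_Conf lam t = (INF p \<in> {p. \<exists>m. conformal_measure lam t p m}. ereal p)"

definition m_conf :: "real \<Rightarrow> real \<Rightarrow> real measure" where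
  "m_conf lam t = (THE m. \<exists>p. ereal p = P_Conf lam t \<and> conformal_measure lam t p m)"


section \<open>Phase transitions\<close>

definition C_k_at :: "nat \<Rightarrow> (real \<Rightarrow> real) \<Rightarrow> real \<Rightarrow> bool" where
  "C_k_at k f x \<longleftrightarrow> (\<exists>U. open U \<and> x \<in> U \<and>
     (\<forall>j<k. \<forall>y\<in>U. (deriv ^^ j) f field_differentiable (at y)) \<and>
     continuous_on U ((deriv ^^ k) f))"

definition phase_transition :: "nat \<Rightarrow> (real \<Rightarrow> real) \<Rightarrow> real \<Rightarrow> bool" where
  "phase_transition k f x \<longleftrightarrow> k \<ge> 1 \<and> C_k_at (k - 1) f x \<and> \<not> C_k_at k f x"

end

theory Submission
  imports Defs "HOL-Real_Asymp.Real_Asymp"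
begin

text \<open>
  Write \<open>s = lam powr t\<close> and let \<open>M\<close> be the mass that an invariant measure \<open>\<mu>\<close> gives to the complement of
  \<open>W lam 1\<close>. The potential takes two values, so its integral is \<open>t * ln (1 - lam) + M * ln s\<close>, and the pressure
  is \<open>t * ln (1 - lam)\<close> plus the supremum of \<open>h(\<mu>) + M * ln s\<close>. This supremum depends on \<open>s\<close> only: a
  point is determined by its itinerary \<open>n\<^sub>0, n\<^sub>1, \<dots>\<close> through the sets \<open>W lam n\<close>, and the admissible
  itineraries, those with \<open>n\<^sub>i \<le> n\<^sub>i\<^sub>+\<^sub>1 + 1\<close>, are the same for all \<open>lam\<close>.

  Given the next symbol \<open>k\<close>, the present symbol \<open>j\<close> lies in \<open>{1..k + 1}\<close>, and for \<open>0 < s < 1\<close> the numbers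
  \<open>geom_kernel s j k\<close>, namely \<open>(1 - s) ^ (k - j)\<close> times \<open>1 - s\<close> for \<open>j = 1\<close> and times \<open>s * (1 - s)\<close> for
  \<open>j \<ge> 2\<close>, form a probability law on this set. Coding orbits backwards by this law costs
  \<open>entropy_rate s M = - ln (1 - s) - M * ln s\<close> per step, since the coboundary \<open>k - j\<close> has mean zero; by Gibbs'
  inequality this bounds the entropy (\<open>ks_entropy_le_kernel\<close>, \<open>ks_entropy_le_rate\<close>). Unbounded symbols do
  no harm: after truncating them at \<open>N\<close> the bound is the same for all \<open>N\<close>. Used with \<open>s\<close> itself for
  \<open>s \<le> 1 / 2\<close> and with \<open>1 / 2\<close> otherwise, it gives the upper bound for the pressure.

  If \<open>\<mu>\<close> attains the bound, then its symbols follow this law exactly, for otherwise tilting the law after a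
  single word would give a better bound (\<open>prob_cyl_Cons_of_maximal\<close>). Such a \<open>\<mu>\<close> has density proportional to
  \<open>(1 - s) powr (- n)\<close> on \<open>W lam n\<close> with respect to a measure that the \<open>n\<close>-th inverse branch scales by
  \<open>slope s n\<close>. The scaling measure is unique (\<open>branch_scaling_unique\<close>) and gives \<open>W lam n\<close> mass
  \<open>(1 - s) * s ^ (n - 1)\<close>, so \<open>\<mu> (W lam n)\<close> is proportional to \<open>(s / (1 - s)) ^ n\<close>. For \<open>s < 1 / 2\<close>
  this determines \<open>\<mu>\<close>; for \<open>s = 1 / 2\<close>, the parameter to compare with whenever \<open>lam powr t \<ge> 1 / 2\<close>, it is
  impossible for a probability measure.

  Conversely, for the map with parameter \<open>s\<close> in place of \<open>lam\<close> Lebesgue measure has the scaling property,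
  and the map matching itineraries carries it to the parameter \<open>lam\<close>. Multiplied by the density above it gives,
  for \<open>s < 1 / 2\<close>, an invariant measure of entropy \<open>entropy_rate s M\<close> (\<open>ks_entropy_equilibrium_measure\<close>). It is
  the equilibrium state, and letting its parameter tend to \<open>1 / 2\<close> gives the lower bound for the pressure when
  \<open>lam powr t \<ge> 1 / 2\<close>.

  A probability measure is conformal if and only if it scales along the branches with suitable factors. Let
  \<open>s < 1 / 2\<close>. For \<open>p = ln (\<psi> lam t)\<close> these factors are the numbers \<open>slope s n\<close>, and for smaller \<open>p\<close> the masses
  of the intervals \<open>{0<..lam ^ n}\<close> would become negative (\<open>branch_scaling_factor_le\<close>); so the scaling measure is \<open>m_conf lam t\<close>, and the equilibrium state has a density
  with respect to it. Finally, the two formulas for the pressure agree to first but not to second order at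
  \<open>s = 1 / 2\<close>.
\<close>


section \<open>Entropy of finite-valued observables\<close>

definition level_set :: "'a measure \<Rightarrow> ('a \<Rightarrow> 'b) \<Rightarrow> 'b \<Rightarrow> 'a set" where
  "level_set M f v = f -` {v} \<inter> space M"

definition obs_entropy :: "'a measure \<Rightarrow> ('a \<Rightarrow> 'b) \<Rightarrow> real" where
  "obs_entropy M f = (\<integral>x. - ln (measure M (level_set M f (f x))) \<partial>M)"

lemma level_set_sets: "simple_function M f \<Longrightarrow> level_set M f v \<in> sets M"
  by (auto simp: level_set_def simple_functionD)

lemma (in finite_measure)
  fixes g :: "'b \<Rightarrow> real"
  assumes "simple_function M f"
  shows integrable_simple_function_compose: "integrable M (\<lambda>x. g (f x))"
    and integral_simple_function_compose:
      "(\<integral>x. g (f x) \<partial>M) = (\<Sum>v\<in>f ` space M. measure M (level_set M f v) * g v)"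
proof -
  have fin: "finite (f ` space M)" using assms by (simp add: simple_function_def)
  have rep: "g (f x) = (\<Sum>v\<in>f ` space M. indicator (level_set M f v) x * g v)" if "x \<in> space M" for x
  proof -
    have "(\<Sum>v\<in>f ` space M. indicator (level_set M f v) x * g v)
        = (\<Sum>v\<in>f ` space M. if v = f x then g v else 0)"
      using that by (intro sum.cong) (auto simp: level_set_def indicator_def)
    also have "\<dots> = g (f x)" using fin that by simp
    finally show ?thesis by simp
  qed
  have int: "integrable M (\<lambda>x. indicator (level_set M f v) x * g v)" for v
    using level_set_sets[OF assms, of v]
    by (intro integrable_mult_left) (auto simp: emeasure_finite less_top[symmetric])
  have intS: "integrable M (\<lambda>x. \<Sum>v\<in>f ` space M. indicator (level_set M f v) x * g v)"
    by (intro Bochner_Integration.integrable_sum int)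
  then show "integrable M (\<lambda>x. g (f x))"
    using rep by (subst Bochner_Integration.integrable_cong[OF refl rep]) auto
  have "(\<integral>x. g (f x) \<partial>M) = (\<integral>x. (\<Sum>v\<in>f ` space M. indicator (level_set M f v) x * g v) \<partial>M)"
    by (intro Bochner_Integration.integral_cong rep refl)
  also have "\<dots> = (\<Sum>v\<in>f ` space M. measure M (level_set M f v) * g v)"
    using int level_set_sets[OF assms]
    by (subst Bochner_Integration.integral_sum) (auto simp: level_set_def Int_absorb2 sets.sets_into_space)
  finally show "(\<integral>x. g (f x) \<partial>M) = (\<Sum>v\<in>f ` space M. measure M (level_set M f v) * g v)" .
qed

lemma (in prob_space) sum_prob_level_set:
  "simple_function M f \<Longrightarrow> (\<Sum>v\<in>f ` space M. prob (level_set M f v)) = 1"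
  using integral_simple_function_compose[of f "\<lambda>_. 1"] by (simp add: prob_space)

lemma (in prob_space) partition_entropy_level_sets:
  assumes "simple_function M f"
  shows "partition_entropy M (level_set M f ` (f ` space M)) = obs_entropy M f"
proof -
  have inj: "inj_on (level_set M f) (f ` space M)"
    by (auto simp: inj_on_def level_set_def)
  show ?thesis
    unfolding partition_entropy_def obs_entropy_def
      integral_simple_function_compose[OF assms, of "\<lambda>v. - ln (prob (level_set M f v))"]
    by (simp add: sum.reindex[OF inj] sum_negf)
qed

text \<open>Gibbs' inequality: a code that is optimal for another law \<open>Q\<close> costs at least the entropy, because
  \<open>ln\<close> lies below its tangent at 1.\<close>

lemma (in prob_space) obs_entropy_le_cross_entropy:
  assumes f: "simple_function M f"
    and pos: "\<And>v. v \<in> f ` space M \<Longrightarrow> prob (level_set M f v) > 0 \<Longrightarrow> Q v > 0"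
    and nonneg: "\<And>v. v \<in> f ` space M \<Longrightarrow> Q v \<ge> 0"
    and sum: "(\<Sum>v\<in>f ` space M. Q v) \<le> 1"
  shows "obs_entropy M f \<le> (\<integral>x. - ln (Q (f x)) \<partial>M)"
proof -
  let ?p = "\<lambda>v. prob (level_set M f v)"
  have "?p v * ln (Q v) - ?p v * ln (?p v) \<le> Q v - ?p v" if v: "v \<in> f ` space M" for v
  proof (cases "?p v = 0")
    case False
    then have p: "?p v > 0" by (simp add: zero_less_measure_iff)
    then have q: "Q v > 0" using pos v by blast
    have "?p v * ln (Q v) - ?p v * ln (?p v) = ?p v * ln (Q v / ?p v)"
      using p q by (simp add: ln_div algebra_simps)
    also have "\<dots> \<le> ?p v * (Q v / ?p v - 1)"
      using p q by (intro mult_left_mono ln_le_minus_one) auto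
    also have "\<dots> = Q v - ?p v" using p by (simp add: field_simps)
    finally show ?thesis .
  qed (use nonneg v in auto)
  then have "(\<Sum>v\<in>f ` space M. ?p v * ln (Q v) - ?p v * ln (?p v)) \<le> (\<Sum>v\<in>f ` space M. Q v - ?p v)"
    by (rule sum_mono)
  also have "\<dots> \<le> 0" using sum sum_prob_level_set[OF f] by (simp add: sum_subtractf)
  finally show ?thesis
    unfolding obs_entropy_def
      integral_simple_function_compose[OF f, of "\<lambda>v. - ln (prob (level_set M f v))"]
      integral_simple_function_compose[OF f, of "\<lambda>v. - ln (Q v)"]
    by (simp add: sum_subtractf sum_negf)
qed

text \<open>The code may describe a finer observable \<open>h\<close>: the law that \<open>Q\<close> induces for \<open>f\<close> is pointwise at least
  \<open>Q\<close>, so passing to it only shortens the code.\<close>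

lemma (in prob_space) obs_entropy_le_joint_cross_entropy:
  assumes f: "simple_function M f" and h: "simple_function M h"
    and fh: "\<And>x. x \<in> space M \<Longrightarrow> f x = c (h x)"
    and pos: "\<And>x. x \<in> space M \<Longrightarrow> Q (h x) > 0"
    and sum: "(\<Sum>v\<in>h ` space M. Q v) \<le> 1"
  shows "obs_entropy M f \<le> (\<integral>x. - ln (Q (h x)) \<partial>M)"
proof -
  define R where "R v = (\<Sum>u\<in>{u \<in> h ` space M. c u = v}. Q u)" for v
  have fin: "finite (h ` space M)" using h by (simp add: simple_function_def)
  have Qn: "Q u \<ge> 0" if "u \<in> h ` space M" for u using pos that by (auto intro: less_imp_le)
  have ge: "Q (h x) \<le> R (f x)" if "x \<in> space M" for x
    unfolding R_def using that fin Qn by (intro member_le_sum) (auto simp: fh)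
  have "f ` space M = c ` h ` space M" using fh by force
  then have "(\<Sum>v\<in>f ` space M. R v) = (\<Sum>u\<in>h ` space M. Q u)"
    unfolding R_def using fin by (simp add: sum.image_gen[symmetric])
  then have "obs_entropy M f \<le> (\<integral>x. - ln (R (f x)) \<partial>M)"
    using ge pos sum by (intro obs_entropy_le_cross_entropy[OF f]) (force intro: less_le_trans less_imp_le)+
  also have "\<dots> \<le> (\<integral>x. - ln (Q (h x)) \<partial>M)"
    using ge pos
    by (intro integral_mono integrable_simple_function_compose[OF f] integrable_simple_function_compose[OF h])
       (simp add: ln_mono)
  finally show ?thesis .
qed


section \<open>Entropy of a measure-preserving map\<close>

text \<open>Fekete's lemma: the limit is the infimum of the averages, since division with remainder by a good \<open>m\<close>
  bounds every later average by the one at \<open>m\<close> up to a vanishing error.\<close>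

lemma subadditive_average_convergent:
  fixes u :: "nat \<Rightarrow> real"
  assumes sub: "\<And>m n. u (m + n) \<le> u m + u n" and nonneg: "\<And>n. u n \<ge> 0"
  shows "convergent (\<lambda>n. u n / real n)"
proof -
  define L where "L = (INF n\<in>{1..}. u n / real n)"
  have bdd: "bdd_below ((\<lambda>n. u n / real n) ` {1..})"
    by (rule bdd_belowI[where m=0]) (auto simp: nonneg)
  have L: "L \<le> u n / real n" if "n \<ge> 1" for n
    unfolding L_def using that by (intro cINF_lower bdd) auto
  have mult: "u (q * m + r) \<le> real q * u m + u r" for q m r
  proof (induction q)
    case (Suc q)
    have "u (Suc q * m + r) \<le> u m + u (q * m + r)" using sub[of m "q * m + r"] by (simp add: add.assoc)
    with Suc show ?case by (simp add: algebra_simps)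
  qed simp
  have "(\<lambda>n. u n / real n) \<longlonglongrightarrow> L"
  proof (rule LIMSEQ_I)
    fix e :: real assume e: "0 < e"
    obtain m where m: "m \<ge> 1" "u m / real m < L + e / 2"
    proof -
      have "\<exists>m\<in>{1..}. u m / real m < L + e / 2"
        using e cINF_less_iff[OF _ bdd, of "L + e / 2"] by (auto simp: L_def)
      then show ?thesis using that by auto
    qed
    define B where "B = Max (u ` {..<m})"
    have B: "u r \<le> B" if "r < m" for r unfolding B_def using that by (intro Max_ge) auto
    obtain N :: nat where N: "real N > 2 * B / e" using reals_Archimedean2 by blast
    have "norm (u n / real n - L) < e" if n: "n \<ge> max 1 N" for n
    proof -
      have n1: "n \<ge> 1" "real n > 2 * B / e" using n N by (auto intro: less_le_trans)
      have "u n \<le> real (n div m) * u m + u (n mod m)" using mult[of "n div m" m "n mod m"] by simp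
      also have "\<dots> \<le> real n / real m * u m + B"
      proof (intro add_mono mult_right_mono B nonneg)
        show "real (n div m) \<le> real n / real m" by (rule of_nat_div_le_of_nat)
      qed (use m in auto)
      finally have "u n / real n \<le> (real n / real m * u m + B) / real n" using n1 by (simp add: divide_right_mono)
      also have "\<dots> = u m / real m + B / real n" using n1 by (simp add: add_divide_distrib)
      also have "B / real n < e / 2" using n1 e by (simp add: field_simps)
      finally have "u n / real n < L + e" using m by simp
      with L[OF n1(1)] e show ?thesis by simp
    qed
    then show "\<exists>no. \<forall>n\<ge>no. norm (u n / real n - L) < e" by blast
  qed
  then show ?thesis by (auto simp: convergent_def)
qed

definition word :: "('a \<Rightarrow> 'a) \<Rightarrow> ('a \<Rightarrow> 'b) \<Rightarrow> nat \<Rightarrow> 'a \<Rightarrow> 'b list" where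
  "word T f n x = map (\<lambda>i. f ((T ^^ i) x)) [0..<n]"

lemma word_0 [simp]: "word T f 0 x = []" and length_word [simp]: "length (word T f n x) = n"
  by (auto simp: word_def)

lemma word_nth: "i < n \<Longrightarrow> word T f n x ! i = f ((T ^^ i) x)"
  by (simp add: word_def)

lemma word_add: "word T f (m + n) x = word T f m x @ word T f n ((T ^^ m) x)"
proof -
  have "[0..<m + n] = [0..<m] @ map (\<lambda>i. i + m) [0..<n]"
    by (metis upt_add_eq_append le0 add.commute map_add_upt)
  then show ?thesis by (simp add: word_def funpow_add o_def)
qed

lemma word_Suc: "word T f (Suc n) x = f x # word T f n (T x)"
  by (simp add: word_def upt_conv_Cons map_Suc_upt[symmetric] funpow_swap1 o_def del: upt_Suc)

lemma take_word: "m \<le> n \<Longrightarrow> take m (word T f n x) = word T f m x"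
  by (simp add: word_def take_map)

locale measure_preserving_map = prob_space M for M :: "'a measure" +
  fixes T :: "'a \<Rightarrow> 'a"
  assumes T_measurable [measurable]: "T \<in> measurable M M" and distr_T: "distr M M T = M"
begin

lemma funpow_measurable: "(T ^^ n) \<in> measurable M M"
proof (induction n)
  case (Suc n)
  have "(\<lambda>x. T ((T ^^ n) x)) \<in> measurable M M"
    using Suc T_measurable by (rule measurable_compose)
  then show ?case by (simp add: o_def)
qed (simp add: id_def)

lemma funpow_space: "x \<in> space M \<Longrightarrow> (T ^^ n) x \<in> space M"
  using measurable_space[OF funpow_measurable] .

lemma T_space: "x \<in> space M \<Longrightarrow> T x \<in> space M"
  using measurable_space[OF T_measurable] .

lemma distr_funpow: "distr M M (T ^^ n) = M"
proof (induction n)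
  case (Suc n)
  have "distr M M (T ^^ Suc n) = distr (distr M M (T ^^ n)) M T"
    unfolding funpow.simps by (rule distr_distr[OF T_measurable funpow_measurable, symmetric])
  also have "\<dots> = M" by (simp only: Suc distr_T)
  finally show ?case .
qed (simp add: id_def distr_id)

lemma integral_funpow:
  fixes g :: "'a \<Rightarrow> real"
  shows "g \<in> borel_measurable M \<Longrightarrow> (\<integral>x. g ((T ^^ n) x) \<partial>M) = (\<integral>x. g x \<partial>M)"
  using integral_distr[OF funpow_measurable, of g n] by (simp add: distr_funpow)

lemma integral_T:
  fixes g :: "'a \<Rightarrow> real"
  shows "g \<in> borel_measurable M \<Longrightarrow> (\<integral>x. g (T x) \<partial>M) = (\<integral>x. g x \<partial>M)"
  using integral_funpow[of g 1] by simp

lemma prob_vimage: "A \<in> sets M \<Longrightarrow> prob (T -` A \<inter> space M) = prob A"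
  using measure_distr[OF T_measurable, of A] by (simp add: distr_T)

lemma prob_funpow_vimage: "A \<in> sets M \<Longrightarrow> prob ((T ^^ n) -` A \<inter> space M) = prob A"
  using measure_distr[OF funpow_measurable, of A n] by (simp add: distr_funpow)

lemma simple_function_funpow: "simple_function M f \<Longrightarrow> simple_function M (\<lambda>x. f ((T ^^ n) x))"
  using simple_function_comp[OF funpow_measurable, of f n] by (simp add: o_def)

lemma simple_function_T: "simple_function M f \<Longrightarrow> simple_function M (\<lambda>x. f (T x))"
  using simple_function_funpow[of f 1] by simp

lemma simple_function_word: "simple_function M f \<Longrightarrow> simple_function M (word T f n)"
proof (induction n)
  case (Suc n)
  have "simple_function M (\<lambda>x. f x # word T f n (T x))"
    by (intro simple_function_compose2[where h="(#)"] Suc.prems simple_function_T Suc.IH)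
  moreover have "word T f (Suc n) = (\<lambda>x. f x # word T f n (T x))" by (rule ext) (rule word_Suc)
  ultimately show ?case by simp
qed (simp add: word_def[abs_def])

lemma obs_entropy_nonneg: "obs_entropy M f \<ge> 0"
  unfolding obs_entropy_def
proof (intro Bochner_Integration.integral_nonneg)
  fix x
  show "0 \<le> - ln (prob (level_set M f (f x)))"
  proof (cases "prob (level_set M f (f x)) = 0")
    case False
    then have "prob (level_set M f (f x)) > 0" by (simp add: zero_less_measure_iff)
    from ln_le_minus_one[OF this] prob_le_1[of "level_set M f (f x)"] show ?thesis by linarith
  qed simp
qed

lemma AE_prob_level_set_pos:
  assumes "simple_function M f"
  shows "AE x in M. prob (level_set M f (f x)) > 0"
proof -
  have "AE x in M. \<forall>v\<in>f ` space M. prob (level_set M f v) = 0 \<longrightarrow> x \<notin> level_set M f v"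
  proof (subst AE_finite_all)
    show "finite (f ` space M)" using assms by (simp add: simple_function_def)
    show "\<forall>v\<in>f ` space M. AE x in M. prob (level_set M f v) = 0 \<longrightarrow> x \<notin> level_set M f v"
      by (auto intro!: AE_not_in simp: null_sets_def level_set_sets[OF assms] emeasure_eq_measure)
  qed
  then show ?thesis
    by (rule AE_mp) (auto simp: zero_less_measure_iff level_set_def)
qed

text \<open>Gibbs' inequality for the law under which the two halves of the word are independent; invariance gives the
  second half its usual distribution.\<close>
lemma obs_entropy_word_subadditive:
  assumes f: "simple_function M f"
  shows "obs_entropy M (word T f (m + n)) \<le> obs_entropy M (word T f m) + obs_entropy M (word T f n)"
proof -
  let ?P = "\<lambda>n w. prob (level_set M (word T f n) w)"
  let ?Q = "\<lambda>w. ?P m (take m w) * ?P n (drop m w)"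
  note sw = simple_function_word[OF f]
  have fin: "finite (word T f k ` space M)" for k using sw[of k] by (simp add: simple_function_def)
  have tk: "take m (word T f (m + n) x) = word T f m x"
    and dr: "drop m (word T f (m + n) x) = word T f n ((T ^^ m) x)" for x
    by (auto simp: word_add)
  have "obs_entropy M (word T f (m + n)) \<le> (\<integral>x. - ln (?Q (word T f (m + n) x)) \<partial>M)"
  proof (rule obs_entropy_le_cross_entropy[OF sw])
    fix v assume v: "v \<in> word T f (m + n) ` space M" and p: "?P (m + n) v > 0"
    have "?P (m + n) v \<le> ?P m (take m v)"
      by (intro finite_measure_mono level_set_sets sw) (auto simp: level_set_def tk)
    moreover have "?P (m + n) v \<le> prob ((T ^^ m) -` level_set M (word T f n) (drop m v) \<inter> space M)"
      by (intro finite_measure_mono measurable_sets[OF funpow_measurable] level_set_sets sw)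
         (auto simp: level_set_def dr funpow_space)
    ultimately show "?Q v > 0"
      using p by (simp add: prob_funpow_vimage level_set_sets[OF sw])
  next
    have "(\<Sum>v\<in>word T f (m + n) ` space M. ?Q v)
        = (\<Sum>(u, w)\<in>(\<lambda>v. (take m v, drop m v)) ` word T f (m + n) ` space M. ?P m u * ?P n w)"
      by (subst sum.reindex) (auto simp: inj_on_def, metis append_take_drop_id)
    also have "\<dots> \<le> (\<Sum>(u, w)\<in>word T f m ` space M \<times> word T f n ` space M. ?P m u * ?P n w)"
      using fin by (intro sum_mono2) (auto simp: tk dr funpow_space)
    also have "\<dots> = 1"
      using sum_prob_level_set[OF sw[of m]] sum_prob_level_set[OF sw[of n]]
      by (simp add: sum.cartesian_product[symmetric] sum_distrib_left[symmetric])
    finally show "(\<Sum>v\<in>word T f (m + n) ` space M. ?Q v) \<le> 1" .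
  qed auto
  also have "\<dots> = (\<integral>x. - ln (?P m (word T f m x)) + - ln (?P n (word T f n ((T ^^ m) x))) \<partial>M)"
  proof (rule integral_cong_AE)
    have "{x \<in> space M. 0 < ?P n (word T f n x)} \<in> sets M"
      by (intro borel_measurable_less borel_measurable_const borel_measurable_integrable
            integrable_simple_function_compose[OF sw])
    then have "AE x in M. ?P n (word T f n ((T ^^ m) x)) > 0"
      using AE_prob_level_set_pos[OF sw[of n]]
      by (subst AE_distr_iff[OF funpow_measurable[of m], of "\<lambda>x. 0 < ?P n (word T f n x)", symmetric])
         (simp_all only: distr_funpow)
    then show "AE x in M. - ln (?Q (word T f (m + n) x)) =
        - ln (?P m (word T f m x)) + - ln (?P n (word T f n ((T ^^ m) x)))"
      using AE_prob_level_set_pos[OF sw[of m]] by eventually_elim (simp add: ln_mult word_add)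
  qed (auto intro!: borel_measurable_integrable
         Bochner_Integration.integrable_add integrable_minus
         integrable_simple_function_compose[OF sw] integrable_simple_function_compose[OF simple_function_funpow[OF sw]])
  also have "\<dots> = obs_entropy M (word T f m) + obs_entropy M (word T f n)"
    unfolding obs_entropy_def
    by (subst Bochner_Integration.integral_add)
       (auto intro!: Bochner_Integration.integrable_minus integrable_simple_function_compose[OF sw] integrable_simple_function_compose[OF simple_function_funpow[OF sw]]
          integral_funpow[where g="\<lambda>x. ln (?P n (word T f n x))"] borel_measurable_integrable)
  finally show ?thesis .
qed


lemma level_set_word:
  "x \<in> space M \<Longrightarrow> level_set M (word T f n) (word T f n x)
    = {y \<in> space M. \<forall>i<n. f ((T ^^ i) y) = f ((T ^^ i) x)}"
  by (auto simp: level_set_def list_eq_iff_nth_eq word_nth)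

end

definition cell :: "'a set set \<Rightarrow> 'a \<Rightarrow> 'a set" where
  "cell \<xi> x = (THE A. A \<in> \<xi> \<and> x \<in> A)"

lemma cell_eq:
  assumes "partition_on S \<xi>" "A \<in> \<xi>" "x \<in> A"
  shows "cell \<xi> x = A"
  unfolding cell_def using assms
  by (intro the_equality) (auto simp: partition_on_def disjoint_def)

lemma cell_mem:
  assumes "partition_on S \<xi>" "x \<in> S"
  shows "cell \<xi> x \<in> \<xi>" "x \<in> cell \<xi> x"
proof -
  obtain A where "A \<in> \<xi>" "x \<in> A" using assms by (auto simp: partition_on_def)
  then show "cell \<xi> x \<in> \<xi>" "x \<in> cell \<xi> x" using cell_eq[OF assms(1)] by auto
qed

context measure_preserving_map
begin

lemma simple_function_cell:
  assumes "finite_measurable_partition M \<xi>"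
  shows "simple_function M (cell \<xi>)"
  unfolding simple_function_def
proof (intro conjI ballI)
  have p: "partition_on (space M) \<xi>" using assms by simp
  have "cell \<xi> ` space M \<subseteq> \<xi>" using cell_mem[OF p] by auto
  then show "finite (cell \<xi> ` space M)" using assms finite_subset by blast
  fix A assume A: "A \<in> cell \<xi> ` space M"
  then have "A \<in> \<xi>" using cell_mem[OF p] by auto
  then have "cell \<xi> -` {A} \<inter> space M = A"
    using cell_eq[OF p] cell_mem[OF p] p by (auto simp: partition_on_def)
  with \<open>A \<in> \<xi>\<close> show "cell \<xi> -` {A} \<inter> space M \<in> sets M" using assms by auto
qed

text \<open>The join ranges over the set of pulled-back partitions, in which equal pullbacks are identified. This does not
  change the join, because a choice of cells with a common point picks the cell of that point from every
  pullback.\<close>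
lemma iterated_join_eq:
  assumes \<xi>: "finite_measurable_partition M \<xi>" and n: "n \<ge> 1"
  shows "iterated_join M T n \<xi>
    = level_set M (word T (cell \<xi>) n) ` (word T (cell \<xi>) n ` space M)"
proof -
  let ?W = "word T (cell \<xi>) n" and ?P = "\<lambda>i. pullback M T i \<xi>"
  have p: "partition_on (space M) \<xi>" using \<xi> by simp
  have piece: "(T ^^ i) -` A \<inter> space M = {y \<in> space M. cell \<xi> ((T ^^ i) y) = cell \<xi> ((T ^^ i) x)}"
    if "A \<in> \<xi>" "x \<in> (T ^^ i) -` A" for A i x
    using that cell_eq[OF p] cell_mem[OF p] funpow_space by auto
  have mem: "X = {y \<in> space M. cell \<xi> ((T ^^ i) y) = cell \<xi> ((T ^^ i) x)}"
    if "X \<in> ?P i" "x \<in> X" for X x and i :: nat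
  proof -
    obtain A where "A \<in> \<xi>" "X = (T ^^ i) -` A \<inter> space M"
      using \<open>X \<in> ?P i\<close> by (auto simp: pullback_def)
    with \<open>x \<in> X\<close> piece[of A x i] show ?thesis by simp
  qed
  have inter: "(\<Inter>i<n. {y \<in> space M. cell \<xi> ((T ^^ i) y) = cell \<xi> ((T ^^ i) x)})
      = level_set M ?W (?W x)" if "x \<in> space M" for x
  proof (subst level_set_word[OF that], intro set_eqI iffI)
    fix y assume "y \<in> (\<Inter>i<n. {y \<in> space M. cell \<xi> ((T ^^ i) y) = cell \<xi> ((T ^^ i) x)})"
    then have "\<forall>i<n. y \<in> space M \<and> cell \<xi> ((T ^^ i) y) = cell \<xi> ((T ^^ i) x)" by simp
    moreover have "0 < n" using n by simp
    ultimately show "y \<in> {y \<in> space M. \<forall>i<n. cell \<xi> ((T ^^ i) y) = cell \<xi> ((T ^^ i) x)}" by blast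
  qed auto
  show ?thesis
  proof (intro set_eqI iffI)
    fix X assume "X \<in> iterated_join M T n \<xi>"
    then obtain c where c: "\<And>i. i < n \<Longrightarrow> c (?P i) \<in> ?P i" and X: "X = (\<Inter>i<n. c (?P i))" and "X \<noteq> {}"
      by (auto simp: iterated_join_def common_refinement Pi_iff image_image)
    then obtain x where x: "x \<in> X" by blast
    have eq: "c (?P i) = {y \<in> space M. cell \<xi> ((T ^^ i) y) = cell \<xi> ((T ^^ i) x)}" if "i < n" for i
      using that x by (intro mem c) (auto simp: X)
    have "x \<in> c (?P 0)" using x n by (auto simp: X)
    then have "x \<in> space M" using eq[of 0] n by simp
    moreover have "X = level_set M ?W (?W x)"
      using eq inter[OF \<open>x \<in> space M\<close>] by (auto simp: X)
    ultimately show "X \<in> level_set M ?W ` (?W ` space M)" by blast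
  next
    fix X assume "X \<in> level_set M ?W ` (?W ` space M)"
    then obtain x where x: "x \<in> space M" "X = level_set M ?W (?W x)" by auto
    define c where "c P = (SOME X. X \<in> P \<and> x \<in> X)" for P :: "'a set set"
    have "\<exists>X. X \<in> ?P i \<and> x \<in> X" for i
      using x cell_mem[OF p funpow_space[OF x(1), of i]]
      by (intro exI[of _ "(T ^^ i) -` cell \<xi> ((T ^^ i) x) \<inter> space M"]) (auto simp: pullback_def)
    then have c: "c (?P i) \<in> ?P i \<and> x \<in> c (?P i)" for i
      unfolding c_def by (rule someI_ex)
    have eq: "c (?P i) = {y \<in> space M. cell \<xi> ((T ^^ i) y) = cell \<xi> ((T ^^ i) x)}" for i
      using c[of i] by (intro mem) auto
    then have "(\<Inter>i<n. c (?P i)) = X"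
      using inter[OF x(1)] x(2) by (simp add: eq)
    moreover have "x \<in> X" using x by (auto simp: level_set_def)
    ultimately show "X \<in> iterated_join M T n \<xi>"
      using c by (auto simp: iterated_join_def common_refinement image_image intro!: bexI[of _ c])
  qed
qed

text \<open>Subadditivity turns the limit in the definition of entropy, which need not exist for an arbitrary sequence, into
  a genuine one.\<close>
lemma entropy_wrt_LIMSEQ:
  assumes "finite_measurable_partition M \<xi>"
  shows "(\<lambda>n. obs_entropy M (word T (cell \<xi>) n) / real n) \<longlonglongrightarrow> entropy_wrt M T \<xi>"
proof -
  note sc = simple_function_cell[OF assms]
  have "partition_entropy M (iterated_join M T n \<xi>) / real n = obs_entropy M (word T (cell \<xi>) n) / real n" for n
    using partition_entropy_level_sets[OF simple_function_word[OF sc]] iterated_join_eq[OF assms, of n]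
    by (cases "n = 0") simp_all
  moreover have "convergent (\<lambda>n. obs_entropy M (word T (cell \<xi>) n) / real n)"
    by (intro subadditive_average_convergent obs_entropy_nonneg obs_entropy_word_subadditive sc)
  ultimately show ?thesis by (simp only: entropy_wrt_def convergent_LIMSEQ_iff)
qed

lemma entropy_wrt_le:
  assumes "finite_measurable_partition M \<xi>"
    and "\<And>n. obs_entropy M (word T (cell \<xi>) (Suc n)) \<le> a + real n * c"
  shows "entropy_wrt M T \<xi> \<le> c"
proof (rule LIMSEQ_le)
  show "(\<lambda>n. obs_entropy M (word T (cell \<xi>) (Suc n)) / real (Suc n)) \<longlonglongrightarrow> entropy_wrt M T \<xi>"
    using LIMSEQ_Suc[OF entropy_wrt_LIMSEQ[OF assms(1)]] .
  show "(\<lambda>n. (a + real n * c) / real (Suc n)) \<longlonglongrightarrow> c" by real_asymp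
  show "\<exists>N. \<forall>n\<ge>N. obs_entropy M (word T (cell \<xi>) (Suc n)) / real (Suc n) \<le> (a + real n * c) / real (Suc n)"
    using assms(2) by (intro exI allI impI divide_right_mono) auto
qed

lemma entropy_wrt_ge:
  assumes "finite_measurable_partition M \<xi>"
    and "\<And>n. obs_entropy M (word T (cell \<xi>) (Suc n)) \<ge> real n * c"
  shows "entropy_wrt M T \<xi> \<ge> c"
proof (rule LIMSEQ_le)
  show "(\<lambda>n. obs_entropy M (word T (cell \<xi>) (Suc n)) / real (Suc n)) \<longlonglongrightarrow> entropy_wrt M T \<xi>"
    using LIMSEQ_Suc[OF entropy_wrt_LIMSEQ[OF assms(1)]] .
  show "(\<lambda>n. (real n * c) / real (Suc n)) \<longlonglongrightarrow> c" by real_asymp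
  show "\<exists>N. \<forall>n\<ge>N. (real n * c) / real (Suc n) \<le> obs_entropy M (word T (cell \<xi>) (Suc n)) / real (Suc n)"
    using assms(2) by (intro exI allI impI divide_right_mono) auto
qed

lemma partition_on_level_sets:
  assumes "simple_function M f"
  shows "finite_measurable_partition M (level_set M f ` (f ` space M))"
    and "x \<in> space M \<Longrightarrow> cell (level_set M f ` (f ` space M)) x = level_set M f (f x)"
proof -
  have p: "partition_on (space M) (level_set M f ` (f ` space M))"
    by (auto simp: partition_on_def disjoint_def level_set_def)
  then show "finite_measurable_partition M (level_set M f ` (f ` space M))"
    using assms level_set_sets[OF assms] by (auto simp: simple_function_def)
  assume "x \<in> space M"
  then show "cell (level_set M f ` (f ` space M)) x = level_set M f (f x)"
    by (intro cell_eq[OF p]) (auto simp: level_set_def)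
qed

lemma obs_entropy_word_level_sets:
  assumes "simple_function M f"
  shows "obs_entropy M (word T (cell (level_set M f ` (f ` space M))) n) = obs_entropy M (word T f n)"
  unfolding obs_entropy_def
proof (intro Bochner_Integration.integral_cong refl)
  fix x assume x: "x \<in> space M"
  let ?c = "cell (level_set M f ` (f ` space M))"
  have "?c y = ?c z \<longleftrightarrow> f y = f z" if "y \<in> space M" "z \<in> space M" for y z
    using that by (simp add: partition_on_level_sets(2)[OF assms]) (auto simp: level_set_def)
  then have "level_set M (word T ?c n) (word T ?c n x) = level_set M (word T f n) (word T f n x)"
    using x funpow_space by (simp add: level_set_word) (rule Collect_cong, blast)
  then show "- ln (prob (level_set M (word T ?c n) (word T ?c n x)))
    = - ln (prob (level_set M (word T f n) (word T f n x)))" by simp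
qed

end

text \<open>The law of a chain run backwards in time: \<open>c\<close> weighs the last letter and \<open>J a b\<close> the letter \<open>a\<close> before \<open>b\<close>.\<close>
fun chain_weight :: "('b \<Rightarrow> 'b \<Rightarrow> real) \<Rightarrow> real \<Rightarrow> 'b list \<Rightarrow> real" where
  "chain_weight J c [] = 1"
| "chain_weight J c [a] = c"
| "chain_weight J c (a # b # w) = J a b * chain_weight J c (b # w)"

text \<open>The basic upper bound. A word is coded backwards, the last letter by the uniform law and every other letter by
  the kernel \<open>J\<close> given its successor; by invariance each step costs the same on average, and the uniform law
  contributes only a constant.\<close>

lemma (in measure_preserving_map) obs_entropy_word_le_kernel:
  assumes Y: "simple_function M Y" and f: "simple_function M f"
    and fY: "\<And>x. x \<in> space M \<Longrightarrow> f x = c (Y x)"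
    and nonneg: "\<And>a b. J a b \<ge> 0"
    and pos: "\<And>x. x \<in> space M \<Longrightarrow> J (Y x) (Y (T x)) > 0"
    and sub: "\<And>b. b \<in> Y ` space M \<Longrightarrow> (\<Sum>a\<in>Y ` space M. J a b) \<le> 1"
  shows "obs_entropy M (word T f (Suc n))
    \<le> ln (card (Y ` space M)) + real n * (\<integral>x. - ln (J (Y x) (Y (T x))) \<partial>M)"
proof -
  let ?R = "Y ` space M"
  let ?w = "chain_weight J (1 / card ?R)"
  let ?I = "\<integral>x. - ln (J (Y x) (Y (T x))) \<partial>M"
  have fin: "finite ?R" using Y by (simp add: simple_function_def)
  have card: "card ?R > 0" using fin not_empty by (simp add: card_gt_0_iff)
  define L where "L k = {w. set w \<subseteq> ?R \<and> length w = Suc k}" for k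
  have finL: "finite (L k)" for k unfolding L_def using finite_lists_length_eq[OF fin, of "Suc k"] by simp
  have wnn: "?w v \<ge> 0" for v
    by (induction v rule: induct_list012) (auto simp: nonneg)
  have L0: "L 0 = (\<lambda>a. [a]) ` ?R" by (auto simp: L_def length_Suc_conv)
  have LS: "L (Suc k) = (\<lambda>(v, a). a # v) ` (L k \<times> ?R)" for k
  proof (intro set_eqI iffI)
    fix w assume "w \<in> L (Suc k)"
    then obtain a v where "w = a # v" "a \<in> ?R" "v \<in> L k"
      unfolding L_def by (cases w) auto
    then show "w \<in> (\<lambda>(v, a). a # v) ` (L k \<times> ?R)" by (intro image_eqI[of _ _ "(v, a)"]) auto
  qed (auto simp: L_def)
  have sumL: "(\<Sum>v\<in>L k. ?w v) \<le> 1" for k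
  proof (induction k)
    case 0
    show ?case using card by (simp add: L0 sum.reindex inj_on_def)
  next
    case (Suc k)
    have "(\<Sum>v\<in>L (Suc k). ?w v) = (\<Sum>(v, a)\<in>L k \<times> ?R. ?w (a # v))"
      unfolding LS by (subst sum.reindex) (auto simp: inj_on_def case_prod_unfold)
    also have "\<dots> = (\<Sum>v\<in>L k. \<Sum>a\<in>?R. ?w (a # v))" by (simp add: sum.cartesian_product)
    also have "\<dots> \<le> (\<Sum>v\<in>L k. ?w v)"
    proof (rule sum_mono)
      fix v assume "v \<in> L k"
      then obtain b v' where v: "v = b # v'" "b \<in> ?R" by (auto simp: L_def length_Suc_conv)
      have "(\<Sum>a\<in>?R. ?w (a # v)) = (\<Sum>a\<in>?R. J a b) * ?w v"
        by (simp add: v sum_distrib_right)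
      also have "\<dots> \<le> 1 * ?w v" by (intro mult_right_mono sub v wnn)
      finally show "(\<Sum>a\<in>?R. ?w (a # v)) \<le> ?w v" by simp
    qed
    finally show ?case using Suc by linarith
  qed
  have word_SS: "?w (word T Y (Suc (Suc k)) x) = J (Y x) (Y (T x)) * ?w (word T Y (Suc k) (T x))" for k x
    by (simp add: word_Suc)
  have wpos: "?w (word T Y (Suc k) x) > 0" if "x \<in> space M" for k x
    using that
  proof (induction k arbitrary: x)
    case (Suc k)
    then show ?case by (simp only: word_SS) (simp add: pos T_space)
  qed (use card in \<open>simp add: word_Suc\<close>)
  have intJ: "integrable M (\<lambda>x. - ln (J (Y x) (Y (T x))))"
    using integrable_simple_function_compose[OF simple_function_Pair[OF Y simple_function_T[OF Y]],
        of "\<lambda>(a, b). - ln (J a b)"] by simp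
  note sw = simple_function_word[OF Y]
  have int: "(\<integral>x. - ln (?w (word T Y (Suc k) x)) \<partial>M) = ln (card ?R) + real k * ?I" for k
  proof (induction k)
    case 0
    show ?case using card by (simp add: word_Suc ln_div prob_space)
  next
    case (Suc k)
    have "(\<integral>x. - ln (?w (word T Y (Suc (Suc k)) x)) \<partial>M)
        = (\<integral>x. - ln (J (Y x) (Y (T x))) + - ln (?w (word T Y (Suc k) (T x))) \<partial>M)"
    proof (intro Bochner_Integration.integral_cong refl)
      fix x assume "x \<in> space M"
      then show "- ln (?w (word T Y (Suc (Suc k)) x))
          = - ln (J (Y x) (Y (T x))) + - ln (?w (word T Y (Suc k) (T x)))"
        using pos[of x] wpos[OF T_space, of x k] by (subst word_SS, subst ln_mult_pos) simp_all
    qed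
    also have "\<dots> = ?I + (\<integral>x. - ln (?w (word T Y (Suc k) (T x))) \<partial>M)"
      by (intro Bochner_Integration.integral_add intJ integrable_simple_function_compose[OF simple_function_T[OF sw]])
    also have "(\<integral>x. - ln (?w (word T Y (Suc k) (T x))) \<partial>M) = (\<integral>x. - ln (?w (word T Y (Suc k) x)) \<partial>M)"
      by (intro integral_T[where g="\<lambda>x. - ln (?w (word T Y (Suc k) x))"] borel_measurable_integrable
            integrable_simple_function_compose[OF sw])
    finally show ?case using Suc by (simp add: algebra_simps)
  qed
  have "obs_entropy M (word T f (Suc n)) \<le> (\<integral>x. - ln (?w (word T Y (Suc n) x)) \<partial>M)"
  proof (rule obs_entropy_le_joint_cross_entropy[OF simple_function_word[OF f] sw, where c="map c"])
    show "word T f (Suc n) x = map c (word T Y (Suc n) x)" if "x \<in> space M" for x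
      using that by (auto simp: word_def fY funpow_space)
    show "?w (word T Y (Suc n) x) > 0" if "x \<in> space M" for x
      using that by (rule wpos)
    have "(\<Sum>v\<in>word T Y (Suc n) ` space M. ?w v) \<le> (\<Sum>v\<in>L n. ?w v)"
      using finL wnn funpow_space by (intro sum_mono2) (auto simp: L_def word_def)
    then show "(\<Sum>v\<in>word T Y (Suc n) ` space M. ?w v) \<le> 1" using sumL[of n] by linarith
  qed
  then show ?thesis by (simp only: int)
qed


section \<open>Branches of the map\<close>

abbreviation unit_ivl :: "real set" where "unit_ivl \<equiv> {0<..1}"

text \<open>The contraction factor of the \<open>k\<close>-th inverse branch. With another parameter \<open>s\<close> in place of \<open>lam\<close> the same
  numbers serve as the factors by which a measure scales along the branches of \<open>F lam\<close>.\<close>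
definition slope :: "real \<Rightarrow> nat \<Rightarrow> real" where
  "slope lam k = (if k = 1 then 1 - lam else lam * (1 - lam))"

definition inv_branch :: "real \<Rightarrow> nat \<Rightarrow> real \<Rightarrow> real" where
  "inv_branch lam k y = lam ^ k + slope lam k * y"

abbreviation itin :: "real \<Rightarrow> nat \<Rightarrow> real \<Rightarrow> nat list" where
  "itin lam \<equiv> word (F lam) (branch lam)"

definition cyl :: "real \<Rightarrow> nat list \<Rightarrow> real set" where
  "cyl lam w = {x \<in> unit_ivl. itin lam (length w) x = w}"

locale branch_map =
  fixes lam :: real
  assumes lam_pos: "0 < lam" and lam_less: "lam < 1"
begin

lemma slope_pos: "slope lam k > 0" and slope_le: "slope lam k \<le> 1 - lam"
  using lam_pos lam_less by (auto simp: slope_def mult_le_one intro!: mult_left_le_one_le)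

lemma pow_le: "m \<le> n \<Longrightarrow> lam ^ n \<le> lam ^ m"
  using lam_pos lam_less by (intro power_decreasing) auto

lemma branch_ex1:
  assumes "x \<in> unit_ivl"
  shows "\<exists>!n. n \<ge> 1 \<and> x \<in> W lam n"
proof (rule ex_ex1I)
  have ex: "\<exists>n. lam ^ n < x" using assms lam_pos lam_less real_arch_pow_inv by auto
  define n where "n = (LEAST n. lam ^ n < x)"
  have n: "lam ^ n < x" unfolding n_def by (rule LeastI_ex[OF ex])
  have n1: "n \<ge> 1" using n assms by (cases n) auto
  then have "\<not> lam ^ (n - 1) < x" unfolding n_def by (intro not_less_Least) auto
  with n n1 show "\<exists>n. n \<ge> 1 \<and> x \<in> W lam n" by (auto simp: W_def)
next
  fix m n assume mn: "m \<ge> 1 \<and> x \<in> W lam m" "n \<ge> 1 \<and> x \<in> W lam n"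
  have "\<not> a < b" if "a \<ge> 1" "b \<ge> 1" "x \<in> W lam a" "x \<in> W lam b" for a b
  proof
    assume "a < b"
    then have "lam ^ (b - 1) \<le> lam ^ a" by (intro pow_le) auto
    then show False using that by (auto simp: W_def)
  qed
  from this[of m n] this[of n m] mn show "m = n" by auto
qed

lemma branch_ge1: "x \<in> unit_ivl \<Longrightarrow> branch lam x \<ge> 1"
  and branch_W: "x \<in> unit_ivl \<Longrightarrow> x \<in> W lam (branch lam x)"
  using theI'[OF branch_ex1] unfolding branch_def by blast+

lemma branch_eqI: "x \<in> unit_ivl \<Longrightarrow> n \<ge> 1 \<Longrightarrow> x \<in> W lam n \<Longrightarrow> branch lam x = n"
  using branch_ex1[of x] branch_ge1[of x] branch_W[of x] by blast

lemma W_subset: "n \<ge> 1 \<Longrightarrow> W lam n \<subseteq> unit_ivl"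
proof -
  have "0 < lam ^ n" "lam ^ (n - 1) \<le> 1" using lam_pos lam_less by (auto intro: power_le_one)
  then show ?thesis by (auto simp: W_def)
qed

lemma W_eq: "n \<ge> 1 \<Longrightarrow> W lam n = {x \<in> unit_ivl. branch lam x = n}"
  using W_subset branch_eqI branch_W by blast

lemma branch_ge_iff:
  assumes "x \<in> unit_ivl" "k \<ge> 1"
  shows "k \<le> branch lam x \<longleftrightarrow> x \<le> lam ^ (k - 1)"
proof
  assume "k \<le> branch lam x"
  then have "lam ^ (branch lam x - 1) \<le> lam ^ (k - 1)" by (intro pow_le) auto
  then show "x \<le> lam ^ (k - 1)" using branch_W[OF assms(1)] by (auto simp: W_def)
next
  assume x: "x \<le> lam ^ (k - 1)"
  show "k \<le> branch lam x"
  proof (rule ccontr)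
    assume "\<not> k \<le> branch lam x"
    then have "lam ^ (k - 1) \<le> lam ^ branch lam x" by (intro pow_le) auto
    then show False using x branch_W[OF assms(1)] by (auto simp: W_def)
  qed
qed

lemma F_eq: "x \<in> unit_ivl \<Longrightarrow> F lam x = (x - lam ^ branch lam x) / slope lam (branch lam x)"
  using branch_ge1[of x] by (auto simp: F_def slope_def Let_def)

lemma inv_branch_F: "x \<in> unit_ivl \<Longrightarrow> inv_branch lam (branch lam x) (F lam x) = x"
  using slope_pos[of "branch lam x"] by (simp add: F_eq inv_branch_def)

text \<open>The right endpoint of \<open>W lam k\<close> is mapped to \<open>lam ^ (k - 2)\<close>, which for \<open>k = 1\<close> is 1 because subtraction is
  truncated. So the image of the branch \<open>k\<close> is the union of the \<open>W lam j\<close> with \<open>j \<ge> k - 1\<close>.\<close>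

lemma F_pow_le:
  assumes "k \<ge> 1"
  shows "lam ^ k + slope lam k * lam ^ (k - 2) = lam ^ (k - 1)"
proof (cases "k = 1")
  case False
  then obtain j where "k = j + 2" using assms by (metis One_nat_def Suc_1 add.commute le_antisym less_eq_Suc_le not_less_eq_eq le_Suc_ex)
  then show ?thesis by (simp add: slope_def algebra_simps)
qed (simp add: slope_def)

lemma
  assumes x: "x \<in> unit_ivl"
  shows F_unit: "F lam x \<in> unit_ivl"
    and branch_F: "branch lam x \<le> branch lam (F lam x) + 1"
proof -
  let ?k = "branch lam x"
  have W: "lam ^ ?k < x" "x \<le> lam ^ (?k - 1)" using branch_W[OF x] by (auto simp: W_def)
  have "slope lam ?k * F lam x \<le> slope lam ?k * lam ^ (?k - 2)"
    using inv_branch_F[OF x] W F_pow_le[OF branch_ge1[OF x]] by (simp add: inv_branch_def)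
  then have le: "F lam x \<le> lam ^ (?k - 2)"
    using slope_pos by simp
  have "lam ^ (?k - 2) \<le> 1" using lam_pos lam_less by (intro power_le_one) auto
  moreover have "F lam x > 0" using W slope_pos[of ?k] by (simp add: F_eq[OF x])
  ultimately show u: "F lam x \<in> unit_ivl" using le by auto
  show "?k \<le> branch lam (F lam x) + 1"
  proof (cases "?k \<ge> 2")
    case True
    then have "1 \<le> ?k - 1" by simp
    moreover have "F lam x \<le> lam ^ (?k - 1 - 1)" using le by (simp only: diff_diff_left one_add_one)
    ultimately have "?k - 1 \<le> branch lam (F lam x)" using branch_ge_iff[OF u] by blast
    then show ?thesis by simp
  qed (use branch_ge1[OF u] in simp)
qed

lemma
  assumes y: "y \<in> unit_ivl" and k: "k \<ge> 1" "k \<le> branch lam y + 1"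
  shows inv_branch_unit: "inv_branch lam k y \<in> unit_ivl"
    and branch_inv_branch: "branch lam (inv_branch lam k y) = k"
    and F_inv_branch: "F lam (inv_branch lam k y) = y"
proof -
  have "y \<le> lam ^ (k - 2)"
  proof (cases "k \<ge> 2")
    case True
    then have "1 \<le> k - 1" "k - 1 \<le> branch lam y" using k by auto
    then have "y \<le> lam ^ (k - 1 - 1)" using branch_ge_iff[OF y] by blast
    then show ?thesis by (simp only: diff_diff_left one_add_one)
  qed (use y in auto)
  then have "slope lam k * y \<le> slope lam k * lam ^ (k - 2)"
    using slope_pos[of k] by (intro mult_left_mono) auto
  moreover have "slope lam k * y > 0" using y slope_pos[of k] by auto
  ultimately have W: "inv_branch lam k y \<in> W lam k"
    using F_pow_le[OF k(1)] by (auto simp: W_def inv_branch_def)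
  then show u: "inv_branch lam k y \<in> unit_ivl" using W_subset[OF k(1)] by blast
  show b: "branch lam (inv_branch lam k y) = k" using branch_eqI[OF u k(1) W] .
  show "F lam (inv_branch lam k y) = y"
    using slope_pos[of k] by (simp add: F_eq[OF u] b) (simp add: inv_branch_def)
qed

lemma space_unit_borel [simp]: "space unit_borel = unit_ivl"
  by (simp add: space_restrict_space)

lemma W_sets: "n \<ge> 1 \<Longrightarrow> W lam n \<in> sets unit_borel"
  using W_subset[of n] by (auto simp: sets_restrict_space_iff W_def)

lemma branch_measurable [measurable]: "branch lam \<in> measurable unit_borel (count_space UNIV)"
proof (subst measurable_count_space_eq2_countable, safe)
  fix n
  have "branch lam -` {n} \<inter> space unit_borel = (if n \<ge> 1 then W lam n else {})"
    using branch_ge1 W_eq[of n] by (cases "n \<ge> 1") force+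
  then show "branch lam -` {n} \<inter> space unit_borel \<in> sets unit_borel" using W_sets[of n] by auto
qed auto

lemma F_measurable [measurable]: "F lam \<in> measurable unit_borel unit_borel"
proof (rule measurable_restrict_space2)
  have id: "(\<lambda>x. x) \<in> borel_measurable unit_borel"
    by (rule measurable_restrict_space1) simp
  have "(\<lambda>x. (x - lam ^ n) / slope lam n) \<in> borel_measurable unit_borel" for n
    by (rule borel_measurable_divide[OF borel_measurable_diff[OF id borel_measurable_const] borel_measurable_const])
  then have "(\<lambda>x. (x - lam ^ branch lam x) / slope lam (branch lam x)) \<in> borel_measurable unit_borel"
    by (rule measurable_compose_countable[OF _ branch_measurable, where f="\<lambda>n x. (x - lam ^ n) / slope lam n"])
  then show "F lam \<in> borel_measurable unit_borel"
    by (rule measurable_cong[THEN iffD1, rotated]) (simp add: F_eq)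
qed (use F_unit in auto)

lemma inv_branch_vimage:
  assumes "k \<ge> 1"
  shows "{x \<in> unit_ivl. branch lam x = k \<and> F lam x \<in> B}
    = inv_branch lam k ` {y \<in> unit_ivl \<inter> B. k \<le> branch lam y + 1}"
proof (intro set_eqI iffI)
  fix x assume x: "x \<in> {x \<in> unit_ivl. branch lam x = k \<and> F lam x \<in> B}"
  then show "x \<in> inv_branch lam k ` {y \<in> unit_ivl \<inter> B. k \<le> branch lam y + 1}"
    using inv_branch_F[of x] branch_F[of x] F_unit[of x] by (intro image_eqI[of _ _ "F lam x"]) auto
qed (use assms in \<open>auto simp: branch_inv_branch F_inv_branch inv_branch_unit simp del: greaterThanAtMost_iff\<close>)

lemma branch_F_vimage_sets:
  assumes "B \<in> sets unit_borel"
  shows "{x \<in> unit_ivl. branch lam x = k \<and> F lam x \<in> B} \<in> sets unit_borel"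
proof -
  have "{x \<in> unit_ivl. branch lam x = k \<and> F lam x \<in> B}
      = (branch lam -` {k} \<inter> space unit_borel) \<inter> (F lam -` B \<inter> space unit_borel)" by auto
  also have "\<dots> \<in> sets unit_borel"
    using assms by (intro sets.Int measurable_sets[OF branch_measurable] measurable_sets[OF F_measurable]) auto
  finally show ?thesis .
qed


section \<open>Cylinders\<close>

lemma cyl_Nil: "cyl lam [] = unit_ivl"
  by (auto simp: cyl_def)

lemma cyl_Cons: "cyl lam (j # v) = {x \<in> unit_ivl. branch lam x = j \<and> F lam x \<in> cyl lam v}"
  using F_unit by (auto simp: cyl_def word_Suc)

lemma cyl_sets: "cyl lam w \<in> sets unit_borel"
proof (induction w)
  case Nil
  then show ?case using sets.top[of unit_borel] by (simp add: cyl_Nil)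
next
  case (Cons j v)
  then show ?case unfolding cyl_Cons by (rule branch_F_vimage_sets)
qed

text \<open>The inverse branches contract by at least \<open>1 - lam\<close>, so points with a long common itinerary are close.\<close>

lemma word_eq_imp_close:
  "x \<in> unit_ivl \<Longrightarrow> y \<in> unit_ivl \<Longrightarrow> itin lam m x = itin lam m y
    \<Longrightarrow> \<bar>x - y\<bar> \<le> (1 - lam) ^ m"
proof (induction m arbitrary: x y)
  case (Suc m)
  let ?k = "branch lam x"
  have eq: "branch lam y = ?k"
    and w: "itin lam m (F lam x) = itin lam m (F lam y)"
    using Suc.prems(3) by (simp_all add: word_Suc)
  have IH: "\<bar>F lam x - F lam y\<bar> \<le> (1 - lam) ^ m"
    using Suc.IH[OF F_unit[OF Suc.prems(1)] F_unit[OF Suc.prems(2)] w] .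
  have "x - y = slope lam ?k * (F lam x - F lam y)"
    using inv_branch_F[OF Suc.prems(1)] inv_branch_F[OF Suc.prems(2)] eq
    by (simp add: inv_branch_def algebra_simps)
  then have "\<bar>x - y\<bar> = slope lam ?k * \<bar>F lam x - F lam y\<bar>"
    using slope_pos[of ?k] by (simp add: abs_mult)
  also have "\<dots> \<le> (1 - lam) * (1 - lam) ^ m"
    using IH slope_le lam_less slope_pos[of ?k] by (intro mult_mono) auto
  finally show ?case by simp
qed auto

text \<open>Two cylinders are nested or disjoint, and the empty set is itself a cylinder because branches are numbered
  from 1.\<close>
lemma Int_stable_cyl: "Int_stable (range (cyl lam))"
proof -
  have prefix: "cyl lam v \<inter> cyl lam w \<in> range (cyl lam)" if "length v \<le> length w" for v w
  proof (cases "take (length v) w = v")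
    case True
    have "cyl lam w \<subseteq> cyl lam v"
      using True that by (auto simp: cyl_def) (metis take_word)
    then show ?thesis by (metis Int_absorb1 rangeI)
  next
    case False
    have "cyl lam v \<inter> cyl lam w = {}"
      using False that by (auto simp: cyl_def) (metis take_word)
    moreover have "x \<notin> cyl lam [0]" for x using branch_ge1[of x] by (auto simp: cyl_Cons)
    then have "cyl lam [0] = {}" by blast
    ultimately show ?thesis by (metis rangeI)
  qed
  show ?thesis
  proof (clarsimp simp: Int_stable_def)
    fix v w show "cyl lam v \<inter> cyl lam w \<in> range (cyl lam)"
      using prefix[of v w] prefix[of w v] by (metis Int_commute nle_le)
  qed
qed

text \<open>Cylinders shrink to points, so every interval open on the left is a countable union of cylinders.\<close>
lemma sets_unit_borel_cyl: "sets unit_borel = sigma_sets unit_ivl (range (cyl lam))"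
proof
  show "sigma_sets unit_ivl (range (cyl lam)) \<subseteq> sets unit_borel"
    using cyl_sets sets.sigma_sets_subset[of "range (cyl lam)" unit_borel] by auto
next
  have sub: "range (cyl lam) \<subseteq> Pow unit_ivl" by (auto simp: cyl_def)
  let ?S = "sigma unit_ivl (range (cyl lam))"
  have "(\<lambda>x. x) \<in> borel_measurable ?S"
  proof (subst borel_measurable_iff_greater, intro allI)
    fix a
    have "{x \<in> unit_ivl. a < x} = (\<Union>w\<in>{w. cyl lam w \<subseteq> {a<..}}. cyl lam w)"
    proof (intro set_eqI iffI)
      fix x assume x: "x \<in> {x \<in> unit_ivl. a < x}"
      then obtain m where m: "(1 - lam) ^ m < x - a"
        using real_arch_pow_inv[of "x - a" "1 - lam"] lam_pos by auto
      have "y > a" if "y \<in> cyl lam (itin lam m x)" for y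
        using word_eq_imp_close[of x y m] that x m by (auto simp: cyl_def)
      then have "cyl lam (itin lam m x) \<subseteq> {a<..}" by auto
      moreover have "x \<in> cyl lam (itin lam m x)" using x by (auto simp: cyl_def)
      ultimately show "x \<in> (\<Union>w\<in>{w. cyl lam w \<subseteq> {a<..}}. cyl lam w)" by blast
    qed (auto simp: cyl_def)
    also have "\<dots> \<in> sets ?S"
      using sub by (intro sets.countable_UN') auto
    finally show "{x \<in> space ?S. a < x} \<in> sets ?S" using sub by (simp add: space_measure_of)
  qed
  then have "A \<inter> unit_ivl \<in> sets ?S" if "A \<in> sets borel" for A
    using measurable_sets[of "\<lambda>x. x" ?S borel A] that sub by (simp add: space_measure_of)
  then show "sets unit_borel \<subseteq> sigma_sets unit_ivl (range (cyl lam))"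
    using sub by (auto simp: sets_restrict_space Int_commute)
qed

lemma measure_eqI_cyl:
  assumes "sets \<mu> = sets unit_borel" "sets \<nu> = sets unit_borel" "finite_measure \<mu>"
    and eq: "\<And>w. emeasure \<mu> (cyl lam w) = emeasure \<nu> (cyl lam w)"
  shows "\<mu> = \<nu>"
proof (rule measure_eqI_generator_eq[OF Int_stable_cyl, where A="\<lambda>_. unit_ivl"])
  show "range (cyl lam) \<subseteq> Pow unit_ivl" by (auto simp: cyl_def)
  show "range (\<lambda>_. unit_ivl) \<subseteq> range (cyl lam)" using cyl_Nil by auto
  show "emeasure \<mu> unit_ivl \<noteq> \<infinity>" using assms(3) by (simp add: finite_measure.emeasure_finite)
qed (use assms sets_unit_borel_cyl in auto)

end


section \<open>Measures that scale along the branches\<close>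

text \<open>Conformality expressed on single branches: pulling a set \<open>B\<close> that lies in the image of the branch \<open>k\<close> back along this
  branch multiplies its mass by \<open>q k\<close>.\<close>
definition branch_scaling :: "real \<Rightarrow> (nat \<Rightarrow> real) \<Rightarrow> real measure \<Rightarrow> bool" where
  "branch_scaling lam q m \<longleftrightarrow> finite_measure m \<and> sets m = sets unit_borel \<and>
     (\<forall>k\<ge>1. \<forall>B\<in>sets unit_borel. (\<forall>y\<in>B. k \<le> branch lam y + 1) \<longrightarrow>
        measure m {x \<in> unit_ivl. branch lam x = k \<and> F lam x \<in> B} = q k * measure m B)"

lemma
  assumes "branch_scaling lam q m"
  shows branch_scaling_finite: "finite_measure m"
    and branch_scaling_sets: "sets m = sets unit_borel"
    and branch_scaling_space: "space m = unit_ivl"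
    and branch_scaling_eq: "k \<ge> 1 \<Longrightarrow> B \<in> sets unit_borel \<Longrightarrow> (\<And>y. y \<in> B \<Longrightarrow> k \<le> branch lam y + 1)
      \<Longrightarrow> measure m {x \<in> unit_ivl. branch lam x = k \<and> F lam x \<in> B} = q k * measure m B"
  using assms sets_eq_imp_space_eq[of m unit_borel]
  by (auto simp: branch_scaling_def space_restrict_space simp del: greaterThanAtMost_iff)

context branch_map
begin

definition tail :: "nat \<Rightarrow> real set" where
  "tail n = {x \<in> unit_ivl. n \<le> branch lam x}"

lemma tail_sets: "tail n \<in> sets unit_borel"
proof -
  have "tail n = branch lam -` {n..} \<inter> space unit_borel" by (auto simp: tail_def)
  also have "\<dots> \<in> sets unit_borel" by (rule measurable_sets[OF branch_measurable]) simp
  finally show ?thesis .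
qed

lemma tail_1: "n \<le> 1 \<Longrightarrow> tail n = unit_ivl"
  using branch_ge1 by (fastforce simp: tail_def simp del: greaterThanAtMost_iff)

text \<open>Applied to the full branch \<open>W lam n\<close>, the scaling property is a second-order recursion for the masses of the
  tails.\<close>
lemma measure_tail_Suc:
  assumes m: "branch_scaling lam q m" and n: "n \<ge> 1"
  shows "measure m (tail n) = q n * measure m (tail (n - 1)) + measure m (tail (Suc n))"
proof -
  interpret finite_measure m using m by (rule branch_scaling_finite)
  let ?A = "{x \<in> unit_ivl. branch lam x = n \<and> F lam x \<in> tail (n - 1)}"
  have A: "?A \<in> sets m" "tail (Suc n) \<in> sets m"
    using branch_F_vimage_sets tail_sets by (auto simp: branch_scaling_sets[OF m])
  have "tail n = ?A \<union> tail (Suc n)"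
  proof (intro set_eqI)
    fix z show "z \<in> tail n \<longleftrightarrow> z \<in> ?A \<union> tail (Suc n)"
      using F_unit[of z] branch_F[of z] by (auto simp: tail_def simp del: greaterThanAtMost_iff)
  qed
  moreover have "?A \<inter> tail (Suc n) = {}" by (auto simp: tail_def)
  ultimately have "measure m (tail n) = measure m ?A + measure m (tail (Suc n))"
    using finite_measure_Union[OF A] by simp
  also have "measure m ?A = q n * measure m (tail (n - 1))"
    using n tail_sets by (intro branch_scaling_eq[OF m]) (auto simp: tail_def)
  finally show ?thesis .
qed

lemma measure_tail:
  assumes m: "branch_scaling lam (slope s) m"
  shows "measure m (tail (Suc n)) = s ^ n * measure m unit_ivl"
proof (induction n rule: less_induct)
  case (less n)
  consider "n = 0" | "n = 1" | k where "n = Suc (Suc k)" by (metis One_nat_def not0_implies_Suc)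
  then show ?case
  proof cases
    case 2
    then show ?thesis using measure_tail_Suc[OF m, of 1] by (simp add: tail_1 slope_def algebra_simps numeral_2_eq_2)
  next
    case 3
    then have "measure m (tail (Suc (Suc k))) = s ^ Suc k * measure m unit_ivl"
      "measure m (tail (Suc k)) = s ^ k * measure m unit_ivl"
      using less.IH[of "Suc k"] less.IH[of k] by auto
    then show ?thesis
      using 3 measure_tail_Suc[OF m, of "Suc (Suc k)"] by (simp add: slope_def algebra_simps)
  qed (simp add: tail_1)
qed

text \<open>The scaling property reduces the mass of a cylinder to that of the cylinder without its first symbol. A
  cylinder of length one is the preimage of a tail, and the masses of the tails form a geometric sequence. So
  all masses are proportional to the total mass.\<close>

lemma branch_scaling_cyl:
  assumes m: "branch_scaling lam (slope s) m" and m': "branch_scaling lam (slope s) m'"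
  shows "measure m (cyl lam w) * measure m' unit_ivl = measure m' (cyl lam w) * measure m unit_ivl"
proof (induction w)
  case Nil
  then show ?case by (simp add: cyl_Nil)
next
  case (Cons j v)
  show ?case
  proof (cases "cyl lam (j # v) = {}")
    case False
    then obtain x where x: "x \<in> unit_ivl" "branch lam x = j" "F lam x \<in> cyl lam v"
      by (auto simp: cyl_Cons)
    have j: "j \<ge> 1" using branch_ge1 x by auto
    have cons: "measure \<nu> (cyl lam (j # v)) = slope s j * measure \<nu> (if v = [] then tail (j - 1) else cyl lam v)"
      if \<nu>: "branch_scaling lam (slope s) \<nu>" for \<nu>
    proof -
      have "cyl lam (j # v) = {x \<in> unit_ivl. branch lam x = j \<and> F lam x \<in> (if v = [] then tail (j - 1) else cyl lam v)}"
      proof (intro set_eqI)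
        fix z
        show "z \<in> cyl lam (j # v) \<longleftrightarrow>
            z \<in> {x \<in> unit_ivl. branch lam x = j \<and> F lam x \<in> (if v = [] then tail (j - 1) else cyl lam v)}"
          using F_unit[of z] branch_F[of z]
          by (cases v) (auto simp: cyl_Cons cyl_Nil tail_def simp del: greaterThanAtMost_iff)
      qed
      moreover have "j \<le> branch lam y + 1" if "y \<in> (if v = [] then tail (j - 1) else cyl lam v)" for y
        using that x branch_F[OF x(1)] by (cases v) (auto simp: tail_def cyl_Cons)
      ultimately show ?thesis
        using branch_scaling_eq[OF \<nu> j, of "if v = [] then tail (j - 1) else cyl lam v"]
        by (simp add: tail_sets cyl_sets)
    qed
    have t: "measure \<nu> (tail (j - 1)) = s ^ (j - 2) * measure \<nu> unit_ivl"
      if \<nu>: "branch_scaling lam (slope s) \<nu>" for \<nu>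
      using measure_tail[OF \<nu>, of "j - 2"] j tail_1[of "j - 1"]
      by (cases "j \<ge> 2") (auto simp: Suc_diff_le numeral_2_eq_2 Suc_diff_Suc)
    show ?thesis
      using Cons.IH cons[OF m] cons[OF m'] t[OF m] t[OF m'] by (cases v) (simp_all add: ac_simps)
  qed simp
qed

lemma branch_scaling_unique:
  assumes m: "branch_scaling lam (slope s) m" and m': "branch_scaling lam (slope s) m'"
    and eq: "measure m unit_ivl = measure m' unit_ivl"
  shows "m = m'"
proof (rule measure_eqI_cyl)
  interpret m: finite_measure m using m by (rule branch_scaling_finite)
  interpret m': finite_measure m' using m' by (rule branch_scaling_finite)
  fix w
  show "emeasure m (cyl lam w) = emeasure m' (cyl lam w)"
  proof (cases "measure m unit_ivl = 0")
    case True
    have "measure m (cyl lam w) = 0" "measure m' (cyl lam w) = 0"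
      using True eq m.bounded_measure[of "cyl lam w"] m'.bounded_measure[of "cyl lam w"]
      by (simp_all add: branch_scaling_space[OF m] branch_scaling_space[OF m'] measure_le_0_iff)
    then show ?thesis by (simp add: m.emeasure_eq_measure m'.emeasure_eq_measure)
  next
    case False
    then show ?thesis
      using branch_scaling_cyl[OF m m', of w] eq by (simp add: m.emeasure_eq_measure m'.emeasure_eq_measure)
  qed
qed (use m m' in \<open>auto simp: branch_scaling_def\<close>)

text \<open>The ratio \<open>\<rho>\<close> of successive tails evolves by \<open>\<rho> \<mapsto> 1 - c * s / \<rho>\<close>, which for \<open>c = 1 - s\<close> has the fixed
  point \<open>s\<close>. For a larger \<open>c\<close> it starts below \<open>s\<close> and, as \<open>\<rho> * (1 - \<rho>)\<close> increases below \<open>1 / 2\<close>, falls by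
  at least \<open>c - (1 - s)\<close> in every step, so it becomes negative, which no ratio of masses is.\<close>

lemma branch_scaling_factor_le:
  assumes m: "branch_scaling lam (\<lambda>k. c * (if k = 1 then 1 else s)) m"
    and mass: "measure m unit_ivl > 0" and s: "0 < s" "s < 1 / 2"
  shows "c \<le> 1 - s"
proof (rule ccontr)
  assume "\<not> c \<le> 1 - s"
  define d where "d = c - (1 - s)"
  have d: "d > 0" using \<open>\<not> c \<le> 1 - s\<close> by (simp add: d_def)
  have c: "c > 0" using \<open>\<not> c \<le> 1 - s\<close> s by linarith
  define S where "S n = measure m (tail (Suc n))" for n
  have S0: "S 0 = measure m unit_ivl" by (simp add: S_def tail_1)
  have S1: "S 1 = (1 - c) * S 0"
    using measure_tail_Suc[OF m, of 1] by (simp add: S_def tail_1 algebra_simps numeral_2_eq_2)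
  have rec: "S (Suc (Suc n)) = S (Suc n) - c * s * S n" for n
    using measure_tail_Suc[OF m, of "Suc (Suc n)"] by (simp add: S_def algebra_simps)
  have nn: "S n \<ge> 0" for n by (simp add: S_def)
  have pos: "S n > 0" for n
  proof (induction n)
    case (Suc n)
    have "c * s * S n > 0" using Suc c s by simp
    then show ?case using rec[of n] nn[of "Suc (Suc n)"] by linarith
  qed (use mass S0 in simp)
  have ratio: "S (Suc n) \<le> (s - real (Suc n) * d) * S n" for n
  proof (induction n)
    case (Suc n)
    define a where "a = s - real (Suc n) * d"
    have "a * S n > 0" using Suc pos[of "Suc n"] by (simp add: a_def)
    then have a: "0 < a" "a \<le> s" using pos[of n] d by (auto simp: a_def zero_less_mult_iff)
    have "a * (1 - a) \<le> s * (1 - s)"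
    proof -
      have "s * (1 - s) - a * (1 - a) = (s - a) * (1 - s - a)" by (simp add: algebra_simps)
      also have "\<dots> \<ge> 0" using a s by (intro mult_nonneg_nonneg) auto
      finally show ?thesis by simp
    qed
    moreover have "a * d \<le> s * d" using a d by (intro mult_right_mono) auto
    ultimately have key: "a - c * s \<le> a * (a - d)" by (simp add: d_def algebra_simps)
    have "a * S (Suc (Suc n)) = a * S (Suc n) - c * s * (a * S n)" by (simp add: rec algebra_simps)
    also have "\<dots> \<le> a * S (Suc n) - c * s * S (Suc n)"
      using Suc c s by (simp add: a_def)
    also have "\<dots> \<le> (a * (a - d)) * S (Suc n)"
      using mult_right_mono[OF key less_imp_le[OF pos[of "Suc n"]]] by (simp add: algebra_simps)
    finally have "a * S (Suc (Suc n)) \<le> a * ((a - d) * S (Suc n))" by (simp add: algebra_simps)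
    then have "S (Suc (Suc n)) \<le> (a - d) * S (Suc n)" using a by simp
    moreover have "a - d = s - real (Suc (Suc n)) * d" by (simp add: a_def algebra_simps)
    ultimately show ?case by simp
  qed (use S1 in \<open>simp add: d_def\<close>)
  obtain n :: nat where n: "real n > s / d" using reals_Archimedean2 by blast
  have "s - real (Suc n) * d < 0" using n d by (simp add: field_simps)
  then have "(s - real (Suc n) * d) * S n < 0" using pos[of n] by (simp add: mult_neg_pos)
  then show False using ratio[of n] pos[of "Suc n"] by linarith
qed


section \<open>Existence of the scaling measures\<close>

abbreviation unit_lebesgue :: "real measure" where
  "unit_lebesgue \<equiv> restrict_space lborel unit_ivl"

lemma sets_unit_lebesgue: "sets unit_lebesgue = sets unit_borel"
  by (rule sets_restrict_space_cong) simp

lemma prob_space_unit_lebesgue: "prob_space unit_lebesgue"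
  by (rule prob_spaceI) (simp add: emeasure_restrict_space space_restrict_space)

text \<open>The inverse branches are affine with slopes \<open>slope lam k\<close>.\<close>
lemma branch_scaling_lebesgue: "branch_scaling lam (slope lam) unit_lebesgue"
  unfolding branch_scaling_def
proof (intro conjI allI impI ballI)
  interpret prob_space unit_lebesgue by (rule prob_space_unit_lebesgue)
  show "finite_measure unit_lebesgue" by unfold_locales
  show "sets unit_lebesgue = sets unit_borel" by (rule sets_unit_lebesgue)
  fix k :: nat and B assume k: "k \<ge> 1" and B: "B \<in> sets unit_borel" and le: "\<forall>y\<in>B. k \<le> branch lam y + 1"
  have sub: "A \<subseteq> unit_ivl \<and> A \<in> sets borel" if "A \<in> sets unit_borel" for A
    using that by (simp add: sets_restrict_space_iff)
  let ?A = "{x \<in> unit_ivl. branch lam x = k \<and> F lam x \<in> B}"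
  have A: "?A \<in> sets unit_borel" using B by (rule branch_F_vimage_sets)
  have img: "?A = (\<lambda>y. slope lam k *\<^sub>R y + lam ^ k) ` B"
  proof -
    have "{y \<in> unit_ivl \<inter> B. k \<le> branch lam y + 1} = B" using le sub[OF B] by blast
    then show ?thesis
      using inv_branch_vimage[OF k, of B] by (simp add: inv_branch_def[abs_def] add.commute)
  qed
  have "measure unit_lebesgue ?A = measure lebesgue ?A"
    using sub[OF A] by (simp add: measure_restrict_space measure_completion)
  also have "\<dots> = slope lam k * measure lebesgue B"
    unfolding img using slope_pos[of k] by (simp only: measure_lebesgue_affine) simp
  also have "measure lebesgue B = measure unit_lebesgue B"
    using sub[OF B] by (simp add: measure_restrict_space measure_completion)
  finally show "measure unit_lebesgue ?A = slope lam k * measure unit_lebesgue B" .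
qed

end

text \<open>The point whose itinerary under \<open>F lam\<close> equals that of \<open>x\<close> under \<open>F s\<close> is the limit of the compositions
  of inverse branches along this itinerary. They are applied to 0, the lower end of all the images, which makes
  the approximations increase.\<close>

fun conj_approx :: "real \<Rightarrow> real \<Rightarrow> nat \<Rightarrow> real \<Rightarrow> real" where
  "conj_approx lam s 0 x = 0"
| "conj_approx lam s (Suc n) x = inv_branch lam (branch s x) (conj_approx lam s n (F s x))"

definition conj_map :: "real \<Rightarrow> real \<Rightarrow> real \<Rightarrow> real" where
  "conj_map lam s x = lim (\<lambda>n. conj_approx lam s n x)"

definition scaling_measure :: "real \<Rightarrow> real \<Rightarrow> real measure" where
  "scaling_measure lam s = distr (restrict_space lborel unit_ivl) unit_borel (conj_map lam s)"

locale branch_map_pair = branch_map lam + S: branch_map s for lam s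
begin

lemma conj_approx_le:
  "x \<in> unit_ivl \<Longrightarrow> 0 \<le> conj_approx lam s n x \<and> conj_approx lam s n x \<le> lam ^ (branch s x - 1)"
proof (induction n arbitrary: x)
  case (Suc n)
  let ?k = "branch s x" and ?y = "F s x"
  have y: "?y \<in> unit_ivl" using S.F_unit[OF Suc.prems] .
  note IH = Suc.IH[OF y]
  have "lam ^ (branch s ?y - 1) \<le> lam ^ (?k - 2)"
    using S.branch_F[OF Suc.prems] by (intro pow_le) auto
  then have le: "slope lam ?k * conj_approx lam s n ?y \<le> slope lam ?k * lam ^ (?k - 2)"
    using IH slope_pos[of ?k] by (intro mult_left_mono) auto
  have nn: "0 \<le> slope lam ?k * conj_approx lam s n ?y" "0 \<le> lam ^ ?k"
    using IH slope_pos[of ?k] lam_pos by auto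
  show ?case
    unfolding conj_approx.simps inv_branch_def
    using F_pow_le[OF S.branch_ge1[OF Suc.prems]] le nn by (intro conjI; linarith)
qed (use lam_pos in auto)

lemma conj_approx_mono:
  "x \<in> unit_ivl \<Longrightarrow> conj_approx lam s n x \<le> conj_approx lam s (Suc n) x"
proof (induction n arbitrary: x)
  case 0
  then show ?case using conj_approx_le[of x 1] by simp
next
  case (Suc n)
  then show ?case
    using Suc.IH[OF S.F_unit[OF Suc.prems]] slope_pos[of "branch s x"]
    by (simp add: inv_branch_def)
qed

lemma conj_approx_LIMSEQ:
  assumes x: "x \<in> unit_ivl"
  shows "(\<lambda>n. conj_approx lam s n x) \<longlonglongrightarrow> conj_map lam s x"
proof -
  have "incseq (\<lambda>n. conj_approx lam s n x)"
    by (rule incseq_SucI) (rule conj_approx_mono[OF x])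
  then obtain L where "(\<lambda>n. conj_approx lam s n x) \<longlonglongrightarrow> L"
    by (rule incseq_convergent[where B="lam ^ (branch s x - 1)"]) (use conj_approx_le[OF x] in blast)
  then have "convergent (\<lambda>n. conj_approx lam s n x)" by (rule convergentI)
  then show ?thesis by (simp add: conj_map_def convergent_LIMSEQ_iff)
qed

lemma conj_map_eq:
  assumes x: "x \<in> unit_ivl"
  shows "conj_map lam s x = inv_branch lam (branch s x) (conj_map lam s (F s x))"
proof (rule LIMSEQ_unique)
  show "(\<lambda>n. conj_approx lam s (Suc n) x) \<longlonglongrightarrow> conj_map lam s x"
    using conj_approx_LIMSEQ[OF x] by (rule LIMSEQ_Suc)
  show "(\<lambda>n. conj_approx lam s (Suc n) x) \<longlonglongrightarrow> inv_branch lam (branch s x) (conj_map lam s (F s x))"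
    unfolding conj_approx.simps inv_branch_def
    by (intro tendsto_intros conj_approx_LIMSEQ S.F_unit x)
qed

lemma
  assumes x: "x \<in> unit_ivl"
  shows conj_map_unit: "conj_map lam s x \<in> unit_ivl"
    and branch_conj_map: "branch lam (conj_map lam s x) = branch s x"
proof -
  have nonneg: "conj_map lam s y \<ge> 0" if "y \<in> unit_ivl" for y
    using conj_approx_le[OF that] by (intro LIMSEQ_le_const[OF conj_approx_LIMSEQ[OF that]]) auto
  have pos: "conj_map lam s y > 0" if "y \<in> unit_ivl" for y
    using nonneg[OF S.F_unit[OF that]] slope_pos[of "branch s y"] lam_pos
    by (subst conj_map_eq[OF that]) (simp add: inv_branch_def add_pos_nonneg)
  have "conj_map lam s x > lam ^ branch s x"
    using pos[OF S.F_unit[OF x]] slope_pos[of "branch s x"]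
    by (subst conj_map_eq[OF x]) (simp add: inv_branch_def)
  moreover have "conj_map lam s x \<le> lam ^ (branch s x - 1)"
    using conj_approx_le[OF x] by (intro LIMSEQ_le_const2[OF conj_approx_LIMSEQ[OF x]]) auto
  ultimately have W: "conj_map lam s x \<in> W lam (branch s x)" by (auto simp: W_def)
  then show u: "conj_map lam s x \<in> unit_ivl" using W_subset[OF S.branch_ge1[OF x]] by blast
  show "branch lam (conj_map lam s x) = branch s x" using branch_eqI[OF u S.branch_ge1[OF x] W] .
qed

lemma F_conj_map:
  assumes x: "x \<in> unit_ivl"
  shows "F lam (conj_map lam s x) = conj_map lam s (F s x)"
  using S.F_unit[OF x] S.branch_F[OF x] S.branch_ge1[OF x]
  by (subst conj_map_eq[OF x]) (intro F_inv_branch, auto simp: branch_conj_map conj_map_unit simp del: greaterThanAtMost_iff)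

lemma conj_map_measurable: "conj_map lam s \<in> measurable unit_borel unit_borel"
proof (rule measurable_restrict_space2)
  have approx: "conj_approx lam s n \<in> borel_measurable unit_borel" for n
  proof (induction n)
    case 0
    have "conj_approx lam s 0 = (\<lambda>_. 0)" by auto
    then show ?case by simp
  next
    case (Suc n)
    have c: "(\<lambda>x. conj_approx lam s n (F s x)) \<in> borel_measurable unit_borel"
      by (rule measurable_compose[OF S.F_measurable Suc])
    have "(\<lambda>x. inv_branch lam k (conj_approx lam s n (F s x))) \<in> borel_measurable unit_borel" for k
      unfolding inv_branch_def
      by (rule borel_measurable_add[OF borel_measurable_const borel_measurable_times[OF borel_measurable_const c]])
    then have "(\<lambda>x. inv_branch lam (branch s x) (conj_approx lam s n (F s x))) \<in> borel_measurable unit_borel"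
      by (rule measurable_compose_countable[OF _ S.branch_measurable,
          where f="\<lambda>k x. inv_branch lam k (conj_approx lam s n (F s x))"])
    then show ?case by (simp add: fun_eq_iff[of "conj_approx lam s (Suc n)", symmetric] conj_approx.simps(2)[abs_def])
  qed
  show "conj_map lam s \<in> borel_measurable unit_borel"
    by (rule borel_measurable_LIMSEQ_real[OF conj_approx_LIMSEQ approx]) simp
qed (use conj_map_unit in auto)

lemma prob_space_scaling_measure: "prob_space (scaling_measure lam s)"
  unfolding scaling_measure_def
  using conj_map_measurable prob_space_unit_lebesgue
  by (intro prob_space.prob_space_distr)
     (simp_all add: measurable_cong_sets[OF sets_unit_lebesgue refl])

text \<open>The scaling property of Lebesgue measure for \<open>F s\<close> is carried over by the conjugacy, which preserves the
  numbering of the branches.\<close>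
lemma branch_scaling_scaling_measure: "branch_scaling lam (slope s) (scaling_measure lam s)"
  unfolding branch_scaling_def
proof (intro conjI allI impI ballI)
  let ?h = "conj_map lam s"
  interpret prob_space "scaling_measure lam s" by (rule prob_space_scaling_measure)
  show "finite_measure (scaling_measure lam s)" by unfold_locales
  show "sets (scaling_measure lam s) = sets unit_borel" by (simp add: scaling_measure_def)
  have h: "?h \<in> measurable unit_lebesgue unit_borel"
    using conj_map_measurable by (simp add: measurable_cong_sets[OF sets_unit_lebesgue refl])
  have meas: "measure (scaling_measure lam s) A = measure unit_lebesgue {x \<in> unit_ivl. ?h x \<in> A}"
    if "A \<in> sets unit_borel" for A
    using that unfolding scaling_measure_def
    by (subst measure_distr[OF h]) (auto simp: space_restrict_space vimage_def Int_def conj_commute)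
  fix k :: nat and B assume k: "k \<ge> 1" and B: "B \<in> sets unit_borel" and le: "\<forall>y\<in>B. k \<le> branch lam y + 1"
  let ?A = "{x \<in> unit_ivl. branch lam x = k \<and> F lam x \<in> B}" and ?B = "{x \<in> unit_ivl. ?h x \<in> B}"
  have "{x \<in> unit_ivl. ?h x \<in> ?A} = {x \<in> unit_ivl. branch s x = k \<and> F s x \<in> ?B}"
    using conj_map_unit branch_conj_map F_conj_map S.F_unit by (auto simp del: greaterThanAtMost_iff)
  moreover have cond: "k \<le> branch s y + 1" if "y \<in> ?B" for y
    using that le branch_conj_map[of y] by auto
  moreover have "?B \<in> sets unit_borel"
    using measurable_sets[OF conj_map_measurable B] by (simp add: vimage_def Int_def conj_commute)
  ultimately have "measure unit_lebesgue {x \<in> unit_ivl. ?h x \<in> ?A} = slope s k * measure unit_lebesgue ?B"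
    using branch_scaling_eq[OF S.branch_scaling_lebesgue k, of ?B] cond by (simp only:)
  then show "measure (scaling_measure lam s) ?A = slope s k * measure (scaling_measure lam s) B"
    by (simp only: meas[OF B] meas[OF branch_F_vimage_sets[OF B]])
qed

end


section \<open>Upper bounds for the entropy of an invariant measure\<close>

locale invariant_measure = branch_map +
  fixes \<mu> :: "real measure"
  assumes invariant: "\<mu> \<in> invariant_measures lam"
begin

lemma sets_mu: "sets \<mu> = sets unit_borel"
  using invariant by (simp add: invariant_measures_def)

lemma space_mu: "space \<mu> = unit_ivl"
  using sets_eq_imp_space_eq[OF sets_mu] by (simp add: space_restrict_space)

end

sublocale invariant_measure \<subseteq> measure_preserving_map \<mu> "F lam"
proof -
  interpret prob_space \<mu> using invariant by (simp add: invariant_measures_def)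
  have F: "F lam \<in> measurable \<mu> \<mu>"
    using F_measurable by (simp add: measurable_cong_sets[OF sets_mu sets_mu])
  have "distr \<mu> \<mu> (F lam) = \<mu>"
  proof (rule measure_eqI)
    fix A assume "A \<in> sets (distr \<mu> \<mu> (F lam))"
    then show "emeasure (distr \<mu> \<mu> (F lam)) A = emeasure \<mu> A"
      using invariant by (simp add: emeasure_distr[OF F] invariant_measures_def)
  qed simp
  with F show "measure_preserving_map \<mu> (F lam)" by unfold_locales
qed

text \<open>Truncation makes the symbols bounded, so that all entropies and integrals below are finite without any moment
  condition on the measure. It preserves the transition rule.\<close>
definition trunc_branch :: "real \<Rightarrow> nat \<Rightarrow> real \<Rightarrow> nat" where
  "trunc_branch lam N x = min (branch lam x) N"

abbreviation trunc_itin :: "real \<Rightarrow> nat \<Rightarrow> nat \<Rightarrow> real \<Rightarrow> nat list" where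
  "trunc_itin lam N \<equiv> word (F lam) (trunc_branch lam N)"

text \<open>A law for the present symbol \<open>j\<close>, depending on the word of the next symbols, whose first entry \<open>k\<close> allows exactly
  \<open>j \<in> {1..k + 1}\<close>.\<close>
definition backward_kernel :: "(nat \<Rightarrow> nat list \<Rightarrow> real) \<Rightarrow> bool" where
  "backward_kernel G \<longleftrightarrow>
    (\<forall>j k w. (j \<in> {1..k + 1} \<longrightarrow> G j (k # w) > 0) \<and> (j \<notin> {1..k + 1} \<longrightarrow> G j (k # w) = 0)) \<and>
    (\<forall>k w. k \<ge> 1 \<longrightarrow> (\<Sum>j=1..k + 1. G j (k # w)) \<le> 1)"

context branch_map
begin

lemma trunc_itin_eq_iff:
  assumes "\<forall>k\<in>set v. k < N"
  shows "trunc_itin lam N (length v) x = v \<longleftrightarrow> itin lam (length v) x = v"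
proof -
  have "min a N = b \<longleftrightarrow> a = b" if "b < N" for a b :: nat using that by (auto simp: min_def)
  then show ?thesis
    using assms by (simp add: list_eq_iff_nth_eq word_nth trunc_branch_def all_set_conv_all_nth)
qed

lemma trunc_itin_eq_itin:
  assumes "\<forall>i<m. branch lam ((F lam ^^ i) x) < N"
  shows "trunc_itin lam N m x = itin lam m x"
  using assms by (simp add: list_eq_iff_nth_eq word_nth trunc_branch_def min_absorb1 less_imp_le)

lemma trunc_branch_bounds:
  assumes "x \<in> unit_ivl" "N \<ge> 1"
  shows "1 \<le> trunc_branch lam N x" "trunc_branch lam N x \<le> trunc_branch lam N (F lam x) + 1"
  using branch_ge1[OF assms(1)] branch_F[OF assms(1)] assms(2) by (auto simp: trunc_branch_def)

end

context invariant_measure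
begin

lemma tail_sets_mu: "tail n \<in> sets \<mu>"
  by (simp add: sets_mu tail_sets)

lemma simple_function_trunc_branch: "simple_function \<mu> (trunc_branch lam N)"
  unfolding simple_function_def
proof (intro conjI ballI)
  show "finite (trunc_branch lam N ` space \<mu>)"
    by (rule finite_subset[of _ "{..N}"]) (auto simp: trunc_branch_def)
  fix k
  have "trunc_branch lam N -` {k} \<inter> space unit_borel = branch lam -` {i. min i N = k} \<inter> space unit_borel"
    by (auto simp: trunc_branch_def)
  also have "\<dots> \<in> sets unit_borel" by (rule measurable_sets[OF branch_measurable]) simp
  finally show "trunc_branch lam N -` {k} \<inter> space \<mu> \<in> sets \<mu>" by (simp add: sets_mu space_mu)
qed

lemma prob_tail_LIMSEQ: "(\<lambda>n. prob (tail n)) \<longlonglongrightarrow> 0"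
proof -
  have "(\<lambda>n. prob (tail n)) \<longlonglongrightarrow> prob (\<Inter>n. tail n)"
  proof (rule finite_Lim_measure_decseq)
    show "range tail \<subseteq> sets \<mu>" using tail_sets_mu by blast
    show "decseq tail" by (auto simp: decseq_def tail_def)
  qed
  moreover have "(\<Inter>n. tail n) = {}"
  proof -
    have "x \<notin> tail (Suc (branch lam x))" for x by (simp add: tail_def)
    then show ?thesis by blast
  qed
  ultimately show ?thesis by simp
qed

lemma compact_approx:
  assumes A: "A \<in> sets \<mu>" and e: "e > 0"
  obtains K where "compact K" "K \<subseteq> A" "K \<in> sets \<mu>" "prob (A - K) \<le> e"
proof -
  have A': "A \<subseteq> unit_ivl" "A \<in> sets borel" using A by (auto simp: sets_mu sets_restrict_space_iff)
  have id: "(\<lambda>x. x) \<in> measurable \<mu> borel"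
    by (simp add: measurable_cong_sets[OF sets_mu refl] measurable_restrict_space1)
  let ?\<nu> = "distr \<mu> borel (\<lambda>x. x)"
  interpret nu: prob_space ?\<nu> by (rule prob_space_distr[OF id])
  have nu: "emeasure ?\<nu> B = emeasure \<mu> B" if "B \<in> sets borel" "B \<subseteq> unit_ivl" for B
    using that by (subst emeasure_distr[OF id]) (auto simp: space_mu Int_absorb2)
  have "emeasure ?\<nu> A = (SUP K\<in>{K. K \<subseteq> A \<and> compact K}. emeasure ?\<nu> K)"
    by (rule inner_regular) (use A' nu.emeasure_finite in auto)
  then have "\<exists>K\<in>{K. K \<subseteq> A \<and> compact K}. emeasure ?\<nu> A < emeasure ?\<nu> K + ennreal e"
    using e nu.emeasure_finite[of A] by (intro SUP_approx_ennreal) auto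
  then obtain K where K: "K \<subseteq> A" "compact K" "emeasure ?\<nu> A < emeasure ?\<nu> K + ennreal e" by auto
  have Kb: "K \<in> sets borel" "K \<subseteq> unit_ivl" using K A' by (auto intro: borel_compact)
  then have Ks: "K \<in> sets \<mu>" by (simp add: sets_mu sets_restrict_space_iff)
  have "emeasure \<mu> A < emeasure \<mu> K + ennreal e" using K(3) nu Kb A' by simp
  then have "prob A \<le> prob K + e"
    using e by (simp add: emeasure_eq_measure ennreal_plus[symmetric] ennreal_less_iff del: ennreal_plus)
  then have "prob (A - K) \<le> e" using finite_measure_Diff[OF A Ks K(1)] by simp
  with K Ks show ?thesis using that by blast
qed

text \<open>Long truncated itineraries nearly determine the cell of any finite partition: compact subsets of the cells, filling up
  almost all mass, have positive distance, while points with a common long itinerary are close.\<close>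

lemma cell_guess:
  assumes \<xi>: "finite_measurable_partition \<mu> \<xi>" and e: "e > 0"
  shows "\<exists>m0. \<forall>m\<ge>m0. \<exists>N0. \<forall>N\<ge>N0. \<exists>guess. (\<forall>w. guess w \<in> \<xi>) \<and>
    prob {x \<in> space \<mu>. cell \<xi> x \<noteq> guess (trunc_itin lam N m x)} \<le> e"
proof -
  have p: "partition_on (space \<mu>) \<xi>" and fin: "finite \<xi>" and sub: "\<xi> \<subseteq> sets \<mu>" using \<xi> by auto
  obtain A0 where A0: "A0 \<in> \<xi>" using p not_empty by (auto simp: partition_on_def)
  then have card: "card \<xi> > 0" using fin by (auto simp: card_gt_0_iff)
  have "\<forall>A\<in>\<xi>. \<exists>K. compact K \<and> K \<subseteq> A \<and> K \<in> sets \<mu> \<and> prob (A - K) \<le> e / (2 * card \<xi>)"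
    using compact_approx[of _ "e / (2 * card \<xi>)"] e card sub by (metis divide_pos_pos in_mono mult_pos_pos of_nat_0_less_iff zero_less_numeral)
  then obtain K where K: "\<And>A. A \<in> \<xi> \<Longrightarrow> compact (K A)" "\<And>A. A \<in> \<xi> \<Longrightarrow> K A \<subseteq> A"
      "\<And>A. A \<in> \<xi> \<Longrightarrow> K A \<in> sets \<mu>" "\<And>A. A \<in> \<xi> \<Longrightarrow> prob (A - K A) \<le> e / (2 * card \<xi>)"
    by metis
  have "\<forall>P\<in>\<xi> \<times> \<xi>. \<exists>d>0. fst P \<noteq> snd P \<longrightarrow> (\<forall>x\<in>K (fst P). \<forall>y\<in>K (snd P). d \<le> dist x y)"
  proof
    fix P assume P: "P \<in> \<xi> \<times> \<xi>"
    show "\<exists>d>0. fst P \<noteq> snd P \<longrightarrow> (\<forall>x\<in>K (fst P). \<forall>y\<in>K (snd P). d \<le> dist x y)"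
    proof (cases "fst P = snd P")
      case False
      moreover have "fst P \<in> \<xi>" "snd P \<in> \<xi>" using P by auto
      ultimately have "fst P \<inter> snd P = {}" using disjointD[OF partition_onD2[OF p]] by blast
      then have "K (fst P) \<inter> K (snd P) = {}" using K(2)[of "fst P"] K(2)[of "snd P"] \<open>fst P \<in> \<xi>\<close> \<open>snd P \<in> \<xi>\<close> by blast
      moreover have "compact (K (fst P))" "closed (K (snd P))"
        using K(1) P by (auto intro: compact_imp_closed)
      ultimately show ?thesis using separate_compact_closed[of "K (fst P)" "K (snd P)"] by auto
    qed (auto intro: exI[of _ 1])
  qed
  then obtain d where d: "\<And>P. P \<in> \<xi> \<times> \<xi> \<Longrightarrow> d P > 0"
      "\<And>P x y. P \<in> \<xi> \<times> \<xi> \<Longrightarrow> fst P \<noteq> snd P \<Longrightarrow> x \<in> K (fst P) \<Longrightarrow> y \<in> K (snd P) \<Longrightarrow> d P \<le> dist x y"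
    by metis
  define \<eta> where "\<eta> = Min (d ` (\<xi> \<times> \<xi>))"
  have finP: "finite (d ` (\<xi> \<times> \<xi>))" "d ` (\<xi> \<times> \<xi>) \<noteq> {}" using fin A0 by auto
  have \<eta>: "\<eta> > 0" unfolding \<eta>_def using finP d(1) by (subst Min_gr_iff) auto
  have sep: "A = B" if "A \<in> \<xi>" "B \<in> \<xi>" "x \<in> K A" "y \<in> K B" "\<bar>x - y\<bar> < \<eta>" for A B x y
  proof (rule ccontr)
    assume "A \<noteq> B"
    then have "d (A, B) \<le> dist x y" using d(2)[of "(A, B)" x y] that by auto
    moreover have "\<eta> \<le> d (A, B)" unfolding \<eta>_def using finP that by (intro Min_le) auto
    ultimately show False using that by (simp add: dist_real_def)
  qed
  obtain m0 where m0: "(1 - lam) ^ m0 < \<eta>"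
    using real_arch_pow_inv[of \<eta> "1 - lam"] \<eta> lam_pos by auto
  show ?thesis
  proof (rule exI[of _ m0], intro allI impI)
    fix m assume "m \<ge> m0"
    then have "(1 - lam) ^ m \<le> (1 - lam) ^ m0" using lam_pos lam_less by (intro power_decreasing) auto
    with m0 have m: "(1 - lam) ^ m < \<eta>" by linarith
    (* By invariance each of the m symbols is truncated with probability prob (tail N). *)
    have "(\<lambda>n. real m * prob (tail n)) \<longlonglongrightarrow> real m * 0" by (intro tendsto_intros prob_tail_LIMSEQ)
    then have "eventually (\<lambda>n. real m * prob (tail n) < e / 2) sequentially"
      using e by (intro order_tendstoD(2)) auto
    then obtain N0 where N0: "\<And>N. N \<ge> N0 \<Longrightarrow> real m * prob (tail N) < e / 2"
      by (auto simp: eventually_sequentially)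
    show "\<exists>N0. \<forall>N\<ge>N0. \<exists>guess. (\<forall>w. guess w \<in> \<xi>) \<and>
        prob {x \<in> space \<mu>. cell \<xi> x \<noteq> guess (trunc_itin lam N m x)} \<le> e"
    proof (rule exI[of _ N0], intro allI impI)
      fix N assume N: "N \<ge> N0"
      let ?good = "\<lambda>w A. A \<in> \<xi> \<and> (\<exists>x\<in>K A. itin lam m x = w)"
      define guess where "guess w = (if \<exists>A. ?good w A then (SOME A. ?good w A) else A0)" for w
      have guess_good: "?good w (guess w)" if "\<exists>A. ?good w A" for w
        using someI_ex[OF that] that unfolding guess_def by simp
      then have guess_mem: "guess w \<in> \<xi>" for w using A0 by (cases "\<exists>A. ?good w A") (auto simp: guess_def)
      let ?W = "trunc_itin lam N m"
      let ?bad = "{x \<in> space \<mu>. cell \<xi> x \<noteq> guess (?W x)}"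
      let ?B1 = "\<Union>A\<in>\<xi>. A - K A" and ?B2 = "\<Union>i<m. (F lam ^^ i) -` tail N \<inter> space \<mu>"
      have "?bad \<subseteq> ?B1 \<union> ?B2"
      proof
        fix x assume x: "x \<in> ?bad"
        show "x \<in> ?B1 \<union> ?B2"
        proof (rule ccontr)
          assume n: "x \<notin> ?B1 \<union> ?B2"
          let ?A = "cell \<xi> x"
          have A: "?A \<in> \<xi>" "x \<in> ?A" using cell_mem[OF p] x by auto
          then have xK: "x \<in> K ?A" using n by blast
          have "branch lam ((F lam ^^ i) x) < N" if "i < m" for i
          proof -
            have "(F lam ^^ i) x \<notin> tail N" using n x that by blast
            then show ?thesis using funpow_space[of x i] x by (auto simp: tail_def space_mu)
          qed
          then have w: "?W x = itin lam m x" by (intro trunc_itin_eq_itin) auto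
          have "?good (?W x) ?A" using A xK w by auto
          then have g: "?good (?W x) (guess (?W x))" using guess_good by blast
          then obtain y where y: "y \<in> K (guess (?W x))"
            "itin lam m y = itin lam m x" using w by auto
          have "K (guess (?W x)) \<subseteq> space \<mu>" using K(3)[OF guess_mem] sets.sets_into_space by blast
          then have "y \<in> unit_ivl" "x \<in> unit_ivl" using y x by (auto simp: space_mu)
          then have "\<bar>x - y\<bar> \<le> (1 - lam) ^ m" using word_eq_imp_close y(2) by metis
          then have "?A = guess (?W x)" using sep[OF A(1) guess_mem xK y(1)] m by simp
          then show False using x by simp
        qed
      qed
      moreover have s1: "?B1 \<in> sets \<mu>" using fin sub K(3) by (intro sets.finite_UN) auto
      moreover have s2: "?B2 \<in> sets \<mu>"
        by (intro sets.finite_UN measurable_sets[OF funpow_measurable] tail_sets_mu) auto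
      ultimately have "prob ?bad \<le> prob (?B1 \<union> ?B2)" by (intro finite_measure_mono) auto
      also have "\<dots> \<le> prob ?B1 + prob ?B2" using s1 s2 by (rule measure_Un_le)
      also have "prob ?B1 \<le> (\<Sum>A\<in>\<xi>. prob (A - K A))"
        using fin sub K(3) by (intro finite_measure_subadditive_finite) auto
      also have "\<dots> \<le> (\<Sum>A\<in>\<xi>. e / (2 * card \<xi>))" using K(4) by (intro sum_mono) auto
      also have "\<dots> = e / 2" using card by simp
      also have "prob ?B2 \<le> (\<Sum>i<m. prob ((F lam ^^ i) -` tail N \<inter> space \<mu>))"
        by (intro finite_measure_subadditive_finite) (auto intro!: measurable_sets[OF funpow_measurable] tail_sets_mu)
      also have "\<dots> = real m * prob (tail N)" by (simp add: prob_funpow_vimage tail_sets_mu)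
      finally have "prob ?bad \<le> e" using N0[OF N] by linarith
      then show "\<exists>guess. (\<forall>w. guess w \<in> \<xi>) \<and>
          prob {x \<in> space \<mu>. cell \<xi> x \<noteq> guess (trunc_itin lam N m x)} \<le> e"
        using guess_mem by blast
    qed
  qed
qed

text \<open>A form of the generator theorem adapted to codes. The observed letter is the cell of an arbitrary partition \<open>\<xi>\<close>
  together with a long truncated itinerary. A letter is coded given the next one by spending \<open>G\<close> on its first symbol,
  nothing on the remaining symbols, which the next letter already shows, and almost nothing on the cell of
  \<open>\<xi>\<close>, which the itinerary allows to guess.\<close>
theorem ks_entropy_le_kernel:
  assumes G: "backward_kernel G" and l: "l \<ge> 1"
    and C: "\<And>N. N \<ge> b \<Longrightarrow>
      (\<integral>x. - ln (G (trunc_branch lam N x) (trunc_itin lam N l (F lam x))) \<partial>\<mu>) \<le> C"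
  shows "ks_entropy \<mu> (F lam) \<le> ereal C"
  unfolding ks_entropy_def
proof (rule SUP_least)
  fix \<xi> assume "\<xi> \<in> {\<xi>. finite_measurable_partition \<mu> \<xi>}"
  then have \<xi>: "finite_measurable_partition \<mu> \<xi>" by simp
  then have p: "partition_on (space \<mu>) \<xi>" and fin: "finite \<xi>" by auto
  have "entropy_wrt \<mu> (F lam) \<xi> \<le> C"
  proof (rule field_le_epsilon)
    fix e :: real assume e: "e > 0"
    let ?K = "real (card \<xi>)"
    obtain A0 where A0: "A0 \<in> \<xi>" using p not_empty by (auto simp: partition_on_def)
    then have K: "?K \<ge> 1" using fin by (simp add: Suc_le_eq card_gt_0_iff) blast
    (* A correct guess of the cell costs - ln (1 - \<kappa>) = e / 2; a wrong one costs at most D, and \<delta> bounds the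
       probability of a wrong guess so that these add at most e / 2 on average. *)
    define \<kappa> where "\<kappa> = 1 - exp (- (e / 2))"
    have \<kappa>: "0 < \<kappa>" "\<kappa> < 1" using e by (auto simp: \<kappa>_def)
    define D where "D = ln (?K / \<kappa>)"
    have D: "D \<ge> 0" unfolding D_def using K \<kappa> by (intro ln_ge_zero) (simp add: field_simps)
    define \<delta> where "\<delta> = e / (2 * (D + 1))"
    have \<delta>: "\<delta> > 0" "\<delta> * D \<le> e / 2"
      using e D by (auto simp: \<delta>_def field_simps)
    obtain m0 where m0: "\<And>m. m \<ge> m0 \<Longrightarrow> \<exists>N0. \<forall>N\<ge>N0. \<exists>guess. (\<forall>w. guess w \<in> \<xi>) \<and>
      prob {x \<in> space \<mu>. cell \<xi> x \<noteq> guess (trunc_itin lam N m x)} \<le> \<delta>"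
      using cell_guess[OF \<xi> \<delta>(1)] by blast
    define m where "m = max m0 l"
    have m: "m \<ge> l" "m \<ge> m0" by (auto simp: m_def)
    obtain N1 where N1: "\<And>N. N \<ge> N1 \<Longrightarrow> \<exists>guess. (\<forall>w. guess w \<in> \<xi>) \<and>
      prob {x \<in> space \<mu>. cell \<xi> x \<noteq> guess (trunc_itin lam N m x)} \<le> \<delta>"
      using m0[OF m(2)] by blast
    define N where "N = max (max b N1) 1"
    have N: "N \<ge> b" "N \<ge> 1" "N \<ge> N1" by (auto simp: N_def)
    obtain guess where guess: "\<And>w. guess w \<in> \<xi>"
      and bad: "prob {x \<in> space \<mu>. cell \<xi> x \<noteq> guess (trunc_itin lam N m x)} \<le> \<delta>"
      using N1[OF N(3)] by blast
    define r where "r a w = (if a = guess w then 1 - \<kappa> else \<kappa> / ?K)" for a w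
    have r_pos: "r a w > 0" for a w using \<kappa> K by (simp add: r_def)
    have r_sum: "(\<Sum>a\<in>\<xi>. r a w) \<le> 1" for w
    proof -
      have "(\<Sum>a\<in>\<xi>. r a w) = (1 - \<kappa>) + (\<Sum>a\<in>\<xi> - {guess w}. \<kappa> / ?K)"
        using sum.remove[OF fin guess, of "\<lambda>a. r a w" w] by (simp add: r_def)
      also have "(\<Sum>a\<in>\<xi> - {guess w}. \<kappa> / ?K) \<le> (\<Sum>a\<in>\<xi>. \<kappa> / ?K)"
        using fin \<kappa> by (intro sum_mono2) auto
      also have "\<dots> = \<kappa>" using K by simp
      finally show ?thesis by simp
    qed
    let ?W = "trunc_itin lam N m"
    let ?Wl = "trunc_itin lam N l"
    define Y where "Y x = (cell \<xi> x, ?W x)" for x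
    define J where "J u v = (if snd u \<noteq> [] \<and> tl (snd u) = take (m - 1) (snd v)
        then G (hd (snd u)) (take l (snd v)) * r (fst u) (snd u) else 0)" for u v :: "real set \<times> nat list"
    have sc: "simple_function \<mu> (cell \<xi>)" by (rule simple_function_cell[OF \<xi>])
    have sw: "simple_function \<mu> (trunc_itin lam N k)" for k
      by (rule simple_function_word[OF simple_function_trunc_branch])
    have Y: "simple_function \<mu> Y" unfolding Y_def by (rule simple_function_Pair[OF sc sw])
    obtain l' where l': "l = Suc l'" using l by (cases l) auto
    obtain m' where m': "m = Suc m'" using l m by (cases m) auto
    have G_pos: "G j (k # w) > 0" if "j \<in> {1..k + 1}" for j k w
      using G that by (simp add: backward_kernel_def)
    have G_zero: "G j (k # w) = 0" if "j \<notin> {1..k + 1}" for j k w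
      using G that unfolding backward_kernel_def by blast
    have G_sum: "(\<Sum>j=1..k + 1. G j (k # w)) \<le> 1" if "k \<ge> 1" for k w
      using G that unfolding backward_kernel_def by blast
    have G_nonneg: "G j (k # w) \<ge> 0" for j k w
      using G_pos[of j k w] G_zero[of j k w] by fastforce
    have GY: "G (trunc_branch lam N x) (?Wl (F lam x)) > 0" if "x \<in> space \<mu>" for x
      using trunc_branch_bounds[of x N] that N by (simp add: l' word_Suc space_mu G_pos)
    have JY: "J (Y x) (Y (F lam x)) = G (trunc_branch lam N x) (?Wl (F lam x)) * r (cell \<xi> x) (?W x)" for x
      using m by (simp add: J_def Y_def m' word_Suc[of _ _ m' x] take_word)
    have J_nonneg: "J u (Y x) \<ge> 0" for u x
      using m less_imp_le[OF r_pos] G_nonneg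
      by (auto simp: J_def Y_def take_word l' word_Suc intro!: mult_nonneg_nonneg)
    have J_sum: "(\<Sum>u\<in>Y ` space \<mu>. J u z) \<le> 1" if z: "z \<in> Y ` space \<mu>" for z
    proof -
      obtain y where y: "y \<in> space \<mu>" "z = Y y" using z by auto
      let ?k = "trunc_branch lam N y" and ?v = "?Wl y"
      let ?t = "take m' (?W y)"
      have k: "?k \<ge> 1" using trunc_branch_bounds(1)[of y N] y N by (simp add: space_mu)
      have v: "?v = ?k # trunc_itin lam N l' (F lam y)" by (simp add: l' word_Suc)
      have tk: "take l (?W y) = ?v" using m by (simp add: take_word)
      let ?h = "\<lambda>(a, j). (a, j # ?t)"
      have "(\<Sum>u\<in>Y ` space \<mu>. J u z) = (\<Sum>u\<in>{u \<in> Y ` space \<mu>. J u z \<noteq> 0}. J u z)"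
        using Y by (intro sum.mono_neutral_right) (auto simp: simple_function_def)
      also have "\<dots> \<le> (\<Sum>u\<in>?h ` (\<xi> \<times> {1..?k + 1}). J u z)"
      proof (rule sum_mono2)
        show "finite (?h ` (\<xi> \<times> {1..?k + 1}))" using fin by auto
        show "{u \<in> Y ` space \<mu>. J u z \<noteq> 0} \<subseteq> ?h ` (\<xi> \<times> {1..?k + 1})"
        proof
          fix u assume u: "u \<in> {u \<in> Y ` space \<mu>. J u z \<noteq> 0}"
          then have "snd u \<noteq> []" "tl (snd u) = ?t" "G (hd (snd u)) ?v \<noteq> 0"
            using tk by (auto simp: J_def y Y_def m' split: if_splits)
          moreover have "fst u \<in> \<xi>" using u cell_mem[OF p] by (auto simp: Y_def)
          moreover have "hd (snd u) \<in> {1..?k + 1}"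
            using \<open>G (hd (snd u)) ?v \<noteq> 0\<close> G_zero v by metis
          ultimately show "u \<in> ?h ` (\<xi> \<times> {1..?k + 1})"
            by (intro image_eqI[of _ _ "(fst u, hd (snd u))"]) (cases "snd u", auto simp: prod_eq_iff)
        qed
        show "J u z \<ge> 0" for u by (simp only: y(2) J_nonneg)
      qed
      also have "\<dots> = (\<Sum>(a, j)\<in>\<xi> \<times> {1..?k + 1}. J (a, j # ?t) z)"
        by (subst sum.reindex) (auto simp: inj_on_def case_prod_unfold)
      also have "\<dots> = (\<Sum>a\<in>\<xi>. \<Sum>j=1..?k + 1. J (a, j # ?t) z)" by (simp only: sum.cartesian_product)
      also have "\<dots> = (\<Sum>j=1..?k + 1. \<Sum>a\<in>\<xi>. J (a, j # ?t) z)" by (rule sum.swap)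
      also have "\<dots> = (\<Sum>j=1..?k + 1. G j ?v * (\<Sum>a\<in>\<xi>. r a (j # ?t)))"
        using tk by (simp add: J_def y Y_def m' sum_distrib_left)
      also have "\<dots> \<le> (\<Sum>j=1..?k + 1. G j ?v * 1)"
        using G_nonneg v by (intro sum_mono mult_left_mono r_sum) auto
      also have "\<dots> \<le> 1" using G_sum[OF k] v by simp
      finally show ?thesis .
    qed
    (* The kernel bound asks for nonnegativity at all pairs of letters, while only the letters that occur as
       second argument are under control. *)
    define J' where "J' u v = (if v \<in> Y ` space \<mu> then J u v else 0)" for u v
    have J': "J' u (Y (F lam x)) = J u (Y (F lam x))" if "x \<in> space \<mu>" for u x
      using T_space[OF that] by (simp add: J'_def)
    let ?I = "\<integral>x. - ln (J' (Y x) (Y (F lam x))) \<partial>\<mu>"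
    have "obs_entropy \<mu> (word (F lam) (cell \<xi>) (Suc n)) \<le> ln (card (Y ` space \<mu>)) + real n * ?I" for n
    proof (rule obs_entropy_word_le_kernel[OF Y sc, where c=fst])
      show "J' a b \<ge> 0" for a b
      proof (cases "b \<in> Y ` space \<mu>")
        case True
        then obtain x where "b = Y x" by blast
        then show ?thesis using True by (simp only: J'_def if_True J_nonneg)
      qed (simp add: J'_def)
      show "0 < J' (Y x) (Y (F lam x))" if "x \<in> space \<mu>" for x
        using GY[OF that] r_pos by (simp add: J'[OF that] JY)
      show "(\<Sum>a\<in>Y ` space \<mu>. J' a b) \<le> 1" if "b \<in> Y ` space \<mu>" for b
        using J_sum[OF that] that by (simp add: J'_def)
    qed (simp add: Y_def)
    then have "entropy_wrt \<mu> (F lam) \<xi> \<le> ?I" by (rule entropy_wrt_le[OF \<xi>])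
    also have "?I = (\<integral>x. - ln (G (trunc_branch lam N x) (?Wl (F lam x))) + - ln (r (cell \<xi> x) (?W x)) \<partial>\<mu>)"
    proof (intro Bochner_Integration.integral_cong refl)
      fix x assume "x \<in> space \<mu>"
      then show "- ln (J' (Y x) (Y (F lam x)))
          = - ln (G (trunc_branch lam N x) (?Wl (F lam x))) + - ln (r (cell \<xi> x) (?W x))"
        using GY[of x] r_pos[of "cell \<xi> x" "?W x"] by (simp add: J' JY ln_mult_pos)
    qed
    also have "\<dots> = (\<integral>x. - ln (G (trunc_branch lam N x) (?Wl (F lam x))) \<partial>\<mu>) + (\<integral>x. - ln (r (cell \<xi> x) (?W x)) \<partial>\<mu>)"
    proof (rule Bochner_Integration.integral_add)
      show "integrable \<mu> (\<lambda>x. - ln (G (trunc_branch lam N x) (?Wl (F lam x))))"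
        using integrable_simple_function_compose[OF simple_function_Pair[OF simple_function_trunc_branch simple_function_T[OF sw]],
          of "\<lambda>(j, v). - ln (G j v)"] by simp
      show "integrable \<mu> (\<lambda>x. - ln (r (cell \<xi> x) (?W x)))"
        using integrable_simple_function_compose[OF simple_function_Pair[OF sc sw], of "\<lambda>(a, w). - ln (r a w)"] by simp
    qed
    also have "(\<integral>x. - ln (r (cell \<xi> x) (?W x)) \<partial>\<mu>) \<le> e"
    proof -
      let ?bad = "{x \<in> space \<mu>. cell \<xi> x \<noteq> guess (?W x)}"
      have s: "simple_function \<mu> (\<lambda>x. cell \<xi> x \<noteq> guess (?W x))"
        by (rule simple_function_compose2[OF sc sw, of "\<lambda>a w. a \<noteq> guess w"])
      have bad_sets: "?bad \<in> sets \<mu>"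
      proof -
        have "?bad = (\<lambda>x. cell \<xi> x \<noteq> guess (?W x)) -` {True} \<inter> space \<mu>" by blast
        then show ?thesis using simple_functionD(2)[OF s, of "{True}"] by simp
      qed
      have le: "- ln (r (cell \<xi> x) (?W x)) \<le> e / 2 + D * indicator ?bad x" if "x \<in> space \<mu>" for x
      proof (cases "cell \<xi> x = guess (?W x)")
        case True
        then show ?thesis using e by (simp add: r_def \<kappa>_def)
      next
        case False
        then have "- ln (r (cell \<xi> x) (?W x)) = D" using \<kappa> K by (simp add: r_def D_def ln_div)
        then show ?thesis using False that e by simp
      qed
      have "(\<integral>x. - ln (r (cell \<xi> x) (?W x)) \<partial>\<mu>) \<le> (\<integral>x. e / 2 + D * indicator ?bad x \<partial>\<mu>)"
      proof (rule integral_mono[OF _ _ le])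
        show "integrable \<mu> (\<lambda>x. - ln (r (cell \<xi> x) (?W x)))"
          using integrable_simple_function_compose[OF simple_function_Pair[OF sc sw], of "\<lambda>(a, w). - ln (r a w)"] by simp
        show "integrable \<mu> (\<lambda>x. e / 2 + D * indicator ?bad x)"
          using bad_sets by (intro Bochner_Integration.integrable_add integrable_mult_right) (auto simp: less_top[symmetric])
      qed
      also have "\<dots> = e / 2 + D * prob ?bad"
        using bad_sets by (subst Bochner_Integration.integral_add)
          (auto simp: prob_space Int_absorb2 sets.sets_into_space less_top[symmetric])
      also have "D * prob ?bad \<le> D * \<delta>" using D bad by (intro mult_left_mono) auto
      finally show ?thesis using \<delta> by (simp add: mult.commute)
    qed
    finally show "entropy_wrt \<mu> (F lam) \<xi> \<le> C + e" using C[OF N(1)] by linarith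
  qed
  then show "ereal (entropy_wrt \<mu> (F lam) \<xi>) \<le> ereal C" by simp
qed

end


section \<open>The geometric backward kernel\<close>

text \<open>The transfer operator with weights \<open>slope s j\<close> has the eigenfunction \<open>(1 - s) powr (- n)\<close> on \<open>W lam n\<close> for the
  eigenvalue 1; normalising the weights by it gives this kernel.\<close>
definition geom_kernel :: "real \<Rightarrow> nat \<Rightarrow> nat \<Rightarrow> real" where
  "geom_kernel s j k = (if j \<in> {1..k + 1} then slope s j * (1 - s) ^ k / (1 - s) ^ j else 0)"

definition entropy_rate :: "real \<Rightarrow> real \<Rightarrow> real" where
  "entropy_rate s M = - ln (1 - s) - M * ln s"

context branch_map
begin

lemma geom_kernel_pos: "j \<in> {1..k + 1} \<Longrightarrow> geom_kernel lam j k > 0"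
  using slope_pos[of j] lam_less by (simp add: geom_kernel_def)

lemma geom_kernel_zero: "j \<notin> {1..k + 1} \<Longrightarrow> geom_kernel s j k = 0"
  unfolding geom_kernel_def by (rule if_not_P)

lemma geom_kernel_nonneg: "geom_kernel lam j k \<ge> 0"
  using geom_kernel_pos[of j k] by (cases "j \<in> {1..k + 1}") (auto simp: geom_kernel_def)

lemma geom_kernel_sum: "(\<Sum>j=1..k + 1. geom_kernel lam j k) = 1"
proof (induction k)
  case 0
  then show ?case using lam_less by (simp add: geom_kernel_def slope_def)
next
  case (Suc k)
  have "(\<Sum>j=1..k + 1. geom_kernel lam j (Suc k)) = (\<Sum>j=1..k + 1. (1 - lam) * geom_kernel lam j k)"
    by (intro sum.cong) (auto simp: geom_kernel_def)
  also have "\<dots> = 1 - lam" using Suc by (simp only: sum_distrib_left[symmetric] mult_1_right)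
  finally have "(\<Sum>j=1..k + 1. geom_kernel lam j (Suc k)) = 1 - lam" .
  moreover have "geom_kernel lam (k + 2) (Suc k) = lam" using lam_less by (simp add: geom_kernel_def slope_def)
  ultimately show ?case by simp
qed

lemma geom_kernel_less_1:
  assumes "k \<ge> 1" "j \<in> {1..k + 1}"
  shows "geom_kernel lam j k < 1"
proof -
  obtain i where i: "i \<in> {1..k + 1}" "i \<noteq> j"
    using assms by (cases "j = 1") (auto intro: that[of 2] that[of 1])
  have "geom_kernel lam j k < geom_kernel lam j k + geom_kernel lam i k" using geom_kernel_pos[OF i(1)] by simp
  also have "\<dots> = (\<Sum>m\<in>{j, i}. geom_kernel lam m k)" using i by simp
  also have "\<dots> \<le> (\<Sum>m=1..k + 1. geom_kernel lam m k)"
    using assms i geom_kernel_nonneg by (intro sum_mono2) auto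
  finally show ?thesis by (simp only: geom_kernel_sum)
qed

lemma ln_geom_kernel:
  assumes "j \<in> {1..k + 1}"
  shows "ln (geom_kernel lam j k) = ln (1 - lam) + (if j \<ge> 2 then ln lam else 0) + (real k - real j) * ln (1 - lam)"
proof -
  have "ln (geom_kernel lam j k) = ln (slope lam j) + (real k - real j) * ln (1 - lam)"
    using assms slope_pos[of j] lam_less
    by (simp add: geom_kernel_def ln_div ln_mult_pos ln_realpow algebra_simps)
  also have "ln (slope lam j) = ln (1 - lam) + (if j \<ge> 2 then ln lam else 0)"
    using assms lam_pos lam_less by (auto simp: slope_def ln_mult_pos)
  finally show ?thesis .
qed

end

text \<open>Tilting a two-point law \<open>(g, 1 - g)\<close> towards the frequencies \<open>(a, b)\<close> shortens the code,
  unless these are already proportional to it.\<close>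

lemma tilt_gain:
  fixes a b g :: real
  assumes g: "0 < g" "g < 1" and ab: "a \<ge> 0" "b \<ge> 0" and ne: "a \<noteq> g * (a + b)"
  obtains \<theta> \<theta>' where "\<theta> > 0" "\<theta>' > 0" "\<theta> * g + \<theta>' * (1 - g) = 1" "a * ln \<theta> + b * ln \<theta>' > 0"
proof -
  consider "a = 0" | "b = 0" "a > 0" | "a > 0" "b > 0" using ab by linarith
  then show ?thesis
  proof cases
    case 1
    then have "b > 0" using ne ab by (cases "b = 0") auto
    have "(1 - g / 2) / (1 - g) > 1" using g by (simp add: field_simps)
    then have "0 < ln ((1 - g / 2) / (1 - g))" by simp
    with \<open>b > 0\<close> g 1 show ?thesis
      by (intro that[of "1 / 2" "(1 - g / 2) / (1 - g)"]) (auto simp: field_simps)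
  next
    case 2
    have "(1 + 1 / g) / 2 > 1" using g by (simp add: field_simps)
    then have "0 < ln ((1 + 1 / g) / 2)" by simp
    with 2 g show ?thesis
      by (intro that[of "(1 + 1 / g) / 2" "1 / 2"]) (auto simp: field_simps)
  next
    case 3
    let ?t = "a / ((a + b) * g)" and ?t' = "b / ((a + b) * (1 - g))"
    have pos: "?t > 0" "?t' > 0" using 3 g by auto
    have lnge: "ln x \<ge> 1 - 1 / x" if "x > 0" for x :: real
      using ln_le_minus_one[of "1 / x"] that by (simp add: ln_div)
    have "?t \<noteq> 1" using ne 3 g by (simp add: field_simps)
    then have "1 / ?t \<noteq> 1" by (simp only: divide_eq_1_iff) auto
    then have "ln (1 / ?t) < 1 / ?t - 1"
      using ln_le_minus_one[of "1 / ?t"] ln_eq_minus_one[of "1 / ?t"] pos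
      by (simp del: divide_divide_eq_right) (metis divide_pos_pos less_eq_real_def zero_less_one)
    moreover have "ln (1 / ?t) = - ln ?t" using ln_inverse[of ?t] pos by (simp only: inverse_eq_divide)
    ultimately have "ln ?t > 1 - 1 / ?t" by linarith
    then have "a * ln ?t > a * (1 - 1 / ?t)" using 3 by simp
    moreover have "b * ln ?t' \<ge> b * (1 - 1 / ?t')" using 3 lnge[OF pos(2)] by (intro mult_left_mono) auto
    moreover have "a * (1 - 1 / ?t) = a - (a + b) * g" "b * (1 - 1 / ?t') = b - (a + b) * (1 - g)"
      using 3 by (simp_all add: field_simps)
    moreover have "(a - (a + b) * g) + (b - (a + b) * (1 - g)) = 0" by (simp add: algebra_simps)
    ultimately have "a * ln ?t + b * ln ?t' > 0" by linarith
    moreover have "?t * g = a / (a + b)" "?t' * (1 - g) = b / (a + b)" using g by simp_all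
    then have "?t * g + ?t' * (1 - g) = 1" using 3 by (simp add: add_divide_distrib[symmetric])
    ultimately show ?thesis using pos that by blast
  qed
qed

context invariant_measure
begin

text \<open>The logarithm of the kernel is \<open>ln (1 - s)\<close>, plus \<open>ln s\<close> off \<open>W lam 1\<close>, plus a coboundary, which integrates to
  zero for the bounded truncated symbols.\<close>
lemma integral_ln_geom_kernel:
  assumes s: "branch_map s" and N: "N \<ge> 2"
  shows "(\<integral>x. - ln (geom_kernel s (trunc_branch lam N x) (trunc_branch lam N (F lam x))) \<partial>\<mu>) = entropy_rate s (prob (tail 2))"
proof -
  interpret S: branch_map s by fact
  let ?d = "\<lambda>x. real (trunc_branch lam N x)"
  have d: "integrable \<mu> ?d" and dF: "integrable \<mu> (\<lambda>x. ?d (F lam x))"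
    using integrable_simple_function_compose[OF simple_function_trunc_branch, of real]
      integrable_simple_function_compose[OF simple_function_T[OF simple_function_trunc_branch], of real] by auto
  have i: "integrable \<mu> (indicator (tail 2) :: real \<Rightarrow> real)"
    using tail_sets_mu[of 2] by (simp add: less_top[symmetric])
  have "(\<integral>x. - ln (geom_kernel s (trunc_branch lam N x) (trunc_branch lam N (F lam x))) \<partial>\<mu>)
      = (\<integral>x. - ln (1 - s) - indicator (tail 2) x * ln s + (?d x - ?d (F lam x)) * ln (1 - s) \<partial>\<mu>)"
  proof (intro Bochner_Integration.integral_cong refl)
    fix x assume x: "x \<in> space \<mu>"
    then have b: "trunc_branch lam N x \<in> {1..trunc_branch lam N (F lam x) + 1}"
      using trunc_branch_bounds[of x N] N by (simp add: space_mu)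
    have "2 \<le> trunc_branch lam N x \<longleftrightarrow> x \<in> tail 2" using x N by (auto simp: trunc_branch_def tail_def space_mu)
    then show "- ln (geom_kernel s (trunc_branch lam N x) (trunc_branch lam N (F lam x)))
      = - ln (1 - s) - indicator (tail 2) x * ln s + (?d x - ?d (F lam x)) * ln (1 - s)"
      by (simp add: S.ln_geom_kernel[OF b] algebra_simps)
  qed
  also have "\<dots> = - ln (1 - s) - prob (tail 2) * ln s + ((\<integral>x. ?d x \<partial>\<mu>) - (\<integral>x. ?d (F lam x) \<partial>\<mu>)) * ln (1 - s)"
    using d dF i tail_sets_mu[of 2] by (simp add: prob_space)
  also have "(\<integral>x. ?d (F lam x) \<partial>\<mu>) = (\<integral>x. ?d x \<partial>\<mu>)"
    by (intro integral_T borel_measurable_integrable d)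
  finally show ?thesis by (simp add: entropy_rate_def)
qed

theorem ks_entropy_le_rate:
  assumes "branch_map s"
  shows "ks_entropy \<mu> (F lam) \<le> ereal (entropy_rate s (prob (tail 2)))"
proof (rule ks_entropy_le_kernel[where G="\<lambda>j w. geom_kernel s j (hd w)" and l=1 and b=2])
  interpret S: branch_map s by fact
  show "backward_kernel (\<lambda>j w. geom_kernel s j (hd w))"
    unfolding backward_kernel_def list.sel using S.geom_kernel_pos S.geom_kernel_sum geom_kernel_zero by (metis order_refl)
  show "(\<integral>x. - ln (geom_kernel s (trunc_branch lam N x) (hd (trunc_itin lam N 1 (F lam x)))) \<partial>\<mu>)
      \<le> entropy_rate s (prob (tail 2))" if "N \<ge> 2" for N
    using integral_ln_geom_kernel[OF assms that] by (simp add: word_Suc)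
qed simp

lemma cyl_sets_mu: "cyl lam w \<in> sets \<mu>"
  by (simp add: sets_mu cyl_sets)

lemma prob_cyl_Cons_le: "prob (cyl lam (j # v)) \<le> prob (cyl lam v)"
proof -
  have "prob (cyl lam (j # v)) \<le> prob (F lam -` cyl lam v \<inter> space \<mu>)"
    by (intro finite_measure_mono measurable_sets[OF T_measurable] cyl_sets_mu) (auto simp: cyl_Cons space_mu)
  then show ?thesis by (simp add: prob_vimage cyl_sets_mu)
qed

text \<open>If the law of the symbol before the word \<open>v\<close> differed from the geometric kernel at \<open>j\<close>, then tilting the kernel
  at \<open>j\<close> for this one word would improve the entropy bound by an amount that is independent of the truncation.\<close>

lemma prob_cyl_Cons_of_maximal:
  assumes s: "branch_map s" and max: "ks_entropy \<mu> (F lam) \<ge> ereal (entropy_rate s (prob (tail 2)))"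
    and v: "v \<noteq> []"
  shows "prob (cyl lam (j # v)) = geom_kernel s j (hd v) * prob (cyl lam v)"
proof (rule ccontr)
  interpret S: branch_map s by fact
  assume ne: "prob (cyl lam (j # v)) \<noteq> geom_kernel s j (hd v) * prob (cyl lam v)"
  let ?k = "hd v"
  define g where "g = geom_kernel s j ?k"
  define a where "a = prob (cyl lam (j # v))"
  define b where "b = prob (cyl lam v) - a"
  have v_eq: "v = ?k # tl v" using v by simp
  have "cyl lam v \<noteq> {}"
    using ne prob_cyl_Cons_le[of j v] by (auto simp: measure_le_0_iff)
  then obtain z where "z \<in> cyl lam (?k # tl v)" using v_eq by auto
  then have k: "?k \<ge> 1" using branch_ge1[of z] by (auto simp: cyl_Cons)
  have j: "j \<in> {1..?k + 1}"
  proof (rule ccontr)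
    assume nj: "j \<notin> {1..?k + 1}"
    have "x \<notin> cyl lam (j # v)" for x
    proof
      assume "x \<in> cyl lam (j # v)"
      then have x: "x \<in> unit_ivl" "branch lam x = j" "F lam x \<in> cyl lam (?k # tl v)"
        using v_eq by (auto simp: cyl_Cons simp del: greaterThanAtMost_iff)
      then show False using nj branch_ge1[OF x(1)] branch_F[OF x(1)] by (simp add: cyl_Cons)
    qed
    then have "cyl lam (j # v) = {}" by blast
    moreover have "geom_kernel s j ?k = 0" using nj by (rule geom_kernel_zero)
    ultimately show False using ne by simp
  qed
  have g: "0 < g" "g < 1" unfolding g_def using S.geom_kernel_pos[OF j] S.geom_kernel_less_1[OF k j] by auto
  obtain \<theta> \<theta>' where t: "\<theta> > 0" "\<theta>' > 0" "\<theta> * g + \<theta>' * (1 - g) = 1" "a * ln \<theta> + b * ln \<theta>' > 0"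
    using tilt_gain[OF g, of a b] ne prob_cyl_Cons_le[of j v] by (auto simp: a_def b_def g_def)
  define G where "G i w = geom_kernel s i (hd w) * (if w = v then if i = j then \<theta> else \<theta>' else 1)" for i w
  have "backward_kernel G"
    unfolding backward_kernel_def
  proof (intro conjI allI impI)
    show "G i (m # w) > 0" if "i \<in> {1..m + 1}" for i m w
      using S.geom_kernel_pos[OF that] t by (simp add: G_def)
    show "G i (m # w) = 0" if "i \<notin> {1..m + 1}" for i m w
      by (simp only: G_def list.sel geom_kernel_zero[OF that] mult_zero_left)
    show "(\<Sum>i=1..m + 1. G i (m # w)) \<le> 1" if "m \<ge> 1" for m w
    proof (cases "m # w = v")
      case True
      then have m: "m = ?k" by auto
      have "(\<Sum>i=1..m + 1. G i (m # w)) = \<theta> * g + (\<Sum>i\<in>{1..m + 1} - {j}. G i (m # w))"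
        using j True m by (subst sum.remove[of _ j]) (auto simp: G_def g_def)
      also have "(\<Sum>i\<in>{1..m + 1} - {j}. G i (m # w)) = \<theta>' * (\<Sum>i\<in>{1..m + 1} - {j}. geom_kernel s i m)"
        using True unfolding sum_distrib_left by (intro sum.cong) (auto simp: G_def)
      also have "(\<Sum>i\<in>{1..m + 1} - {j}. geom_kernel s i m) = 1 - g"
        using S.geom_kernel_sum[of m] j m by (subst (asm) sum.remove[of _ j]) (auto simp: g_def)
      finally show ?thesis using t(3) by simp
    next
      case False
      then show ?thesis using S.geom_kernel_sum[of m] by (simp add: G_def)
    qed
  qed
  (* Beyond N0 the truncation does not affect the symbols of v and j. *)
  moreover define N0 where "N0 = max 2 (Suc (Max (insert j (set v))))"
  have "(\<integral>x. - ln (G (trunc_branch lam N x) (trunc_itin lam N (length v) (F lam x))) \<partial>\<mu>)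
      \<le> entropy_rate s (prob (tail 2)) - (a * ln \<theta> + b * ln \<theta>')" if "N \<ge> N0" for N
  proof -
    have N: "N \<ge> 2" using that by (simp add: N0_def)
    have "Suc (Max (insert j (set v))) \<le> N"
      using \<open>N \<ge> N0\<close> unfolding N0_def by (rule order.trans[OF max.cobounded2])
    then have jv: "i < N" if "i \<in> insert j (set v)" for i
      using Max_ge[OF _ that] by (intro le_less_trans[OF Max_ge[OF _ that]]) (auto simp: Suc_le_eq simp del: Max_insert)
    let ?A = "cyl lam (j # v)" and ?B = "(F lam -` cyl lam v \<inter> space \<mu>) - cyl lam (j # v)"
    have FB: "F lam -` cyl lam v \<inter> space \<mu> \<in> sets \<mu>"
      by (intro measurable_sets[OF T_measurable] cyl_sets_mu)
    have B: "?B \<in> sets \<mu>" using FB cyl_sets_mu by blast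
    have "?A \<subseteq> F lam -` cyl lam v \<inter> space \<mu>" by (auto simp: cyl_Cons space_mu)
    then have pB: "prob ?B = b"
      using finite_measure_Diff[OF FB cyl_sets_mu] by (simp add: b_def a_def prob_vimage cyl_sets_mu)
    have "(\<integral>x. - ln (G (trunc_branch lam N x) (trunc_itin lam N (length v) (F lam x))) \<partial>\<mu>)
      = (\<integral>x. - ln (geom_kernel s (trunc_branch lam N x) (trunc_branch lam N (F lam x)))
          - (indicator ?A x * ln \<theta> + indicator ?B x * ln \<theta>') \<partial>\<mu>)"
    proof (intro Bochner_Integration.integral_cong refl)
      fix x assume x: "x \<in> space \<mu>"
      have Fx: "F lam x \<in> unit_ivl" using x F_unit by (simp add: space_mu)
      let ?w = "trunc_itin lam N (length v) (F lam x)"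
      have pos: "geom_kernel s (trunc_branch lam N x) (trunc_branch lam N (F lam x)) > 0"
        using trunc_branch_bounds[of x N] x N by (intro S.geom_kernel_pos) (simp add: space_mu)
      have hd: "hd ?w = trunc_branch lam N (F lam x)" using v by (cases v) (simp_all add: word_Suc)
      have w: "?w = v \<longleftrightarrow> F lam x \<in> cyl lam v"
        using trunc_itin_eq_iff[of v N "F lam x"] jv Fx by (simp add: cyl_def)
      have d: "trunc_branch lam N x = j \<longleftrightarrow> branch lam x = j"
        using jv[of j] by (auto simp: trunc_branch_def min_def)
      have A: "x \<in> ?A \<longleftrightarrow> branch lam x = j \<and> F lam x \<in> cyl lam v" using x by (auto simp: cyl_Cons space_mu)
      show "- ln (G (trunc_branch lam N x) ?w) = - ln (geom_kernel s (trunc_branch lam N x) (trunc_branch lam N (F lam x)))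
          - (indicator ?A x * ln \<theta> + indicator ?B x * ln \<theta>')"
        using x pos t by (auto simp: G_def hd w d A indicator_def ln_mult_pos)
    qed
    also have "\<dots> = (\<integral>x. - ln (geom_kernel s (trunc_branch lam N x) (trunc_branch lam N (F lam x))) \<partial>\<mu>)
        - (\<integral>x. indicator ?A x * ln \<theta> + indicator ?B x * ln \<theta>' \<partial>\<mu>)"
    proof (rule Bochner_Integration.integral_diff)
      show "integrable \<mu> (\<lambda>x. - ln (geom_kernel s (trunc_branch lam N x) (trunc_branch lam N (F lam x))))"
        using integrable_simple_function_compose[OF simple_function_Pair[OF simple_function_trunc_branch
            simple_function_T[OF simple_function_trunc_branch]], of "\<lambda>(j, k). - ln (geom_kernel s j k)"] by simp
      show "integrable \<mu> (\<lambda>x. indicator ?A x * ln \<theta> + indicator ?B x * ln \<theta>')"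
        using B cyl_sets_mu by (intro Bochner_Integration.integrable_add integrable_mult_left) (auto simp: less_top[symmetric])
    qed
    also have "(\<integral>x. indicator ?A x * ln \<theta> + indicator ?B x * ln \<theta>' \<partial>\<mu>) = a * ln \<theta> + b * ln \<theta>'"
      using B cyl_sets_mu[of "j # v"] pB
      by (subst Bochner_Integration.integral_add)
         (auto simp: less_top[symmetric] a_def Int_absorb2 sets.sets_into_space)
    finally show ?thesis using integral_ln_geom_kernel[OF s N] by simp
  qed
  ultimately have "ks_entropy \<mu> (F lam) \<le> ereal (entropy_rate s (prob (tail 2)) - (a * ln \<theta> + b * ln \<theta>'))"
    using v by (intro ks_entropy_le_kernel[where G=G and l="length v" and b=N0]) (auto simp: Suc_le_eq)
  with max have "ereal (entropy_rate s (prob (tail 2))) \<le> ereal (entropy_rate s (prob (tail 2)) - (a * ln \<theta> + b * ln \<theta>'))"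
    by (rule order.trans)
  then show False using t(4) by simp
qed

end


section \<open>Backward Markov measures\<close>

text \<open>Given the whole future, the present symbol is distributed according to the geometric kernel.\<close>
definition backward_markov :: "real \<Rightarrow> real \<Rightarrow> real measure \<Rightarrow> bool" where
  "backward_markov lam s \<mu> \<longleftrightarrow> prob_space \<mu> \<and> sets \<mu> = sets unit_borel \<and>
    (\<forall>j. \<forall>B\<in>sets unit_borel. emeasure \<mu> {x \<in> unit_ivl. branch lam x = j \<and> F lam x \<in> B}
      = (\<integral>\<^sup>+y. ennreal (geom_kernel s j (branch lam y)) * indicator B y \<partial>\<mu>))"

definition tilted_measure :: "real \<Rightarrow> real \<Rightarrow> real measure \<Rightarrow> real measure" where
  "tilted_measure lam s \<mu> = density \<mu> (\<lambda>x. ennreal ((1 - s) ^ branch lam x))"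

text \<open>The constant \<open>(1 - 2 * s) / (1 - s)\<close> normalises the geometric series with ratio \<open>s / (1 - s)\<close>.\<close>
definition equilibrium_measure :: "real \<Rightarrow> real \<Rightarrow> real measure" where
  "equilibrium_measure lam s = density (scaling_measure lam s)
     (\<lambda>x. ennreal ((1 - 2 * s) / (1 - s) / (1 - s) ^ branch lam x))"

context branch_map
begin

lemma cyl_single: "cyl lam [k] = {x \<in> unit_ivl. branch lam x = k}"
  using F_unit by (auto simp: cyl_Cons cyl_Nil simp del: greaterThanAtMost_iff)

lemma disjoint_cyl_single: "disjoint_family (\<lambda>k. cyl lam [k])"
  by (auto simp: disjoint_family_on_def cyl_single)

lemma UN_cyl_single: "(\<Union>k. cyl lam [k]) = unit_ivl"
  by (auto simp: cyl_single)

lemma branch_measurable_cong: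
  "sets \<mu> = sets unit_borel \<Longrightarrow> (\<lambda>x. f (branch lam x)) \<in> measurable \<mu> (borel :: 'a :: topological_space measure)"
  by (rule measurable_compose[where N="count_space UNIV"])
     (simp_all add: measurable_cong_sets[of \<mu> unit_borel] branch_measurable)

lemma measure_eqI_cyl_Cons:
  assumes s: "sets \<mu> = sets unit_borel" "sets \<nu> = sets unit_borel" and "finite_measure \<mu>"
    and eq: "\<And>j v. emeasure \<mu> (cyl lam (j # v)) = emeasure \<nu> (cyl lam (j # v))"
  shows "\<mu> = \<nu>"
proof (rule measure_eqI_cyl[OF s assms(3)])
  fix w
  show "emeasure \<mu> (cyl lam w) = emeasure \<nu> (cyl lam w)"
  proof (cases w)
    case Nil
    have "emeasure M (cyl lam w) = (\<Sum>k. emeasure M (cyl lam [k]))" if "sets M = sets unit_borel" for M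
      using suminf_emeasure[of "\<lambda>k. cyl lam [k]" M] disjoint_cyl_single UN_cyl_single that
      by (simp add: Nil cyl_Nil image_subset_iff cyl_sets)
    then show ?thesis using s eq by simp
  qed (simp add: eq)
qed

lemma nn_integral_branch:
  assumes s: "sets m = sets unit_borel"
  shows "(\<integral>\<^sup>+x. f (branch lam x) \<partial>m) = (\<Sum>k. f k * emeasure m (cyl lam [k]))"
proof -
  have sp: "space m = unit_ivl" using sets_eq_imp_space_eq[OF s] by simp
  have c: "cyl lam [k] \<in> sets m" for k by (simp add: s cyl_sets)
  have "(\<integral>\<^sup>+x. f (branch lam x) \<partial>m) = (\<integral>\<^sup>+x. (\<Sum>k. f k * indicator (cyl lam [k]) x) \<partial>m)"
  proof (rule nn_integral_cong)
    fix x assume "x \<in> space m"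
    then have "(\<Sum>k. f k * indicator (cyl lam [k]) x) = (\<Sum>k\<in>{branch lam x}. f k * indicator (cyl lam [k]) x)"
      by (intro suminf_finite) (auto simp: cyl_single sp indicator_def)
    also have "\<dots> = f (branch lam x)" using \<open>x \<in> space m\<close> by (simp add: cyl_single sp)
    finally show "f (branch lam x) = (\<Sum>k. f k * indicator (cyl lam [k]) x)" by (rule sym)
  qed
  also have "\<dots> = (\<Sum>k. \<integral>\<^sup>+x. f k * indicator (cyl lam [k]) x \<partial>m)"
    using c by (intro nn_integral_suminf) simp
  also have "\<dots> = (\<Sum>k. f k * emeasure m (cyl lam [k]))"
    using c by (simp add: nn_integral_cmult_indicator)
  finally show ?thesis .
qed

lemma emeasure_density_branch:
  assumes s: "sets m = sets unit_borel" and A: "A \<in> sets unit_borel" "\<And>x. x \<in> A \<Longrightarrow> branch lam x = k"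
  shows "emeasure (density m (\<lambda>x. f (branch lam x))) A = f k * emeasure m A"
proof -
  have "emeasure (density m (\<lambda>x. f (branch lam x))) A = (\<integral>\<^sup>+x. f (branch lam x) * indicator A x \<partial>m)"
    using A s by (intro emeasure_density branch_measurable_cong) auto
  also have "\<dots> = (\<integral>\<^sup>+x. f k * indicator A x \<partial>m)"
    using A(2) by (intro nn_integral_cong) (auto simp: indicator_def)
  finally show ?thesis using A s by (simp add: nn_integral_cmult_indicator)
qed

text \<open>The kernel is a probability law in \<open>j\<close>, so the preimages of a set along the branches have the mass of the set
  in total.\<close>
lemma backward_markov_invariant:
  assumes s: "branch_map s" and \<mu>: "backward_markov lam s \<mu>"
  shows "\<mu> \<in> invariant_measures lam"
proof -
  interpret S: branch_map s by fact
  have p: "prob_space \<mu>" and st: "sets \<mu> = sets unit_borel" using \<mu> by (auto simp: backward_markov_def)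
  have sp: "space \<mu> = unit_ivl" using sets_eq_imp_space_eq[OF st] by simp
  have "F lam -` A \<inter> space \<mu> \<in> sets \<mu> \<and> emeasure \<mu> (F lam -` A \<inter> space \<mu>) = emeasure \<mu> A"
    if A: "A \<in> sets \<mu>" for A
  proof -
    have A': "A \<in> sets unit_borel" using A by (simp add: st)
    let ?P = "\<lambda>j. {x \<in> unit_ivl. branch lam x = j \<and> F lam x \<in> A}"
    have un: "F lam -` A \<inter> space \<mu> = (\<Union>j. ?P j)" by (auto simp: sp)
    have P: "?P j \<in> sets \<mu>" for j using branch_F_vimage_sets[OF A'] by (simp add: st)
    have "emeasure \<mu> (F lam -` A \<inter> space \<mu>) = (\<Sum>j. emeasure \<mu> (?P j))"
      unfolding un using P by (intro suminf_emeasure[symmetric]) (auto simp: disjoint_family_on_def)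
    also have "\<dots> = (\<Sum>j. \<integral>\<^sup>+y. ennreal (geom_kernel s j (branch lam y)) * indicator A y \<partial>\<mu>)"
      using \<mu> A' by (simp add: backward_markov_def)
    also have "\<dots> = (\<integral>\<^sup>+y. (\<Sum>j. ennreal (geom_kernel s j (branch lam y)) * indicator A y) \<partial>\<mu>)"
      using A st by (intro nn_integral_suminf[symmetric] borel_measurable_times_ennreal branch_measurable_cong) auto
    also have "\<dots> = (\<integral>\<^sup>+y. indicator A y \<partial>\<mu>)"
    proof (rule nn_integral_cong)
      fix y
      let ?k = "branch lam y"
      have "(\<Sum>j. ennreal (geom_kernel s j ?k) * indicator A y) = (\<Sum>j=1..?k + 1. ennreal (geom_kernel s j ?k) * indicator A y)"
        by (intro suminf_finite) (auto simp: geom_kernel_zero simp del: atLeastAtMost_iff)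
      also have "\<dots> = ennreal (\<Sum>j=1..?k + 1. geom_kernel s j ?k) * indicator A y"
        by (simp only: sum_distrib_right[symmetric] sum_ennreal[OF S.geom_kernel_nonneg])
      finally show "(\<Sum>j. ennreal (geom_kernel s j ?k) * indicator A y) = indicator A y"
        by (simp only: S.geom_kernel_sum ennreal_1 mult_1)
    qed
    also have "\<dots> = emeasure \<mu> A" using A by simp
    finally have "emeasure \<mu> (F lam -` A \<inter> space \<mu>) = emeasure \<mu> A" .
    moreover have "F lam -` A \<inter> space \<mu> \<in> sets \<mu>" unfolding un using P by blast
    ultimately show ?thesis by blast
  qed
  with p st show ?thesis by (simp add: invariant_measures_def)
qed

text \<open>The eigenfunction in the kernel cancels against the density, leaving the constant factor \<open>slope s k\<close> on the
  branch \<open>k\<close>.\<close>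
lemma branch_scaling_tilted:
  assumes s: "branch_map s" and \<mu>: "backward_markov lam s \<mu>"
  shows "branch_scaling lam (slope s) (tilted_measure lam s \<mu>)"
  unfolding branch_scaling_def
proof (intro conjI allI impI ballI)
  interpret S: branch_map s by fact
  interpret prob_space \<mu> using \<mu> by (simp add: backward_markov_def)
  have st: "sets \<mu> = sets unit_borel" using \<mu> by (auto simp: backward_markov_def)
  have sp: "space \<mu> = unit_ivl" using sets_eq_imp_space_eq[OF st] by simp
  let ?\<nu> = "tilted_measure lam s \<mu>"
  have meas: "(\<lambda>x. ennreal ((1 - s) ^ branch lam x)) \<in> borel_measurable \<mu>"
    by (rule branch_measurable_cong[OF st, of "\<lambda>k. ennreal ((1 - s) ^ k)"])
  have em: "emeasure ?\<nu> A = (\<integral>\<^sup>+x. ennreal ((1 - s) ^ branch lam x) * indicator A x \<partial>\<mu>)"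
    if "A \<in> sets unit_borel" for A
    unfolding tilted_measure_def using that st by (intro emeasure_density meas) simp
  have "emeasure ?\<nu> unit_ivl = (\<integral>\<^sup>+x. ennreal ((1 - s) ^ branch lam x) * indicator unit_ivl x \<partial>\<mu>)"
    using sets.top[of unit_borel] by (intro em) simp
  also have "\<dots> \<le> (\<integral>\<^sup>+x. 1 \<partial>\<mu>)"
  proof (rule nn_integral_mono)
    fix x
    have "(1 - s) ^ branch lam x \<le> 1" using S.lam_pos S.lam_less by (intro power_le_one) auto
    then show "ennreal ((1 - s) ^ branch lam x) * indicator unit_ivl x \<le> 1"
      by (cases "x \<in> unit_ivl") (simp_all del: greaterThanAtMost_iff)
  qed
  also have "\<dots> = 1" by (simp add: emeasure_space_1)
  finally have "emeasure ?\<nu> unit_ivl \<le> 1" .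
  then have "emeasure ?\<nu> unit_ivl < \<infinity>" by (rule le_less_trans) simp
  then show "finite_measure ?\<nu>"
    by (intro finite_measureI) (simp add: tilted_measure_def sp)
  show "sets ?\<nu> = sets unit_borel" by (simp add: tilted_measure_def st)
  fix k :: nat and B assume k: "k \<ge> 1" and B: "B \<in> sets unit_borel" and le: "\<forall>y\<in>B. k \<le> branch lam y + 1"
  let ?A = "{x \<in> unit_ivl. branch lam x = k \<and> F lam x \<in> B}"
  have "emeasure ?\<nu> ?A = ennreal ((1 - s) ^ k) * emeasure \<mu> ?A"
    unfolding tilted_measure_def
    by (rule emeasure_density_branch[OF st branch_F_vimage_sets[OF B], where f="\<lambda>k. ennreal ((1 - s) ^ k)"]) auto
  also have "emeasure \<mu> ?A = (\<integral>\<^sup>+y. ennreal (geom_kernel s k (branch lam y)) * indicator B y \<partial>\<mu>)"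
    using \<mu> B by (simp add: backward_markov_def)
  also have "ennreal ((1 - s) ^ k) * \<dots>
      = (\<integral>\<^sup>+y. ennreal ((1 - s) ^ k) * (ennreal (geom_kernel s k (branch lam y)) * indicator B y) \<partial>\<mu>)"
    using B st by (intro nn_integral_cmult[symmetric] borel_measurable_times_ennreal branch_measurable_cong) auto
  also have "\<dots> = (\<integral>\<^sup>+y. ennreal (slope s k) * (ennreal ((1 - s) ^ branch lam y) * indicator B y) \<partial>\<mu>)"
  proof (rule nn_integral_cong)
    fix y
    show "ennreal ((1 - s) ^ k) * (ennreal (geom_kernel s k (branch lam y)) * indicator B y)
      = ennreal (slope s k) * (ennreal ((1 - s) ^ branch lam y) * indicator B y)"
    proof (cases "y \<in> B")
      case True
      then have "k \<in> {1..branch lam y + 1}" using le k by auto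
      then have "(1 - s) ^ k * geom_kernel s k (branch lam y) = slope s k * (1 - s) ^ branch lam y"
        using S.lam_less by (simp add: geom_kernel_def)
      then show ?thesis
        using True S.lam_less S.slope_pos[of k] S.geom_kernel_nonneg[of k] by (simp add: ennreal_mult[symmetric] less_imp_le)
    qed simp
  qed
  also have "\<dots> = ennreal (slope s k) * emeasure ?\<nu> B"
    using B st by (subst em) (auto intro!: nn_integral_cmult borel_measurable_times_ennreal meas)
  finally show "measure ?\<nu> ?A = slope s k * measure ?\<nu> B"
    using S.slope_pos[of k] by (simp add: measure_def enn2real_mult)
qed

lemma measure_tilted_cyl:
  assumes s: "branch_map s" and st: "sets \<mu> = sets unit_borel"
  shows "measure (tilted_measure lam s \<mu>) (cyl lam (k # v)) = (1 - s) ^ k * measure \<mu> (cyl lam (k # v))"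
proof -
  have "emeasure (tilted_measure lam s \<mu>) (cyl lam (k # v)) = ennreal ((1 - s) ^ k) * emeasure \<mu> (cyl lam (k # v))"
    unfolding tilted_measure_def
    by (rule emeasure_density_branch[OF st cyl_sets, where f="\<lambda>k. ennreal ((1 - s) ^ k)"]) (auto simp: cyl_Cons)
  then show ?thesis
    using branch_map.lam_less[OF s] by (simp add: measure_def enn2real_mult)
qed

lemma measure_cyl_sums:
  assumes "finite_measure \<mu>" "sets \<mu> = sets unit_borel"
  shows "(\<lambda>k. measure \<mu> (cyl lam [k])) sums measure \<mu> unit_ivl"
  using finite_measure.finite_measure_UNION[OF assms(1), of "\<lambda>k. cyl lam [k]"]
  by (simp add: disjoint_cyl_single UN_cyl_single assms(2) cyl_sets image_subset_iff)

lemma measure_tilted_pos: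
  assumes s: "branch_map s" and \<mu>: "backward_markov lam s \<mu>"
  shows "measure (tilted_measure lam s \<mu>) unit_ivl > 0"
proof (rule ccontr)
  interpret S: branch_map s by fact
  let ?\<nu> = "tilted_measure lam s \<mu>"
  note sc = branch_scaling_tilted[OF s \<mu>]
  interpret \<nu>: finite_measure ?\<nu> using sc by (rule branch_scaling_finite)
  interpret prob_space \<mu> using \<mu> by (simp add: backward_markov_def)
  have st: "sets \<mu> = sets unit_borel" using \<mu> by (auto simp: backward_markov_def)
  have sp: "space \<mu> = unit_ivl" using sets_eq_imp_space_eq[OF st] by simp
  assume "\<not> measure ?\<nu> unit_ivl > 0"
  then have "measure ?\<nu> (cyl lam [k]) = 0" for k
    using \<nu>.bounded_measure[of "cyl lam [k]"] by (simp add: branch_scaling_space[OF sc] measure_le_0_iff not_less)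
  then have "prob (cyl lam [k]) = 0" for k
    using S.lam_less by (simp add: measure_tilted_cyl[OF s st])
  then have "(\<lambda>_. 0) sums prob unit_ivl" using measure_cyl_sums[OF _ st] by (simp add: finite_measure_axioms)
  then have "prob unit_ivl = 0" by (rule sums_unique2[OF _ sums_zero])
  then show False using prob_space by (simp add: sp)
qed

text \<open>Tilting leads to scaling measures, which are proportional; the masses of the unit interval fix the constant.\<close>
lemma backward_markov_unique:
  assumes s: "branch_map s" and \<mu>: "backward_markov lam s \<mu>" and \<mu>': "backward_markov lam s \<mu>'"
  shows "\<mu> = \<mu>'"
proof -
  interpret S: branch_map s by fact
  let ?\<nu> = "tilted_measure lam s \<mu>" and ?\<nu>' = "tilted_measure lam s \<mu>'"
  have p: "prob_space \<mu>" "prob_space \<mu>'" and st: "sets \<mu> = sets unit_borel" "sets \<mu>' = sets unit_borel"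
    using \<mu> \<mu>' by (auto simp: backward_markov_def)
  interpret m: prob_space \<mu> by fact
  interpret m': prob_space \<mu>' by fact
  note sc = branch_scaling_tilted[OF s \<mu>] and sc' = branch_scaling_tilted[OF s \<mu>']
  let ?c = "measure ?\<nu> unit_ivl" and ?c' = "measure ?\<nu>' unit_ivl"
  have cyl: "measure \<mu> (cyl lam (k # v)) * ?c' = measure \<mu>' (cyl lam (k # v)) * ?c" for k v
    using branch_scaling_cyl[OF sc sc', of "k # v"] S.lam_less
    by (simp add: measure_tilted_cyl[OF s st(1)] measure_tilted_cyl[OF s st(2)])
  have one: "measure \<mu> unit_ivl = 1" "measure \<mu>' unit_ivl = 1"
    using m.prob_space m'.prob_space sets_eq_imp_space_eq[OF st(1)] sets_eq_imp_space_eq[OF st(2)] by simp_all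
  have "(\<lambda>k. measure \<mu> (cyl lam [k]) * ?c') sums (1 * ?c')"
    using sums_mult2[OF measure_cyl_sums[OF m.finite_measure_axioms st(1)]] by (simp only: one)
  moreover have "(\<lambda>k. measure \<mu> (cyl lam [k]) * ?c') sums (1 * ?c)"
    using sums_mult2[OF measure_cyl_sums[OF m'.finite_measure_axioms st(2)]] by (simp only: one cyl)
  ultimately have "1 * ?c' = 1 * ?c" by (rule sums_unique2)
  then have c: "?c' = ?c" by simp
  have "?c > 0" by (rule measure_tilted_pos[OF s \<mu>])
  then have "measure \<mu> (cyl lam (k # v)) = measure \<mu>' (cyl lam (k # v))" for k v
    using cyl[of k v] c by simp
  then show ?thesis
    by (intro measure_eqI_cyl_Cons st m.finite_measure_axioms)
       (simp add: m.emeasure_eq_measure m'.emeasure_eq_measure)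
qed

lemma measure_scaling_cyl_single:
  assumes m: "branch_scaling lam (slope s) m"
  shows "measure m (cyl lam [Suc k]) = (1 - s) * s ^ k * measure m unit_ivl"
proof -
  interpret finite_measure m using m by (rule branch_scaling_finite)
  have "cyl lam [Suc k] = tail (Suc k) - tail (Suc (Suc k))" by (auto simp: cyl_single tail_def)
  moreover have "tail (Suc (Suc k)) \<subseteq> tail (Suc k)" by (auto simp: tail_def)
  ultimately show ?thesis
    using finite_measure_Diff[of "tail (Suc k)" "tail (Suc (Suc k))"] tail_sets
    by (simp add: branch_scaling_sets[OF m] measure_tail[OF m] measure_tail[OF m, of "Suc k", simplified] algebra_simps)
qed

text \<open>The mass of \<open>W lam n\<close> would be a constant multiple of \<open>(s / (1 - s)) ^ n\<close>, so at \<open>s = 1 / 2\<close> infinitely many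
  disjoint sets would have the same positive mass.\<close>

lemma not_backward_markov_half: "\<not> backward_markov lam (1 / 2) \<mu>"
proof
  assume \<mu>: "backward_markov lam (1 / 2) \<mu>"
  have s: "branch_map (1 / 2)" by unfold_locales auto
  let ?\<nu> = "tilted_measure lam (1 / 2) \<mu>"
  let ?c = "measure ?\<nu> unit_ivl"
  interpret prob_space \<mu> using \<mu> by (simp add: backward_markov_def)
  have st: "sets \<mu> = sets unit_borel" using \<mu> by (auto simp: backward_markov_def)
  have "(1 / 2) ^ Suc k * prob (cyl lam [Suc k]) = (1 / 2) ^ Suc k * ?c" for k
    using measure_tilted_cyl[OF s st, of "Suc k" "[]"] measure_scaling_cyl_single[OF branch_scaling_tilted[OF s \<mu>], of k]
    by simp
  then have c: "prob (cyl lam [Suc k]) = ?c" for k by simp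
  have "summable (\<lambda>k. prob (cyl lam [k]))"
    using measure_cyl_sums[OF finite_measure_axioms st] by (rule sums_summable)
  then have "(\<lambda>k. prob (cyl lam [Suc k])) \<longlonglongrightarrow> 0"
    by (intro LIMSEQ_Suc summable_LIMSEQ_zero)
  then have "?c = 0" by (simp add: c LIMSEQ_const_iff)
  then show False using measure_tilted_pos[OF s \<mu>] by simp
qed

end

context invariant_measure
begin

text \<open>The identity on cylinders of \<open>prob_cyl_Cons_of_maximal\<close> says that two finite measures agree on cylinders, hence
  everywhere.\<close>
lemma backward_markov_of_maximal:
  assumes s: "branch_map s" and max: "ks_entropy \<mu> (F lam) \<ge> ereal (entropy_rate s (prob (tail 2)))"
  shows "backward_markov lam s \<mu>"
  unfolding backward_markov_def
proof (intro conjI allI ballI)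
  interpret S: branch_map s by fact
  show "prob_space \<mu>" by unfold_locales
  show "sets \<mu> = sets unit_borel" by (rule sets_mu)
  fix j B assume B: "B \<in> sets unit_borel"
  let ?C = "{x \<in> unit_ivl. branch lam x = j}"
  have C: "?C \<in> sets \<mu>" using cyl_sets_mu[of "[j]"] by (simp add: cyl_single)
  let ?R = "density \<mu> (indicator ?C)"
  have FR: "F lam \<in> measurable ?R unit_borel"
    using F_measurable by (simp add: measurable_cong_sets[OF sets_mu refl])
  let ?N1 = "distr ?R unit_borel (F lam)"
  let ?N2 = "density \<mu> (\<lambda>y. ennreal (geom_kernel s j (branch lam y)))"
  have N1: "emeasure ?N1 A = emeasure \<mu> {x \<in> unit_ivl. branch lam x = j \<and> F lam x \<in> A}"
    if A: "A \<in> sets unit_borel" for A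
  proof -
    have FA: "F lam -` A \<inter> space \<mu> \<in> sets \<mu>" using A by (intro measurable_sets[OF T_measurable]) (simp add: sets_mu)
    have "emeasure ?N1 A = emeasure \<mu> (?C \<inter> (F lam -` A \<inter> space \<mu>))"
      using A C FA by (subst emeasure_distr[OF FR]) (auto simp: emeasure_restricted)
    also have "?C \<inter> (F lam -` A \<inter> space \<mu>) = {x \<in> unit_ivl. branch lam x = j \<and> F lam x \<in> A}"
      by (auto simp: space_mu)
    finally show ?thesis .
  qed
  have N2: "emeasure ?N2 A = (\<integral>\<^sup>+y. ennreal (geom_kernel s j (branch lam y)) * indicator A y \<partial>\<mu>)"
    if A: "A \<in> sets unit_borel" for A
    using A by (intro emeasure_density branch_measurable_cong sets_mu) (simp add: sets_mu)
  have "?N1 = ?N2"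
  proof (rule measure_eqI_cyl_Cons)
    show "finite_measure ?N1"
      using N1[of unit_ivl] sets.top[of unit_borel]
      by (intro finite_measureI) (simp add: emeasure_eq_measure)
    fix k v
    have "emeasure ?N1 (cyl lam (k # v)) = emeasure \<mu> (cyl lam (j # k # v))"
      by (subst N1[OF cyl_sets]) (simp add: cyl_Cons[of j])
    also have "\<dots> = ennreal (geom_kernel s j k) * emeasure \<mu> (cyl lam (k # v))"
      using prob_cyl_Cons_of_maximal[OF s max, of "k # v" j] S.geom_kernel_nonneg[of j k]
      by (simp add: emeasure_eq_measure ennreal_mult)
    also have "\<dots> = emeasure ?N2 (cyl lam (k # v))"
      by (rule emeasure_density_branch[OF sets_mu cyl_sets, symmetric, where f="\<lambda>k. ennreal (geom_kernel s j k)"])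
         (auto simp: cyl_Cons)
    finally show "emeasure ?N1 (cyl lam (k # v)) = emeasure ?N2 (cyl lam (k # v))" .
  qed (simp_all add: sets_mu)
  then show "emeasure \<mu> {x \<in> unit_ivl. branch lam x = j \<and> F lam x \<in> B}
      = (\<integral>\<^sup>+y. ennreal (geom_kernel s j (branch lam y)) * indicator B y \<partial>\<mu>)"
    using N1[OF B] N2[OF B] by simp
qed

end

context branch_map_pair
begin

lemma sets_scaling_measure: "sets (scaling_measure lam s) = sets unit_borel"
  by (rule branch_scaling_sets[OF branch_scaling_scaling_measure])

lemma measure_scaling_measure_cyl: "measure (scaling_measure lam s) (cyl lam [Suc k]) = (1 - s) * s ^ k"
proof -
  interpret prob_space "scaling_measure lam s" by (rule prob_space_scaling_measure)
  have "prob unit_ivl = 1"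
    using prob_space by (simp add: branch_scaling_space[OF branch_scaling_scaling_measure])
  then show ?thesis using measure_scaling_cyl_single[OF branch_scaling_scaling_measure, of k] by simp
qed

text \<open>The series starts with \<open>f 1\<close> because no point has branch 0.\<close>
lemma nn_integral_scaling_measure:
  assumes "\<And>k. f k \<ge> 0" and "(\<lambda>k. f (Suc k) * ((1 - s) * s ^ k)) sums S"
  shows "(\<integral>\<^sup>+x. ennreal (f (branch lam x)) \<partial>scaling_measure lam s) = ennreal S"
proof -
  interpret prob_space "scaling_measure lam s" by (rule prob_space_scaling_measure)
  have z: "cyl lam [0] = {}" using branch_ge1 by (fastforce simp: cyl_single simp del: greaterThanAtMost_iff)
  have "(\<integral>\<^sup>+x. ennreal (f (branch lam x)) \<partial>scaling_measure lam s)
      = (\<Sum>k. ennreal (f k) * emeasure (scaling_measure lam s) (cyl lam [k]))"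
    by (rule nn_integral_branch[OF sets_scaling_measure])
  also have "\<dots> = (\<Sum>k. ennreal (f (Suc k)) * emeasure (scaling_measure lam s) (cyl lam [Suc k]))"
    by (subst suminf_offset[where i=1]) (auto simp: z)
  also have "\<dots> = (\<Sum>k. ennreal (f (Suc k) * ((1 - s) * s ^ k)))"
    using assms(1) S.lam_pos S.lam_less
    by (simp add: emeasure_eq_measure measure_scaling_measure_cyl ennreal_mult)
  also have "\<dots> = ennreal S"
    using assms S.lam_pos S.lam_less by (intro suminf_ennreal_eq) auto
  finally show ?thesis .
qed

context
  assumes half: "s < 1 / 2"
begin

lemma equilibrium_weight_sums: "(\<lambda>k. (1 - 2 * s) / (1 - s) / (1 - s) ^ Suc k * ((1 - s) * s ^ k)) sums 1"
proof -
  have r: "norm (s / (1 - s)) < 1" using half S.lam_pos by (simp add: field_simps)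
  have "(\<lambda>k. (1 - 2 * s) / (1 - s) * (s / (1 - s)) ^ k) sums ((1 - 2 * s) / (1 - s) * (1 / (1 - s / (1 - s))))"
    by (intro sums_mult geometric_sums r)
  moreover have "(1 - 2 * s) / (1 - s) * (1 / (1 - s / (1 - s))) = 1"
  proof -
    have "1 - s / (1 - s) = (1 - 2 * s) / (1 - s)" using S.lam_less by (simp add: field_simps)
    then show ?thesis using half S.lam_less by simp
  qed
  moreover have "(1 - 2 * s) / (1 - s) / (1 - s) ^ Suc k * ((1 - s) * s ^ k) = (1 - 2 * s) / (1 - s) * (s / (1 - s)) ^ k" for k
  proof -
    have "x / u / u ^ Suc k * (u * s ^ k) = x / u * (s / u) ^ k" if "u \<noteq> 0" for x u :: real
      using that by (simp add: power_divide)
    then show ?thesis using S.lam_less by simp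
  qed
  ultimately show ?thesis by (simp only:)
qed

lemma backward_markov_equilibrium_measure: "backward_markov lam s (equilibrium_measure lam s)"
  unfolding backward_markov_def
proof (intro conjI allI ballI)
  let ?m = "scaling_measure lam s" and ?\<mu> = "equilibrium_measure lam s"
  define h where "h k = (1 - 2 * s) / (1 - s) / (1 - s) ^ k" for k :: nat
  have h: "h k > 0" for k using half S.lam_less by (simp add: h_def)
  have mu: "?\<mu> = density ?m (\<lambda>x. ennreal (h (branch lam x)))" by (simp add: equilibrium_measure_def h_def)
  have meas: "(\<lambda>x. ennreal (h (branch lam x))) \<in> borel_measurable ?m"
    by (rule branch_measurable_cong[OF sets_scaling_measure, of "\<lambda>k. ennreal (h k)"])
  interpret m: prob_space ?m by (rule prob_space_scaling_measure)
  have sp: "space ?m = unit_ivl" by (rule branch_scaling_space[OF branch_scaling_scaling_measure])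
  have "emeasure ?\<mu> (space ?m) = (\<integral>\<^sup>+x. ennreal (h (branch lam x)) \<partial>?m)"
    unfolding mu by (subst emeasure_density[OF meas]) (auto intro!: nn_integral_cong)
  also have "\<dots> = 1"
    using nn_integral_scaling_measure[of h 1] h equilibrium_weight_sums by (simp add: h_def less_imp_le)
  finally show "prob_space ?\<mu>" by (intro prob_spaceI) (simp add: mu)
  show "sets ?\<mu> = sets unit_borel" by (simp add: mu sets_scaling_measure)
  fix j B assume B: "B \<in> sets unit_borel"
  let ?A = "{x \<in> unit_ivl. branch lam x = j \<and> F lam x \<in> B}"
  let ?B = "B \<inter> tail (j - 1)"
  have B': "?B \<in> sets unit_borel" using B tail_sets by blast
  show "emeasure ?\<mu> ?A = (\<integral>\<^sup>+y. ennreal (geom_kernel s j (branch lam y)) * indicator B y \<partial>?\<mu>)"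
  proof (cases "j = 0")
    case True
    have "x \<notin> ?A" for x using True branch_ge1[of x] by auto
    then have "?A = {}" by blast
    then have "emeasure ?\<mu> ?A = 0" by (simp only: emeasure_empty)
    moreover have "geom_kernel s j k = 0" for k using True by (simp add: geom_kernel_def)
    ultimately show ?thesis by (simp only: ennreal_0 mult_zero_left nn_integral_0_iff_AE nn_integral_const)
  next
    case False
    have A: "?A = {x \<in> unit_ivl. branch lam x = j \<and> F lam x \<in> ?B}"
    proof (intro set_eqI)
      fix x show "x \<in> ?A \<longleftrightarrow> x \<in> {x \<in> unit_ivl. branch lam x = j \<and> F lam x \<in> ?B}"
        using F_unit[of x] branch_F[of x] by (auto simp: tail_def simp del: greaterThanAtMost_iff)
    qed
    have "emeasure ?\<mu> ?A = ennreal (h j) * emeasure ?m ?A"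
      unfolding mu by (rule emeasure_density_branch[OF sets_scaling_measure branch_F_vimage_sets[OF B], where f="\<lambda>k. ennreal (h k)"]) auto
    also have "emeasure ?m ?A = ennreal (slope s j) * emeasure ?m ?B"
    proof -
      have "measure ?m ?A = slope s j * measure ?m ?B"
        unfolding A using False B' by (intro branch_scaling_eq[OF branch_scaling_scaling_measure]) (auto simp: tail_def)
      then show ?thesis using S.slope_pos[of j] by (simp add: m.emeasure_eq_measure ennreal_mult)
    qed
    also have "ennreal (h j) * (ennreal (slope s j) * emeasure ?m ?B)
        = (\<integral>\<^sup>+y. ennreal (h j * slope s j) * indicator ?B y \<partial>?m)"
      using B' h[of j] S.slope_pos[of j]
      by (subst nn_integral_cmult_indicator) (simp_all add: sets_scaling_measure ennreal_mult less_imp_le mult.assoc)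
    also have "\<dots> = (\<integral>\<^sup>+y. ennreal (h (branch lam y)) * (ennreal (geom_kernel s j (branch lam y)) * indicator B y) \<partial>?m)"
    proof (rule nn_integral_cong)
      fix y assume y: "y \<in> space ?m"
      let ?k = "branch lam y"
      have in_B: "y \<in> ?B \<longleftrightarrow> y \<in> B \<and> j \<in> {1..?k + 1}" using y False by (auto simp: tail_def sp)
      have "h j * slope s j = h ?k * geom_kernel s j ?k" if "j \<in> {1..?k + 1}"
        using that S.lam_less by (simp add: h_def geom_kernel_def field_simps)
      then show "ennreal (h j * slope s j) * indicator ?B y
          = ennreal (h ?k) * (ennreal (geom_kernel s j ?k) * indicator B y)"
        using in_B h[of ?k] S.geom_kernel_nonneg[of j ?k] geom_kernel_zero[of j ?k s]
        by (cases "y \<in> B"; cases "j \<in> {1..?k + 1}")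
           (simp_all add: ennreal_mult less_imp_le del: atLeastAtMost_iff)
    qed
    also have "\<dots> = (\<integral>\<^sup>+y. ennreal (geom_kernel s j (branch lam y)) * indicator B y \<partial>?\<mu>)"
      unfolding mu using B
      by (intro nn_integral_density[symmetric] meas borel_measurable_times_ennreal
            branch_measurable_cong[OF sets_scaling_measure] borel_measurable_indicator)
         (simp add: sets_scaling_measure)
    finally show ?thesis .
  qed
qed

end

end


section \<open>Lower bound for the entropy of a backward Markov measure\<close>

context invariant_measure
begin

lemma prob_vimage_backward_markov:
  assumes s: "branch_map s" and bm: "backward_markov lam s \<mu>"
    and A: "A \<in> sets \<mu>" "\<And>y. y \<in> A \<Longrightarrow> branch lam y = k"
  shows "prob {x \<in> unit_ivl. branch lam x = j \<and> F lam x \<in> A} = geom_kernel s j k * prob A"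
proof -
  interpret S: branch_map s by fact
  have "emeasure \<mu> {x \<in> unit_ivl. branch lam x = j \<and> F lam x \<in> A}
      = (\<integral>\<^sup>+y. ennreal (geom_kernel s j (branch lam y)) * indicator A y \<partial>\<mu>)"
    using bm A(1) by (simp add: backward_markov_def)
  also have "\<dots> = (\<integral>\<^sup>+y. ennreal (geom_kernel s j k) * indicator A y \<partial>\<mu>)"
    using A(2) by (intro nn_integral_cong) (auto simp: indicator_def)
  also have "\<dots> = ennreal (geom_kernel s j k) * emeasure \<mu> A" using A(1) by (simp add: nn_integral_cmult_indicator)
  finally show ?thesis using S.geom_kernel_nonneg[of j k] by (simp add: measure_def enn2real_mult)
qed

text \<open>The information that the symbol of \<open>x\<close> adds to the itinerary of \<open>F lam x\<close>, counted only if the truncated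
  symbols show it exactly. If the next symbol is at most \<open>N - 2\<close>, then the present one is at most \<open>N - 1\<close>, and
  neither is affected by the truncation.\<close>

definition trunc_info :: "real \<Rightarrow> nat \<Rightarrow> real \<Rightarrow> real" where
  "trunc_info s N x =
    (if trunc_branch lam N (F lam x) + 2 \<le> N then - ln (geom_kernel s (trunc_branch lam N x) (trunc_branch lam N (F lam x))) else 0)"

lemma integrable_trunc_info: "integrable \<mu> (trunc_info s N)"
  using integrable_simple_function_compose[OF simple_function_Pair[OF simple_function_trunc_branch
      simple_function_T[OF simple_function_trunc_branch]], of "\<lambda>(j, k). if k + 2 \<le> N then - ln (geom_kernel s j k) else 0"]
  by (simp add: trunc_info_def[abs_def])

text \<open>Entropy is the mean of the information function \<open>- ln (prob (level_set \<dots>))\<close>. By the Markov property this function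
  for the longer word exceeds the one for the word shifted by one step by at least \<open>trunc_info\<close>; where the latter
  vanishes, refining a cell still cannot increase its mass.\<close>
lemma obs_entropy_word_Suc_ge:
  assumes s: "branch_map s" and bm: "backward_markov lam s \<mu>"
  shows "obs_entropy \<mu> (trunc_itin lam N (Suc (Suc n)))
    \<ge> (\<integral>x. trunc_info s N x \<partial>\<mu>) + obs_entropy \<mu> (trunc_itin lam N (Suc n))"
proof -
  interpret S: branch_map s by fact
  let ?f = "trunc_branch lam N"
  let ?W0 = "word (F lam) ?f (Suc n)" and ?W1 = "word (F lam) ?f (Suc (Suc n))"
  note sw = simple_function_word[OF simple_function_trunc_branch]
  let ?I0 = "\<lambda>x. - ln (prob (level_set \<mu> ?W0 (?W0 x)))"
  let ?I1 = "\<lambda>x. - ln (prob (level_set \<mu> ?W1 (?W1 x)))"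
  have int0: "integrable \<mu> ?I0" and int0F: "integrable \<mu> (\<lambda>x. ?I0 (F lam x))" and int1: "integrable \<mu> ?I1"
    by (rule integrable_simple_function_compose[OF sw] integrable_simple_function_compose[OF simple_function_T[OF sw]])+
  have "AE x in \<mu>. trunc_info s N x + ?I0 (F lam x) \<le> ?I1 x"
    using AE_prob_level_set_pos[OF sw, of N "Suc (Suc n)"] AE_space
  proof eventually_elim
    case (elim x)
    let ?A = "level_set \<mu> ?W0 (?W0 (F lam x))" and ?L = "level_set \<mu> ?W1 (?W1 x)"
    have x: "x \<in> unit_ivl" "F lam x \<in> unit_ivl" using elim(2) T_space[OF elim(2)] by (simp_all add: space_mu)
    have A: "?A \<in> sets \<mu>" by (rule level_set_sets[OF sw])
    have sub: "?L \<subseteq> F lam -` ?A \<inter> space \<mu>"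
      using T_space by (auto simp: level_set_def word_Suc[of _ _ "Suc n"])
    then have "prob ?L \<le> prob (F lam -` ?A \<inter> space \<mu>)"
      by (intro finite_measure_mono measurable_sets[OF T_measurable] A)
    then have le: "prob ?L \<le> prob ?A" by (simp add: prob_vimage A)
    have L: "prob ?L > 0" by (rule elim(1))
    show ?case
    proof (cases "?f (F lam x) + 2 \<le> N")
      case True
      let ?k = "branch lam (F lam x)" and ?j = "branch lam x"
      have k: "?f (F lam x) = ?k" "?k + 2 \<le> N" using True by (auto simp: trunc_branch_def min_def split: if_splits)
      have j: "?f x = ?j" "?j < N" using k branch_F[OF x(1)] by (auto simp: trunc_branch_def)
      have jk: "?j \<in> {1..?k + 1}" using branch_F[OF x(1)] branch_ge1[OF x(1)] by simp
      have dig: "min a N = b \<longleftrightarrow> a = b" if "b < N" for a b :: nat using that by (auto simp: min_def)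
      have Ak: "branch lam y = ?k" if "y \<in> ?A" for y
      proof -
        have "?f y = ?k" using that k by (simp add: level_set_def word_Suc)
        then show ?thesis using k by (simp add: trunc_branch_def dig)
      qed
      have "?L = {y \<in> unit_ivl. branch lam y = ?j \<and> F lam y \<in> ?A}"
      proof (intro set_eqI)
        fix y
        have "?f y = ?f x \<longleftrightarrow> branch lam y = ?j" using j by (simp add: trunc_branch_def dig)
        then show "y \<in> ?L \<longleftrightarrow> y \<in> {y \<in> unit_ivl. branch lam y = ?j \<and> F lam y \<in> ?A}"
          using T_space[of y] by (auto simp: level_set_def word_Suc[of _ _ "Suc n"] space_mu simp del: greaterThanAtMost_iff)
      qed
      then have "prob ?L = geom_kernel s ?j ?k * prob ?A" using prob_vimage_backward_markov[OF s bm A Ak] by simp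
      moreover have "prob ?A > 0" using L le by linarith
      ultimately have "ln (prob ?L) = ln (geom_kernel s ?j ?k) + ln (prob ?A)"
        using S.geom_kernel_pos[OF jk] by (simp add: ln_mult_pos)
      then show ?thesis using True k j by (simp add: trunc_info_def)
    next
      case False
      then show ?thesis using L le by (simp add: trunc_info_def ln_mono)
    qed
  qed
  then have "(\<integral>x. trunc_info s N x + ?I0 (F lam x) \<partial>\<mu>) \<le> (\<integral>x. ?I1 x \<partial>\<mu>)"
    by (intro integral_mono_AE Bochner_Integration.integrable_add integrable_trunc_info int0F int1)
  moreover have "(\<integral>x. trunc_info s N x + ?I0 (F lam x) \<partial>\<mu>) = (\<integral>x. trunc_info s N x \<partial>\<mu>) + (\<integral>x. ?I0 (F lam x) \<partial>\<mu>)"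
    by (intro Bochner_Integration.integral_add integrable_trunc_info int0F)
  moreover have "(\<integral>x. ?I0 (F lam x) \<partial>\<mu>) = (\<integral>x. ?I0 x \<partial>\<mu>)"
    by (intro integral_T[where g="?I0"] borel_measurable_integrable int0)
  ultimately show ?thesis by (simp only: obs_entropy_def)
qed

lemma ks_entropy_ge_trunc_info:
  assumes s: "branch_map s" and bm: "backward_markov lam s \<mu>"
  shows "ereal (\<integral>x. trunc_info s N x \<partial>\<mu>) \<le> ks_entropy \<mu> (F lam)"
proof -
  let ?f = "trunc_branch lam N" and ?c = "\<integral>x. trunc_info s N x \<partial>\<mu>"
  let ?\<xi> = "level_set \<mu> ?f ` (?f ` space \<mu>)"
  have \<xi>: "finite_measurable_partition \<mu> ?\<xi>" by (rule partition_on_level_sets[OF simple_function_trunc_branch])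
  have "obs_entropy \<mu> (word (F lam) ?f (Suc n)) \<ge> real n * ?c" for n
  proof (induction n)
    case (Suc n)
    then show ?case using obs_entropy_word_Suc_ge[OF s bm, of N n] by (simp add: algebra_simps)
  qed (simp add: obs_entropy_nonneg)
  then have "?c \<le> entropy_wrt \<mu> (F lam) ?\<xi>"
    by (intro entropy_wrt_ge[OF \<xi>]) (simp add: obs_entropy_word_level_sets[OF simple_function_trunc_branch])
  then show ?thesis
    unfolding ks_entropy_def using \<xi> by (intro SUP_upper2[of ?\<xi>]) auto
qed

text \<open>As \<open>N\<close> grows, the truncated information increases to \<open>- ln\<close> of the kernel. Integrability of the symbols makes
  the coboundary in it integrable with mean zero.\<close>
theorem ks_entropy_ge_rate:
  assumes s: "branch_map s" and bm: "backward_markov lam s \<mu>"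
    and int: "integrable \<mu> (\<lambda>x. real (branch lam x))"
  shows "ereal (entropy_rate s (prob (tail 2))) \<le> ks_entropy \<mu> (F lam)"
proof -
  interpret S: branch_map s by fact
  let ?d = "\<lambda>x. real (branch lam x)"
  let ?\<phi> = "\<lambda>x. - ln (1 - s) - indicator (tail 2) x * ln s + (?d x - ?d (F lam x)) * ln (1 - s)"
  have intF: "integrable \<mu> (\<lambda>x. ?d (F lam x))"
    using integrable_distr[OF T_measurable, of ?d] int by (simp add: distr_T)
  have i: "integrable \<mu> (indicator (tail 2) :: real \<Rightarrow> real)"
    using tail_sets_mu[of 2] by (simp add: less_top[symmetric])
  have int\<phi>: "integrable \<mu> ?\<phi>" using int intF i by simp
  have \<phi>: "?\<phi> x = - ln (geom_kernel s (branch lam x) (branch lam (F lam x)))" "0 \<le> ?\<phi> x" if "x \<in> space \<mu>" for x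
  proof -
    have x: "x \<in> unit_ivl" "F lam x \<in> unit_ivl" using that T_space[OF that] by (simp_all add: space_mu)
    have b: "branch lam x \<in> {1..branch lam (F lam x) + 1}"
      using branch_ge1[OF x(1)] branch_F[OF x(1)] by simp
    have "2 \<le> branch lam x \<longleftrightarrow> x \<in> tail 2" using x by (auto simp: tail_def)
    then show eq: "?\<phi> x = - ln (geom_kernel s (branch lam x) (branch lam (F lam x)))"
      by (simp add: S.ln_geom_kernel[OF b] algebra_simps)
    show "0 \<le> ?\<phi> x"
      unfolding eq using S.geom_kernel_pos[OF b] S.geom_kernel_less_1[OF branch_ge1[OF x(2)] b] by simp
  qed
  have info: "trunc_info s N x = (if branch lam (F lam x) + 2 \<le> N then ?\<phi> x else 0)" if x: "x \<in> space \<mu>" for x N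
  proof -
    have "x \<in> unit_ivl" using x by (simp add: space_mu)
    then have "branch lam x \<le> branch lam (F lam x) + 1" by (rule branch_F)
    then show ?thesis unfolding trunc_info_def \<phi>(1)[OF x] by (auto simp: trunc_branch_def min_def)
  qed
  have lim: "(\<lambda>N. \<integral>x. trunc_info s N x \<partial>\<mu>) \<longlonglongrightarrow> (\<integral>x. ?\<phi> x \<partial>\<mu>)"
  proof (rule integral_dominated_convergence[where w="?\<phi>"])
    show "AE x in \<mu>. (\<lambda>N. trunc_info s N x) \<longlonglongrightarrow> ?\<phi> x"
    proof (rule AE_I2)
      fix x assume x: "x \<in> space \<mu>"
      have "eventually (\<lambda>N. trunc_info s N x = ?\<phi> x) sequentially"
        using eventually_ge_at_top[of "branch lam (F lam x) + 2"] by eventually_elim (simp add: info[OF x])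
      then show "(\<lambda>N. trunc_info s N x) \<longlonglongrightarrow> ?\<phi> x" by (rule tendsto_eventually)
    qed
    show "AE x in \<mu>. norm (trunc_info s N x) \<le> ?\<phi> x" for N
      by (rule AE_I2) (simp only: info real_norm_def, use \<phi>(2) in auto)
  qed (use int\<phi> integrable_trunc_info in \<open>auto intro: borel_measurable_integrable\<close>)
  have "(\<integral>x. ?\<phi> x \<partial>\<mu>) = - ln (1 - s) - prob (tail 2) * ln s + ((\<integral>x. ?d x \<partial>\<mu>) - (\<integral>x. ?d (F lam x) \<partial>\<mu>)) * ln (1 - s)"
    using int intF i tail_sets_mu[of 2] by (simp add: prob_space)
  also have "(\<integral>x. ?d (F lam x) \<partial>\<mu>) = (\<integral>x. ?d x \<partial>\<mu>)"
    by (intro integral_T borel_measurable_integrable int)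
  finally have "(\<integral>x. ?\<phi> x \<partial>\<mu>) = entropy_rate s (prob (tail 2))" by (simp add: entropy_rate_def)
  with lim have "(\<lambda>N. ereal (\<integral>x. trunc_info s N x \<partial>\<mu>)) \<longlonglongrightarrow> ereal (entropy_rate s (prob (tail 2)))" by simp
  then show ?thesis by (rule LIMSEQ_le_const2) (use ks_entropy_ge_trunc_info[OF s bm] in blast)
qed

end

context branch_map_pair
begin

lemma
  assumes half: "s < 1 / 2"
  shows equilibrium_measure_tail: "measure (equilibrium_measure lam s) (tail 2) = s / (1 - s)"
    and integrable_branch_equilibrium: "integrable (equilibrium_measure lam s) (\<lambda>x. real (branch lam x))"
proof -
  let ?m = "scaling_measure lam s" and ?\<mu> = "equilibrium_measure lam s"
  have bm: "backward_markov lam s ?\<mu>" by (rule backward_markov_equilibrium_measure[OF half])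
  interpret prob_space ?\<mu> using bm by (simp add: backward_markov_def)
  have st: "sets ?\<mu> = sets unit_borel" using bm by (simp add: backward_markov_def)
  have sp: "space ?\<mu> = unit_ivl" using sets_eq_imp_space_eq[OF st] by simp
  define h where "h k = (1 - 2 * s) / (1 - s) / (1 - s) ^ k" for k :: nat
  have h: "h k > 0" for k using half S.lam_less by (simp add: h_def)
  have mu: "?\<mu> = density ?m (\<lambda>x. ennreal (h (branch lam x)))" by (simp add: equilibrium_measure_def h_def)
  have meas: "(\<lambda>x. ennreal (h (branch lam x))) \<in> borel_measurable ?m"
    by (rule branch_measurable_cong[OF sets_scaling_measure, of "\<lambda>k. ennreal (h k)"])
  interpret m: prob_space ?m by (rule prob_space_scaling_measure)
  have "emeasure ?\<mu> (cyl lam [1]) = ennreal (h 1) * emeasure ?m (cyl lam [1])"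
    unfolding mu by (rule emeasure_density_branch[OF sets_scaling_measure cyl_sets, where f="\<lambda>k. ennreal (h k)"]) (auto simp: cyl_Cons)
  also have "emeasure ?m (cyl lam [1]) = ennreal (1 - s)"
    using measure_scaling_measure_cyl[of 0] by (simp add: m.emeasure_eq_measure)
  finally have "emeasure ?\<mu> (cyl lam [1]) = ennreal (h 1 * (1 - s))"
    using h[of 1] S.lam_less by (simp add: ennreal_mult)
  then have c: "prob (cyl lam [1]) = (1 - 2 * s) / (1 - s)"
    using h[of 1] S.lam_less half by (simp add: measure_def h_def)
  have "tail 2 = space ?\<mu> - cyl lam [1]"
  proof (intro set_eqI)
    fix x show "x \<in> tail 2 \<longleftrightarrow> x \<in> space ?\<mu> - cyl lam [1]"
      using branch_ge1[of x] by (auto simp: tail_def cyl_single sp simp del: greaterThanAtMost_iff)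
  qed
  then have "prob (tail 2) = 1 - (1 - 2 * s) / (1 - s)"
    using prob_compl[of "cyl lam [1]"] c by (simp only: st cyl_sets)
  also have "\<dots> = s / (1 - s)" using S.lam_less by (simp add: field_simps)
  finally show "prob (tail 2) = s / (1 - s)" .
  show "integrable ?\<mu> (\<lambda>x. real (branch lam x))"
  proof (rule integrableI_nonneg)
    show "(\<lambda>x. real (branch lam x)) \<in> borel_measurable ?\<mu>" by (rule branch_measurable_cong[OF st])
    define r where "r = s / (1 - s)"
    have r: "norm r < 1" using half S.lam_pos by (simp add: r_def field_simps)
    have "(\<integral>\<^sup>+x. ennreal (real (branch lam x)) \<partial>?\<mu>) = (\<integral>\<^sup>+x. ennreal (h (branch lam x)) * ennreal (real (branch lam x)) \<partial>?m)"
      unfolding mu by (intro nn_integral_density meas branch_measurable_cong[OF sets_scaling_measure])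
    also have "\<dots> = (\<integral>\<^sup>+x. ennreal (h (branch lam x) * real (branch lam x)) \<partial>?m)"
      using h by (simp add: ennreal_mult less_imp_le)
    also have "\<dots> = ennreal ((1 - 2 * s) / (1 - s) * (1 / (1 - r)^2))"
    proof (rule nn_integral_scaling_measure[where f="\<lambda>k. h k * real k"])
      have "h (Suc k) * real (Suc k) * ((1 - s) * s ^ k) = (1 - 2 * s) / (1 - s) * (of_nat (Suc k) * r ^ k)" for k
      proof -
        have "x / u / u ^ Suc k * n * (u * s ^ k) = x / u * (n * (s / u) ^ k)" if "u \<noteq> 0" for x u n :: real
          using that by (simp add: power_divide)
        then show ?thesis using S.lam_less by (simp only: h_def r_def)
      qed
      then show "(\<lambda>k. h (Suc k) * real (Suc k) * ((1 - s) * s ^ k)) sums ((1 - 2 * s) / (1 - s) * (1 / (1 - r)^2))"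
        using sums_mult[OF geometric_deriv_sums[OF r]] by (simp only:)
    qed (use h in \<open>simp add: less_imp_le\<close>)
    finally show "(\<integral>\<^sup>+x. ennreal (real (branch lam x)) \<partial>?\<mu>) < \<infinity>" by simp
  qed simp
qed

theorem ks_entropy_equilibrium_measure:
  assumes half: "s < 1 / 2"
  shows "equilibrium_measure lam s \<in> invariant_measures lam"
    and "ks_entropy (equilibrium_measure lam s) (F lam) = ereal (entropy_rate s (s / (1 - s)))"
proof -
  let ?\<mu> = "equilibrium_measure lam s"
  have s: "branch_map s" by unfold_locales
  have bm: "backward_markov lam s ?\<mu>" by (rule backward_markov_equilibrium_measure[OF half])
  show inv: "?\<mu> \<in> invariant_measures lam" by (rule backward_markov_invariant[OF s bm])
  interpret I: invariant_measure lam ?\<mu> by unfold_locales (rule inv)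
  show "ks_entropy ?\<mu> (F lam) = ereal (entropy_rate s (s / (1 - s)))"
    using I.ks_entropy_le_rate[OF s] I.ks_entropy_ge_rate[OF s bm integrable_branch_equilibrium[OF half]]
    by (simp add: equilibrium_measure_tail[OF half])
qed

end


section \<open>The potential\<close>

context branch_map
begin

lemma F_deriv_eq:
  assumes x: "x \<in> unit_ivl"
  shows "F_deriv lam x = 1 / slope lam (branch lam x)"
proof -
  let ?k = "branch lam x"
  have k: "?k \<ge> 1" and xW: "x \<in> W lam ?k" using x branch_ge1 branch_W by auto
  have "lam ^ ?k < lam ^ (?k - 1)" using xW by (auto simp: W_def)
  then have "\<not> (\<exists>a. W lam ?k = {a})"
  proof -
    assume lt: "lam ^ ?k < lam ^ (?k - 1)"
    have "lam ^ (?k - 1) \<in> W lam ?k" "(lam ^ ?k + lam ^ (?k - 1)) / 2 \<in> W lam ?k"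
      using lt by (auto simp: W_def)
    then show ?thesis using lt by force
  qed
  then have "x islimpt W lam ?k"
    using xW by (intro connected_imp_perfect) (auto simp: W_def)
  then have nb: "at x within W lam ?k \<noteq> bot" by (simp add: trivial_limit_within)
  have "((\<lambda>y. (y - lam ^ ?k) / slope lam ?k) has_vector_derivative (1 / slope lam ?k)) (at x within W lam ?k)"
    using slope_pos[of ?k]
    by (auto intro!: derivative_eq_intros simp: has_real_derivative_iff_has_vector_derivative[symmetric])
  then have "(F lam has_vector_derivative (1 / slope lam ?k)) (at x within W lam ?k)"
    by (rule has_vector_derivative_transform[OF xW, rotated]) (auto simp: W_eq[OF k] F_eq)
  then show ?thesis
    unfolding F_deriv_def by (rule vector_derivative_within[OF nb])
qed

lemma Phi_eq: "x \<in> unit_ivl \<Longrightarrow> \<Phi> lam t x = t * ln (slope lam (branch lam x))"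
  using slope_pos[of "branch lam x"] by (simp add: \<Phi>_def F_deriv_eq ln_div)

lemma ln_slope: "k \<ge> 1 \<Longrightarrow> ln (slope lam k) = ln (1 - lam) + (if k \<ge> 2 then ln lam else 0)"
  using lam_pos lam_less by (auto simp: slope_def ln_mult_pos)

end

context invariant_measure
begin

lemma
  shows integrable_Phi: "integrable \<mu> (\<Phi> lam t)"
    and integral_Phi: "(\<integral>x. \<Phi> lam t x \<partial>\<mu>) = t * ln (1 - lam) + prob (tail 2) * ln (lam powr t)"
proof -
  have eq: "\<Phi> lam t x = t * ln (1 - lam) + indicator (tail 2) x * ln (lam powr t)" if "x \<in> space \<mu>" for x
  proof -
    have x: "x \<in> unit_ivl" using that by (simp add: space_mu)
    then show ?thesis
      using lam_pos by (simp add: Phi_eq[OF x] ln_slope[OF branch_ge1[OF x]] tail_def ln_powr algebra_simps)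
  qed
  have i: "integrable \<mu> (indicator (tail 2) :: real \<Rightarrow> real)"
    using tail_sets_mu[of 2] by (simp add: less_top[symmetric])
  show "integrable \<mu> (\<Phi> lam t)"
    using i by (subst Bochner_Integration.integrable_cong[OF refl eq]) auto
  show "(\<integral>x. \<Phi> lam t x \<partial>\<mu>) = t * ln (1 - lam) + prob (tail 2) * ln (lam powr t)"
    using i tail_sets_mu[of 2] by (subst Bochner_Integration.integral_cong[OF refl eq]) (auto simp: prob_space)
qed

end


section \<open>Conformal measures\<close>

context branch_map
begin

definition conformal_factor :: "real \<Rightarrow> real \<Rightarrow> nat \<Rightarrow> real" where
  "conformal_factor t p k = exp (- p) * slope lam k powr t"

lemma conformal_factor_pos: "conformal_factor t p k > 0"
  using slope_pos[of k] by (simp add: conformal_factor_def)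

text \<open>The Jacobian that conformality prescribes is constant on every branch.\<close>
lemma exp_minus_Phi:
  "x \<in> unit_ivl \<Longrightarrow> exp (p - \<Phi> lam t x) = 1 / conformal_factor t p (branch lam x)"
  using slope_pos[of "branch lam x"]
  by (simp add: conformal_factor_def Phi_eq powr_def exp_diff exp_minus field_simps)

lemma conformal_factor_eq:
  "conformal_factor t p = (\<lambda>k. exp (- p) * (1 - lam) powr t * (if k = 1 then 1 else lam powr t))"
  using lam_pos lam_less by (auto simp: conformal_factor_def slope_def powr_mult)

lemma branch_scaling_of_conformal:
  assumes m: "conformal_measure lam t p m"
  shows "branch_scaling lam (conformal_factor t p) m"
  unfolding branch_scaling_def
proof (intro conjI allI impI ballI)
  interpret prob_space m using m by (simp add: conformal_measure_def)
  show "finite_measure m" by unfold_locales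
  show st: "sets m = sets unit_borel" using m by (simp add: conformal_measure_def)
  fix k :: nat and B assume k: "k \<ge> 1" and B: "B \<in> sets unit_borel" and le: "\<forall>y\<in>B. k \<le> branch lam y + 1"
  let ?A = "{x \<in> unit_ivl. branch lam x = k \<and> F lam x \<in> B}"
  have A: "?A \<in> sets m" using branch_F_vimage_sets[OF B] by (simp add: st)
  have inj: "inj_on (F lam) ?A"
  proof (rule inj_onI)
    fix x y assume xy: "x \<in> ?A" "y \<in> ?A" "F lam x = F lam y"
    then show "x = y" using inv_branch_F[of x] inv_branch_F[of y] by auto
  qed
  have sub: "B \<subseteq> unit_ivl" using B by (simp add: sets_restrict_space_iff)
  have img: "F lam ` ?A = B"
  proof (intro set_eqI iffI)
    fix y assume y: "y \<in> B"
    then have "y \<in> unit_ivl" "k \<le> branch lam y + 1" using sub le by auto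
    then show "y \<in> F lam ` ?A"
      using y k by (intro image_eqI[of _ _ "inv_branch lam k y"])
        (auto simp: F_inv_branch branch_inv_branch inv_branch_unit simp del: greaterThanAtMost_iff)
  qed auto
  have "emeasure m (F lam ` ?A) = (\<integral>\<^sup>+x\<in>?A. ennreal (exp (p - \<Phi> lam t x)) \<partial>m)"
    using m A inj unfolding conformal_measure_def by blast
  also have "\<dots> = (\<integral>\<^sup>+x. ennreal (1 / conformal_factor t p k) * indicator ?A x \<partial>m)"
    by (intro nn_integral_cong) (auto simp: exp_minus_Phi indicator_def)
  also have "\<dots> = ennreal (1 / conformal_factor t p k) * emeasure m ?A"
    using A by (simp add: nn_integral_cmult_indicator)
  finally have "measure m B = 1 / conformal_factor t p k * measure m ?A"
    using conformal_factor_pos[of t p k] by (simp only: img) (simp add: measure_def enn2real_mult)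
  then show "measure m ?A = conformal_factor t p k * measure m B"
    using conformal_factor_pos[of t p k] by simp
qed

text \<open>A set on which the map is injective splits along the branches into countably many pieces with disjoint images.\<close>
lemma conformal_of_branch_scaling:
  assumes m: "branch_scaling lam (conformal_factor t p) m" and p: "prob_space m"
  shows "conformal_measure lam t p m"
  unfolding conformal_measure_def
proof (intro conjI ballI impI)
  interpret prob_space m by fact
  show "prob_space m" by fact
  show st: "sets m = sets unit_borel" by (rule branch_scaling_sets[OF m])
  fix A assume A: "A \<in> sets m" and inj: "inj_on (F lam) A"
  have A': "A \<in> sets borel" "A \<subseteq> unit_ivl" using A by (simp_all add: st sets_restrict_space_iff)
  let ?q = "conformal_factor t p"
  let ?A = "\<lambda>k. A \<inter> cyl lam [k]"
  let ?B = "\<lambda>k. F lam ` ?A k"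
  have As: "?A k \<in> sets m" for k using A cyl_sets by (auto simp: st)
  have un: "(\<Union>k. ?A k) = A" using UN_cyl_single A' by blast
  have zero: "?A 0 = {}"
  proof -
    have "x \<notin> cyl lam [0]" for x using branch_ge1[of x] by (auto simp: cyl_single)
    then show ?thesis by blast
  qed
  have Bs: "?B k \<in> sets unit_borel" for k
  proof (cases "k = 0")
    case False
    have "?B k = tail (k - 1) \<inter> {y. inv_branch lam k y \<in> A}"
    proof (intro set_eqI iffI)
      fix y assume "y \<in> ?B k"
      then obtain x where x: "x \<in> A" "x \<in> unit_ivl" "branch lam x = k" "y = F lam x" by (auto simp: cyl_single)
      then show "y \<in> tail (k - 1) \<inter> {y. inv_branch lam k y \<in> A}"
        using F_unit[OF x(2)] branch_F[OF x(2)] inv_branch_F[OF x(2)] by (auto simp: tail_def simp del: greaterThanAtMost_iff)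
    next
      fix y assume "y \<in> tail (k - 1) \<inter> {y. inv_branch lam k y \<in> A}"
      then have y: "y \<in> unit_ivl" "k \<le> branch lam y + 1" "inv_branch lam k y \<in> A" by (auto simp: tail_def)
      then show "y \<in> ?B k"
        using False by (intro image_eqI[of _ _ "inv_branch lam k y"])
          (auto simp: F_inv_branch branch_inv_branch inv_branch_unit cyl_single simp del: greaterThanAtMost_iff)
    qed
    moreover have "{y. inv_branch lam k y \<in> A} \<in> sets borel"
    proof -
      have "inv_branch lam k \<in> borel_measurable borel" unfolding inv_branch_def[abs_def] by measurable
      then show ?thesis using measurable_sets[of "inv_branch lam k" borel borel A] A' by (simp add: vimage_def)
    qed
    then have "unit_ivl \<inter> {y. inv_branch lam k y \<in> A} \<in> sets unit_borel"
      by (simp add: sets_restrict_space_iff)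
    then have "tail (k - 1) \<inter> (unit_ivl \<inter> {y. inv_branch lam k y \<in> A}) \<in> sets unit_borel"
      using tail_sets by (rule sets.Int[rotated])
    moreover have "tail (k - 1) \<inter> (unit_ivl \<inter> {y. inv_branch lam k y \<in> A}) = tail (k - 1) \<inter> {y. inv_branch lam k y \<in> A}"
      by (auto simp: tail_def)
    ultimately show ?thesis by simp
  qed (use zero in simp)
  have Fun: "F lam ` A = (\<Union>k. ?B k)" using un by (metis image_UN)
  then show "F lam ` A \<in> sets m" using Bs by (simp add: st sets.countable_UN image_subset_iff)
  have scale: "emeasure m (?B k) = ennreal (1 / ?q k) * emeasure m (?A k)" for k
  proof (cases "k = 0")
    case True
    then show ?thesis using zero by simp
  next
    case False
    have "{x \<in> unit_ivl. branch lam x = k \<and> F lam x \<in> ?B k} = ?A k"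
    proof (intro set_eqI iffI)
      fix x assume x: "x \<in> {x \<in> unit_ivl. branch lam x = k \<and> F lam x \<in> ?B k}"
      then obtain z where z: "z \<in> A" "z \<in> unit_ivl" "branch lam z = k" "F lam x = F lam z" by (auto simp: cyl_single)
      then have "x = z" using x inv_branch_F[of x] inv_branch_F[of z] by auto
      then show "x \<in> ?A k" using z by (auto simp: cyl_single)
    qed (auto simp: cyl_single)
    then have "measure m (?A k) = ?q k * measure m (?B k)"
      using branch_scaling_eq[OF m _ Bs, of k k] False branch_F by (fastforce simp: cyl_single simp del: greaterThanAtMost_iff)
    then have "measure m (?B k) = 1 / ?q k * measure m (?A k)" using conformal_factor_pos[of t p k] by simp
    then show ?thesis using conformal_factor_pos[of t p k]
      by (simp add: emeasure_eq_measure ennreal_mult[symmetric] less_imp_le)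
  qed
  have dis: "disjoint_family ?A" "disjoint_family ?B"
  proof -
    show 1: "disjoint_family ?A" by (auto simp: disjoint_family_on_def cyl_single)
    show "disjoint_family ?B"
      unfolding disjoint_family_on_def
    proof (intro ballI impI)
      fix i j :: nat assume "i \<noteq> j"
      then have "?A i \<inter> ?A j = {}" by (auto simp: cyl_single)
      then show "?B i \<inter> ?B j = {}" using inj_on_image_Int[OF inj, of "?A i" "?A j"] by simp
    qed
  qed
  have "emeasure m (F lam ` A) = (\<Sum>k. emeasure m (?B k))"
    unfolding Fun using Bs dis(2) by (intro suminf_emeasure[symmetric]) (auto simp: st)
  also have "\<dots> = (\<Sum>k. emeasure (density m (\<lambda>x. ennreal (1 / ?q (branch lam x)))) (?A k))"
  proof (rule suminf_cong)
    fix k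
    have "emeasure (density m (\<lambda>x. ennreal (1 / ?q (branch lam x)))) (?A k) = ennreal (1 / ?q k) * emeasure m (?A k)"
      using As[of k] st
      by (intro emeasure_density_branch[OF st, where f="\<lambda>k. ennreal (1 / ?q k)"]) (auto simp: cyl_single)
    then show "emeasure m (?B k) = emeasure (density m (\<lambda>x. ennreal (1 / ?q (branch lam x)))) (?A k)"
      by (simp add: scale)
  qed
  also have "\<dots> = emeasure (density m (\<lambda>x. ennreal (1 / ?q (branch lam x)))) A"
    using suminf_emeasure[of ?A "density m (\<lambda>x. ennreal (1 / ?q (branch lam x)))"] As dis(1) un by (simp add: image_subset_iff)
  also have "\<dots> = (\<integral>\<^sup>+x. ennreal (1 / ?q (branch lam x)) * indicator A x \<partial>m)"
    by (rule emeasure_density[OF branch_measurable_cong[OF st, of "\<lambda>k. ennreal (1 / ?q k)"] A])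
  also have "\<dots> = (\<integral>\<^sup>+x\<in>A. ennreal (exp (p - \<Phi> lam t x)) \<partial>m)"
    using A' by (intro nn_integral_cong) (auto simp: exp_minus_Phi indicator_def)
  finally show "emeasure m (F lam ` A) = (\<integral>\<^sup>+x\<in>A. ennreal (exp (p - \<Phi> lam t x)) \<partial>m)" .
qed

lemma
  assumes half: "lam powr t < 1 / 2"
  shows P_Conf_eq: "P_Conf lam t = ereal (ln (\<psi> lam t))"
    and m_conf_eq: "m_conf lam t = scaling_measure lam (lam powr t)"
proof -
  define s where "s = lam powr t"
  have s: "0 < s" "s < 1 / 2" using half lam_pos by (auto simp: s_def)
  interpret S: branch_map_pair lam s by unfold_locales (use s in auto)
  have sc: "branch_scaling lam (slope s) (scaling_measure lam s)" by (rule S.branch_scaling_scaling_measure)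
  interpret m: prob_space "scaling_measure lam s" by (rule S.prob_space_scaling_measure)
  have psi: "\<psi> lam t > 0" "exp (- ln (\<psi> lam t)) * (1 - lam) powr t = 1 - s"
    using s lam_less by (auto simp: \<psi>_def s_def exp_minus)
  have q: "conformal_factor t (ln (\<psi> lam t)) = slope s"
    unfolding conformal_factor_eq psi(2) by (auto simp: slope_def s_def)
  have cm: "conformal_measure lam t (ln (\<psi> lam t)) (scaling_measure lam s)"
    by (rule conformal_of_branch_scaling) (simp_all add: q sc m.prob_space_axioms)
  have one: "measure m unit_ivl = 1" if "conformal_measure lam t p m" for m p
  proof -
    have "prob_space m" using that by (simp add: conformal_measure_def)
    then show ?thesis
      using prob_space.prob_space[of m] branch_scaling_space[OF branch_scaling_of_conformal[OF that]] by simp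
  qed
  have ge: "ln (\<psi> lam t) \<le> p" if "conformal_measure lam t p m" for m p
  proof -
    have "exp (- p) * (1 - lam) powr t \<le> 1 - s"
      using branch_scaling_of_conformal[OF that] one[OF that] s
      unfolding conformal_factor_eq s_def[symmetric] by (intro branch_scaling_factor_le[where m=m]) auto
    also have "\<dots> = exp (- ln (\<psi> lam t)) * (1 - lam) powr t" by (simp add: psi)
    finally have "exp (- p) \<le> exp (- ln (\<psi> lam t))" using lam_less by simp
    then show ?thesis by simp
  qed
  show P: "P_Conf lam t = ereal (ln (\<psi> lam t))"
    unfolding P_Conf_def using cm ge by (intro antisym INF_lower2 INF_greatest) auto
  show "m_conf lam t = scaling_measure lam (lam powr t)"
    unfolding m_conf_def s_def[symmetric]
  proof (rule the_equality)
    show "\<exists>p. ereal p = P_Conf lam t \<and> conformal_measure lam t p (scaling_measure lam s)"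
      using cm P by auto
    fix m assume "\<exists>p. ereal p = P_Conf lam t \<and> conformal_measure lam t p m"
    then have m: "conformal_measure lam t (ln (\<psi> lam t)) m" using P by auto
    show "m = scaling_measure lam s"
      using branch_scaling_of_conformal[OF m] one[OF m] one[OF cm]
      by (intro branch_scaling_unique[OF _ sc]) (simp_all add: q)
  qed
qed

end


section \<open>The pressure\<close>

definition pressure_value :: "real \<Rightarrow> real \<Rightarrow> real" where
  "pressure_value lam t =
    (if lam powr t \<le> 1 / 2 then ln (\<psi> lam t) else ln (4 * lam powr t * (1 - lam) powr t))"

context branch_map
begin

lemma ln_psi: "lam powr t < 1 \<Longrightarrow> ln (\<psi> lam t) = t * ln (1 - lam) - ln (1 - lam powr t)"
  using lam_less by (simp add: \<psi>_def ln_div ln_powr)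

lemma ln_four: "ln (4 * lam powr t * (1 - lam) powr t) = 2 * ln 2 + ln (lam powr t) + t * ln (1 - lam)"
proof -
  have "ln (4 :: real) = 2 * ln 2" using ln_realpow[of 2 2] by simp
  then show ?thesis using lam_pos lam_less by (simp add: ln_mult_pos ln_powr)
qed

lemma pressure_value_upper:
  "lam powr t \<ge> 1 / 2 \<Longrightarrow> pressure_value lam t = 2 * ln 2 + ln (lam powr t) + t * ln (1 - lam)"
proof (cases "lam powr t = 1 / 2")
  case True
  then show ?thesis by (simp add: pressure_value_def ln_psi True ln_div)
qed (simp add: pressure_value_def ln_four)

lemma pressure_value_lower:
  "lam powr t \<le> 1 / 2 \<Longrightarrow> pressure_value lam t = t * ln (1 - lam) - ln (1 - lam powr t)"
  by (simp add: pressure_value_def ln_psi)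

end

text \<open>The kernel parameter is \<open>s\<close> where the geometric equilibrium exists and stops at \<open>1 / 2\<close>. Beyond \<open>1 / 2\<close> the
  bound is not optimal for a measure with \<open>M < 1\<close>, but \<open>M \<le> 1\<close> and \<open>ln (2 * s) \<ge> 0\<close> make its maximum the value claimed
  for the pressure. Equality in the final estimate forces equality in the entropy bound.\<close>

lemma (in invariant_measure)
  shows free_energy_le: "ks_entropy \<mu> (F lam) + ereal (\<integral>x. \<Phi> lam t x \<partial>\<mu>) \<le> ereal (pressure_value lam t)"
    and backward_markov_of_equality:
      "ks_entropy \<mu> (F lam) + ereal (\<integral>x. \<Phi> lam t x \<partial>\<mu>) = ereal (pressure_value lam t)
        \<Longrightarrow> backward_markov lam (min (lam powr t) (1 / 2)) \<mu>"
proof -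
  define s where "s = lam powr t"
  define r where "r = min s (1 / 2)"
  define M where "M = prob (tail 2)"
  have s: "0 < s" using lam_pos by (simp add: s_def)
  have r: "branch_map r" by unfold_locales (use s in \<open>auto simp: r_def\<close>)
  have M: "0 \<le> M" "M \<le> 1" by (auto simp: M_def)
  have le: "entropy_rate r M \<le> pressure_value lam t - (t * ln (1 - lam) + M * ln s)"
  proof (cases "s \<le> 1 / 2")
    case True
    then show ?thesis by (simp add: r_def pressure_value_lower s_def[symmetric] entropy_rate_def)
  next
    case False
    have "ln (2 * s) \<ge> 0" using False by simp
    then have "(1 - M) * (ln 2 + ln s) \<ge> 0" using M s by (simp add: ln_mult_pos)
    then show ?thesis
      using False by (simp add: r_def pressure_value_upper s_def[symmetric] entropy_rate_def ln_div algebra_simps)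
  qed
  have int: "(\<integral>x. \<Phi> lam t x \<partial>\<mu>) = t * ln (1 - lam) + M * ln s" by (simp add: integral_Phi M_def s_def)
  have "ks_entropy \<mu> (F lam) \<le> ereal (entropy_rate r M)" using ks_entropy_le_rate[OF r] by (simp add: M_def)
  also have "\<dots> \<le> ereal (pressure_value lam t - (t * ln (1 - lam) + M * ln s))" using le by simp
  finally have "ks_entropy \<mu> (F lam) + ereal (t * ln (1 - lam) + M * ln s)
      \<le> ereal (pressure_value lam t - (t * ln (1 - lam) + M * ln s)) + ereal (t * ln (1 - lam) + M * ln s)"
    by (rule add_right_mono)
  then show "ks_entropy \<mu> (F lam) + ereal (\<integral>x. \<Phi> lam t x \<partial>\<mu>) \<le> ereal (pressure_value lam t)"
    by (simp add: int)
  assume "ks_entropy \<mu> (F lam) + ereal (\<integral>x. \<Phi> lam t x \<partial>\<mu>) = ereal (pressure_value lam t)"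
  then have "ks_entropy \<mu> (F lam) = ereal (pressure_value lam t - (t * ln (1 - lam) + M * ln s))"
    unfolding int by (cases "ks_entropy \<mu> (F lam)") auto
  then have "ks_entropy \<mu> (F lam) \<ge> ereal (entropy_rate r (prob (tail 2)))" using le by (simp add: M_def)
  then show "backward_markov lam (min (lam powr t) (1 / 2)) \<mu>"
    using backward_markov_of_maximal[OF r] by (simp add: r_def s_def)
qed

lemma (in branch_map_pair) free_energy_equilibrium_measure:
  assumes half: "s < 1 / 2"
  shows "ks_entropy (equilibrium_measure lam s) (F lam) + ereal (\<integral>x. \<Phi> lam t x \<partial>equilibrium_measure lam s)
    = ereal (entropy_rate s (s / (1 - s)) + t * ln (1 - lam) + s / (1 - s) * ln (lam powr t))"
proof -
  interpret I: invariant_measure lam "equilibrium_measure lam s"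
    by unfold_locales (rule ks_entropy_equilibrium_measure(1)[OF half])
  show ?thesis
    by (simp add: ks_entropy_equilibrium_measure(2)[OF half] I.integral_Phi equilibrium_measure_tail[OF half])
qed

context branch_map
begin

lemma free_energy_le_pressure:
  assumes s: "0 < s" "s < 1 / 2"
  shows "ereal (entropy_rate s (s / (1 - s)) + t * ln (1 - lam) + s / (1 - s) * ln (lam powr t)) \<le> pressure lam t"
proof -
  interpret S: branch_map_pair lam s by unfold_locales (use s in auto)
  have inv: "equilibrium_measure lam s \<in> invariant_measures lam"
    by (rule S.ks_entropy_equilibrium_measure(1)[OF s(2)])
  interpret I: invariant_measure lam "equilibrium_measure lam s" by unfold_locales (rule inv)
  show ?thesis
    unfolding pressure_def S.free_energy_equilibrium_measure[OF s(2), symmetric]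
    using inv I.integrable_Phi by (intro SUP_upper) auto
qed

theorem pressure_eq: "pressure lam t = ereal (pressure_value lam t)"
proof (rule antisym)
  show "pressure lam t \<le> ereal (pressure_value lam t)"
    unfolding pressure_def
  proof (rule SUP_least)
    fix \<mu> assume "\<mu> \<in> {\<mu> \<in> invariant_measures lam. integrable \<mu> (\<Phi> lam t)}"
    then interpret invariant_measure lam \<mu> by unfold_locales auto
    show "ks_entropy \<mu> (F lam) + ereal (\<integral>x. \<Phi> lam t x \<partial>\<mu>) \<le> ereal (pressure_value lam t)"
      by (rule free_energy_le)
  qed
  show "ereal (pressure_value lam t) \<le> pressure lam t"
  proof (cases "lam powr t < 1 / 2")
    case True
    then show ?thesis
      using free_energy_le_pressure[of "lam powr t" t] lam_pos by (simp add: pressure_value_lower entropy_rate_def)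
  next
    case False
    (* At s = 1 / 2 there is no equilibrium measure, but its free energy v s extends continuously. *)
    define v where "v s = entropy_rate s (s / (1 - s)) + t * ln (1 - lam) + s / (1 - s) * ln (lam powr t)" for s
    define u where "u n = 1 / 2 - inverse (real (n + 3))" for n
    have u: "0 < u n" "u n < 1 / 2" for n by (auto simp: u_def field_simps)
    have ulim: "u \<longlonglongrightarrow> 1 / 2" unfolding u_def[abs_def] by real_asymp
    have "isCont v (1 / 2)" unfolding v_def[abs_def] entropy_rate_def by (intro continuous_intros) auto
    then have "(\<lambda>n. v (u n)) \<longlonglongrightarrow> v (1 / 2)" using ulim by (rule isCont_tendsto_compose)
    moreover have "v (1 / 2) = pressure_value lam t"
      using False by (simp add: v_def entropy_rate_def pressure_value_upper ln_div)
    ultimately have "(\<lambda>n. ereal (v (u n))) \<longlonglongrightarrow> ereal (pressure_value lam t)" by simp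
    then show ?thesis
      by (rule LIMSEQ_le_const2) (use free_energy_le_pressure[OF u] in \<open>auto simp: v_def\<close>)
  qed
qed

lemma equilibrium_state_backward_markov:
  assumes "equilibrium_state lam t \<mu>"
  shows "lam powr t < 1 / 2" and "backward_markov lam (lam powr t) \<mu>"
proof -
  interpret invariant_measure lam \<mu>
    using assms by unfold_locales (simp add: equilibrium_state_def)
  have bm: "backward_markov lam (min (lam powr t) (1 / 2)) \<mu>"
    using assms by (intro backward_markov_of_equality) (simp add: equilibrium_state_def pressure_eq)
  then show half: "lam powr t < 1 / 2"
  proof (rule contrapos_pp)
    assume "\<not> lam powr t < 1 / 2"
    then have "min (lam powr t) (1 / 2) = 1 / 2" by simp
    then show "\<not> backward_markov lam (min (lam powr t) (1 / 2)) \<mu>" by (simp only: not_backward_markov_half) simp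
  qed
  with bm show "backward_markov lam (lam powr t) \<mu>" by (simp add: min_def)
qed

lemma equilibrium_state_iff:
  "equilibrium_state lam t \<mu> \<longleftrightarrow> lam powr t < 1 / 2 \<and> \<mu> = equilibrium_measure lam (lam powr t)"
proof
  assume e: "equilibrium_state lam t \<mu>"
  note half = equilibrium_state_backward_markov(1)[OF e]
  interpret S: branch_map_pair lam "lam powr t" by unfold_locales (use half lam_pos in auto)
  have "\<mu> = equilibrium_measure lam (lam powr t)"
    by (rule backward_markov_unique[OF S.S.branch_map_axioms equilibrium_state_backward_markov(2)[OF e]
          S.backward_markov_equilibrium_measure[OF half]])
  with half show "lam powr t < 1 / 2 \<and> \<mu> = equilibrium_measure lam (lam powr t)" by blast
next
  assume "lam powr t < 1 / 2 \<and> \<mu> = equilibrium_measure lam (lam powr t)"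
  then have half: "lam powr t < 1 / 2" and \<mu>: "\<mu> = equilibrium_measure lam (lam powr t)" by auto
  interpret S: branch_map_pair lam "lam powr t" by unfold_locales (use half lam_pos in auto)
  show "equilibrium_state lam t \<mu>"
    unfolding equilibrium_state_def \<mu> S.free_energy_equilibrium_measure[OF half] pressure_eq
    using half S.ks_entropy_equilibrium_measure(1)[OF half]
    by (simp add: pressure_value_lower entropy_rate_def)
qed

lemma absolutely_continuous_equilibrium_measure:
  assumes half: "lam powr t < 1 / 2"
  shows "absolutely_continuous (m_conf lam t) (equilibrium_measure lam (lam powr t))"
proof -
  interpret S: branch_map_pair lam "lam powr t" by unfold_locales (use half lam_pos in auto)
  show ?thesis
    unfolding m_conf_eq[OF half] equilibrium_measure_def
    by (intro absolutely_continuousI_density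
          branch_measurable_cong[OF S.sets_scaling_measure, of "\<lambda>k. ennreal (_ / _ ^ k)"])
qed

end


section \<open>The phase transition\<close>

text \<open>The difference quotients of \<open>f\<close> are those of \<open>g\<close> on the right and those of \<open>h\<close> on the left.\<close>
lemma has_real_derivative_glue_iff:
  fixes f g h :: "real \<Rightarrow> real"
  assumes f: "\<And>x. x \<ge> a \<Longrightarrow> f x = g x" "\<And>x. x \<le> a \<Longrightarrow> f x = h x"
    and g: "(g has_real_derivative g') (at a)" and h: "(h has_real_derivative h') (at a)"
  shows "(f has_real_derivative d) (at a) \<longleftrightarrow> g' = d \<and> h' = d"
proof -
  let ?q = "\<lambda>f x. (f x - f a) / (x - a) :: real"
  have q: "(?q g \<longlongrightarrow> g') (at_right a)" "(?q h \<longlongrightarrow> h') (at_left a)"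
    using g h by (auto simp: has_field_derivative_iff filterlim_at_split)
  have "(?q f \<longlongrightarrow> d) (at_right a) \<longleftrightarrow> (?q g \<longlongrightarrow> d) (at_right a)"
    using f(1) by (intro filterlim_cong refl) (auto simp: eventually_at_filter)
  also have "\<dots> \<longleftrightarrow> g' = d" using q(1) tendsto_unique[OF trivial_limit_at_right_real q(1)] by blast
  finally have 1: "(?q f \<longlongrightarrow> d) (at_right a) \<longleftrightarrow> g' = d" .
  have "(?q f \<longlongrightarrow> d) (at_left a) \<longleftrightarrow> (?q h \<longlongrightarrow> d) (at_left a)"
    using f(2) by (intro filterlim_cong refl) (auto simp: eventually_at_filter)
  also have "\<dots> \<longleftrightarrow> h' = d" using q(2) tendsto_unique[OF trivial_limit_at_left_real q(2)] by blast
  finally have 2: "(?q f \<longlongrightarrow> d) (at_left a) \<longleftrightarrow> h' = d" .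
  show ?thesis by (auto simp: has_field_derivative_iff filterlim_at_split 1 2)
qed

text \<open>Below the critical parameter the pressure is affine. The first derivative is the continuous function \<open>D\<close>, in
  which \<open>min\<close> merges the two formulas; at \<open>t0\<close> its right derivative is \<open>2 * (ln lam) ^ 2\<close>, its left derivative 0.\<close>
lemma (in branch_map) phase_transition_pressure_value:
  "phase_transition 2 (pressure_value lam) (- ln 2 / ln lam)"
proof -
  define l where "l = ln lam"
  define a where "a = ln (1 - lam)"
  define t0 where "t0 = - ln 2 / l"
  let ?f = "pressure_value lam"
  define g where "g t = t * a - ln (1 - exp (t * l))" for t
  define h where "h t = 2 * ln 2 + t * l + t * a" for t
  define D where "D t = a + l * (min (exp (t * l)) (1 / 2) / (1 - min (exp (t * l)) (1 / 2)))" for t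
  define D' where "D' t = a + l * (exp (t * l) / (1 - exp (t * l)))" for t
  have l: "l < 0" using lam_pos lam_less by (simp add: l_def)
  have pw: "lam powr t = exp (t * l)" for t using lam_pos by (simp add: powr_def l_def)
  have e0: "exp (t0 * l) = 1 / 2" using l by (simp add: t0_def exp_minus)
  have le_iff: "exp (t * l) \<le> 1 / 2 \<longleftrightarrow> t \<ge> t0" for t
  proof -
    have "exp (t * l) \<le> exp (t0 * l) \<longleftrightarrow> t \<ge> t0" using l by (simp add: mult_le_cancel_right)
    then show ?thesis by (simp add: e0)
  qed
  have ge_iff: "1 / 2 \<le> exp (t * l) \<longleftrightarrow> t \<le> t0" for t
  proof -
    have "exp (t0 * l) \<le> exp (t * l) \<longleftrightarrow> t \<le> t0" using l by (simp add: mult_le_cancel_right)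
    then show ?thesis by (simp add: e0)
  qed
  have fg: "?f t = g t" if "t \<ge> t0" for t
    using that pressure_value_lower[of t] le_iff[of t] by (simp add: pw g_def a_def)
  have fh: "?f t = h t" if "t \<le> t0" for t
    using that pressure_value_upper[of t] ge_iff[of t] by (simp add: pw h_def a_def)
  have dg: "(g has_real_derivative D' t) (at t)" if "exp (t * l) < 1" for t
    unfolding g_def D'_def using that by (auto intro!: derivative_eq_intros simp: field_simps)
  have dh: "(h has_real_derivative (l + a)) (at t)" for t
    unfolding h_def by (auto intro!: derivative_eq_intros)
  have DD: "D t = D' t" if "t \<ge> t0" for t using that le_iff[of t] by (simp add: D_def D'_def)
  have Dla: "D t = l + a" if "t \<le> t0" for t
  proof -
    have "min (exp (t * l)) (1 / 2) = 1 / 2" using that ge_iff by (intro min_absorb2) blast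
    then show ?thesis by (simp add: D_def)
  qed
  have df: "(?f has_real_derivative D t) (at t)" for t
  proof (cases t t0 rule: linorder_cases)
    case less
    have "(h has_real_derivative D t) (at t)" using dh[of t] Dla[of t] less by simp
    then show ?thesis
      by (rule has_field_derivative_transform_within_open[of _ _ _ "{..<t0}"]) (use less fh in auto)
  next
    case greater
    then have "exp (t * l) \<le> 1 / 2" using le_iff[of t] by simp
    then have "exp (t * l) < 1" by linarith
    then have "(g has_real_derivative D t) (at t)" using dg[of t] DD[of t] greater by simp
    then show ?thesis
      by (rule has_field_derivative_transform_within_open[of _ _ _ "{t0<..}"]) (use greater fg in auto)
  next
    case equal
    have "(g has_real_derivative D t0) (at t0)" "(h has_real_derivative D t0) (at t0)"
      using dg[of t0] e0 dh[of t0] DD[of t0] Dla[of t0] by simp_all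
    then show ?thesis using has_real_derivative_glue_iff[OF fg fh, of t0] equal by simp
  qed
  then have deriv: "deriv ?f = D" by (intro ext DERIV_imp_deriv)
  have "continuous_on UNIV D"
  proof -
    have "1 - min (exp (t * l)) (1 / 2) \<noteq> 0" for t
      using min.cobounded2[of "exp (t * l)" "1 / 2"] by linarith
    then show ?thesis unfolding D_def by (intro continuous_intros) auto
  qed
  then have "C_k_at 1 ?f t0"
    using df unfolding C_k_at_def by (intro exI[of _ UNIV]) (auto simp: deriv field_differentiable_def)
  moreover have "\<not> C_k_at 2 ?f t0"
  proof
    assume "C_k_at 2 ?f t0"
    then obtain U where U: "t0 \<in> U" "\<And>j y. j < 2 \<Longrightarrow> y \<in> U \<Longrightarrow> (deriv ^^ j) ?f field_differentiable (at y)"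
      unfolding C_k_at_def by blast
    from U(2)[of 1 t0] U(1) obtain d where d: "(D has_real_derivative d) (at t0)"
      by (auto simp: deriv field_differentiable_def)
    have "(D' has_real_derivative (l * (l * (1 / 2) * (1 / 2) + (1 / 2) * (l * (1 / 2))) / (1 / 4))) (at t0)"
      unfolding D'_def by (auto intro!: derivative_eq_intros simp: e0 power2_eq_square)
    moreover have "((\<lambda>_. l + a) has_real_derivative 0) (at t0)" by simp
    ultimately have "l * (l * (1 / 2) * (1 / 2) + (1 / 2) * (l * (1 / 2))) / (1 / 4) = d \<and> 0 = d"
      using has_real_derivative_glue_iff[where f=D and g=D' and h="\<lambda>_. l + a" and a=t0, OF DD Dla] d by blast
    then show False using l by (auto simp: field_simps)
  qed
  ultimately show ?thesis by (simp add: phase_transition_def t0_def l_def)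
qed

theorem theorem2:
  fixes lam :: real
  assumes "0 < lam" and "lam < 1"
  shows "(\<forall>t. (lam powr t \<le> 1 / 2 \<longrightarrow> pressure lam t = ereal (ln (\<psi> lam t))) \<and>
              (lam powr t \<ge> 1 / 2 \<longrightarrow> pressure lam t = ereal (ln (4 * lam powr t * (1 - lam) powr t))))
    \<and> phase_transition 2 (\<lambda>t. real_of_ereal (pressure lam t)) (- ln 2 / ln lam)
    \<and> (\<forall>t. lam powr t < 1 / 2 \<longrightarrow> (\<exists>\<mu>. equilibrium_state lam t \<mu>))
    \<and> (\<forall>t \<mu>. equilibrium_state lam t \<mu> \<longrightarrow>
          (\<forall>\<nu>. equilibrium_state lam t \<nu> \<longrightarrow> \<nu> = \<mu>) \<and> absolutely_continuous (m_conf lam t) \<mu>)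
    \<and> (\<forall>t. lam powr t \<ge> 1 / 2 \<longrightarrow> \<not> (\<exists>\<mu>. equilibrium_state lam t \<mu>))
    \<and> \<not> (\<exists>\<mu>. measure_of_maximal_entropy lam \<mu>)"
proof -
  interpret branch_map lam using assms by unfold_locales
  have "pressure lam t = ereal (ln (\<psi> lam t))" if "lam powr t \<le> 1 / 2" for t
    using that by (simp add: pressure_eq pressure_value_def)
  moreover have "pressure lam t = ereal (ln (4 * lam powr t * (1 - lam) powr t))" if "lam powr t \<ge> 1 / 2" for t
    using that by (simp only: pressure_eq pressure_value_upper ln_four)
  moreover have "phase_transition 2 (\<lambda>t. real_of_ereal (pressure lam t)) (- ln 2 / ln lam)"
    using phase_transition_pressure_value by (simp add: pressure_eq)
  moreover have "lam powr 0 = 1" using assms by simp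
  ultimately show ?thesis
    using absolutely_continuous_equilibrium_measure
    by (auto simp: equilibrium_state_iff measure_of_maximal_entropy_def)
qed

end
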